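(* Suppose that $\beta^{(1)}_{p,n}(\boldsymbol\delta_\phi)\ge0$. Let $$\xi_0(W)=\max\left[\min\left(1,\frac{1}{n g_1(W)}\right),\ \frac{1}{g_1(W)}\left(\frac1n-\frac{1+W}{n+p+1}\right)\right],$$ $$\eta_0(W)=\min\left[1,\ \frac{1}{g_1(W)}\left(\frac1n+g_3(W)\right)\right].$$ Then $\hat{\boldsymbol M}(\xi_0,\eta_0;\boldsymbol\delta_\phi)$ improves on $\hat{\boldsymbol M}_0(\boldsymbol\delta_\phi)$, as an estimator of $\boldsymbol M(\boldsymbol\delta_\phi)$, under the loss $L(\hat{\boldsymbol M};\boldsymbol M(\boldsymbol\delta_\phi))=\mathrm{tr}\,(\hat{\boldsymbol M}-\boldsymbol M(\boldsymbol\delta_\phi))^2$.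
   Context: Let $p\ge 3$, $n\ge1$, and let $\boldsymbol X\sim N_p(\boldsymbol\theta,\sigma^2 I_p)$ and $S\sim\sigma^2\chi^2_n$ be independent, with $\boldsymbol\theta\in\mathbb R^p$ and $\sigma^2>0$ both unknown. Put $W=\|\boldsymbol X\|^2/S$. Consider the shrinkage estimator $\boldsymbol\delta_\phi=\left(1-\frac{\phi(W)}{W}\right)\boldsymbol X$, where $\phi$ is a locally absolutely continuous real function with $\phi$ and $\phi'$ finite, such that $\boldsymbol\delta_\phi$ improves on $\boldsymbol X$ under squared error loss. Its MSE matrix is $\boldsymbol M(\boldsymbol\delta_\phi)=E[(\boldsymbol\delta_\phi-\boldsymbol\theta)(\boldsymbol\delta_\phi-\boldsymbol\theta)']$. For $i=1,2$ put $$g_i(W)=W^{n/2}\int_W^\infty t^{-n/2}\,\frac{h_i(t)}{t}\,dt,\quad h_1(W)=\frac{\phi(W)}{W},\quad h_2(W)=2\left(\frac{\phi(W)}{W}-\phi'(W)\right),\quad g_3(W)=g_2(W)+\frac{\phi^2(W)}{W}.$$ It is assumed that $g_1$ is nonincreasing (and it is understood that $g_1(W)>0$). For functions $\xi,\eta$ define, with $\boldsymbol P=\boldsymbol X\boldsymbol X'/\|\boldsymbol X\|^2$, $$\hat{\boldsymbol M}(\xi,\eta;\boldsymbol\delta_\phi)=S\left\{\left(\frac1n-g_1(W)\xi(W)\right)(I_p-\boldsymbol P)+\left(\frac1n-g_1(W)\eta(W)+g_3(W)\right)\boldsymbol P\right\}.$$ The case $\xi\equiv\eta\equiv1$, denoted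 $\hat{\boldsymbol M}_0(\boldsymbol\delta_\phi)$, is the uniformly minimum variance unbiased estimator of $\boldsymbol M(\boldsymbol\delta_\phi)$. Let $$b(W)=\frac{4\phi(W)}{W}+\frac{(n+2)\phi^2(W)}{W}-4\phi'(W)-4\phi(W)\phi'(W).$$ For integers $j\ge0$ let $u\sim\chi^2_{p+2j}$ and $v\sim\chi^2_n$ be independent and set $$\beta^{(1)}_{p,n}(j;\boldsymbol\delta_\phi)=E\left[\frac{2(p-1)\phi(u/v)}{u/v}-\frac{(p+2j-1)\,b(u/v)}{p+2j}\right],\qquad \beta^{(1)}_{p,n}(\boldsymbol\delta_\phi)=\inf_{j\ge0}\beta^{(1)}_{p,n}(j;\boldsymbol\delta_\phi).$$ An estimator improves on another under a given loss if its risk (expected loss) is less than or equal to that of the other for all $(\boldsymbol\theta,\sigma^2)$. *)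

theory Defs
  imports "HOL-Probability.Probability"
begin

definition absolutely_continuous_on_cbox :: "real \<Rightarrow> real \<Rightarrow> (real \<Rightarrow> real) \<Rightarrow> bool" where
  "absolutely_continuous_on_cbox a b f \<longleftrightarrow>
     (\<forall>\<epsilon>>0. \<exists>\<delta>>0. \<forall>D :: (real \<times> real) set.
        finite D \<longrightarrow>
        (\<forall>(x, y)\<in>D. a \<le> x \<and> x \<le> y \<and> y \<le> b) \<longrightarrow>
        pairwise (\<lambda>I J. disjnt {fst I<..<snd I} {fst J<..<snd J}) D \<longrightarrow>
        (\<Sum>(x, y)\<in>D. y - x) < \<delta> \<longrightarrow>
        (\<Sum>(x, y)\<in>D. \<bar>f y - f x\<bar>) < \<epsilon>)"

definition locally_absolutely_continuous_on :: "real set \<Rightarrow> (real \<Rightarrow> real) \<Rightarrow> bool" where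
  "locally_absolutely_continuous_on T f \<longleftrightarrow>
     (\<forall>a b. {a..b} \<subseteq> T \<longrightarrow> absolutely_continuous_on_cbox a b f)"

definition chi_square_density :: "nat \<Rightarrow> real \<Rightarrow> real" where
  "chi_square_density k x =
     (if x > 0
      then x powr (real k / 2 - 1) * exp (- x / 2) / (2 powr (real k / 2) * Gamma (real k / 2))
      else 0)"

definition chi_square :: "nat \<Rightarrow> real measure" where
  "chi_square k = density lborel (\<lambda>x. ennreal (chi_square_density k x))"

text \<open>The law of a vector with independent coordinates \<open>x $ i\<close>, normal with mean
  \<open>\<theta> $ i\<close> and variance \<open>\<sigma>2\<close>. Note that the second argument of the library's
  \<^const>\<open>normal_density\<close> is the standard deviation.\<close>

definition spherical_normal :: "(real^'p) \<Rightarrow> real \<Rightarrow> (real^'p) measure" where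
  "spherical_normal \<theta> \<sigma>2 =
     density lborel (\<lambda>x. ennreal (\<Prod>i\<in>UNIV. normal_density (\<theta> $ i) (sqrt \<sigma>2) (x $ i)))"

text \<open>The joint law of \<open>(X, S)\<close>. Estimators are functions of the pair \<open>(x, s)\<close>, and
  expectations are integrals with respect to this law.\<close>

definition model :: "nat \<Rightarrow> (real^'p) \<Rightarrow> real \<Rightarrow> ((real^'p) \<times> real) measure" where
  "model n \<theta> \<sigma>2 =
     spherical_normal \<theta> \<sigma>2 \<Otimes>\<^sub>M distr (chi_square n) borel (\<lambda>v. \<sigma>2 * v)"

text \<open>A loss takes the estimate and the parameters \<open>\<theta>\<close>, \<open>\<sigma>2\<close>. All losses used below are
  nonnegative, so the risk always makes sense in \<open>[0, \<infinity>]\<close>.\<close>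

definition risk ::
  "nat \<Rightarrow> ('d \<Rightarrow> (real^'p) \<Rightarrow> real \<Rightarrow> real) \<Rightarrow> ((real^'p) \<times> real \<Rightarrow> 'd) \<Rightarrow> (real^'p) \<Rightarrow> real \<Rightarrow> ennreal"
  where "risk n L d \<theta> \<sigma>2 = (\<integral>\<^sup>+ z. ennreal (L (d z) \<theta> \<sigma>2) \<partial>model n \<theta> \<sigma>2)"

definition improves_on ::
  "nat \<Rightarrow> ('d \<Rightarrow> (real^'p) \<Rightarrow> real \<Rightarrow> real) \<Rightarrow> ((real^'p) \<times> real \<Rightarrow> 'd) \<Rightarrow> ((real^'p) \<times> real \<Rightarrow> 'd) \<Rightarrow> bool"
  where "improves_on n L d d' \<longleftrightarrow> (\<forall>\<theta> \<sigma>2. \<sigma>2 > 0 \<longrightarrow> risk n L d \<theta> \<sigma>2 \<le> risk n L d' \<theta> \<sigma>2)"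

definition squared_error_loss :: "(real^'p) \<Rightarrow> (real^'p) \<Rightarrow> real \<Rightarrow> real" where
  "squared_error_loss d \<theta> \<sigma>2 = (norm (d - \<theta>))\<^sup>2"

definition outer :: "(real^'p) \<Rightarrow> (real^'p) \<Rightarrow> real^'p^'p" where
  "outer x y = (\<chi> i j. x $ i * y $ j)"

definition W_stat :: "(real^'p) \<times> real \<Rightarrow> real" where
  "W_stat = (\<lambda>(x, s). (norm x)\<^sup>2 / s)"

definition P_stat :: "(real^'p) \<times> real \<Rightarrow> real^'p^'p" where
  "P_stat = (\<lambda>(x, s). (1 / (norm x)\<^sup>2) *\<^sub>R outer x x)"

definition shrinkage :: "(real \<Rightarrow> real) \<Rightarrow> (real^'p) \<times> real \<Rightarrow> real^'p" where
  "shrinkage \<phi> z = (1 - \<phi> (W_stat z) / W_stat z) *\<^sub>R fst z"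

definition mse_matrix :: "nat \<Rightarrow> ((real^'p) \<times> real \<Rightarrow> real^'p) \<Rightarrow> (real^'p) \<Rightarrow> real \<Rightarrow> real^'p^'p" where
  "mse_matrix n d \<theta> \<sigma>2 = (\<integral>z. outer (d z - \<theta>) (d z - \<theta>) \<partial>model n \<theta> \<sigma>2)"

definition mse_matrix_loss ::
  "nat \<Rightarrow> ((real^'p) \<times> real \<Rightarrow> real^'p) \<Rightarrow> real^'p^'p \<Rightarrow> (real^'p) \<Rightarrow> real \<Rightarrow> real" where
  "mse_matrix_loss n d Mh \<theta> \<sigma>2 =
     trace ((Mh - mse_matrix n d \<theta> \<sigma>2) ** (Mh - mse_matrix n d \<theta> \<sigma>2))"

text \<open>The function \<open>\<phi>\<close> need only be differentiable almost everywhere. The derivative enters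
  exclusively under integrals, and \<^term>\<open>deriv \<phi>\<close> takes one fixed value at all points where
  \<open>\<phi>\<close> is not differentiable.\<close>

definition h1 :: "(real \<Rightarrow> real) \<Rightarrow> real \<Rightarrow> real" where
  "h1 \<phi> w = \<phi> w / w"

definition h2 :: "(real \<Rightarrow> real) \<Rightarrow> real \<Rightarrow> real" where
  "h2 \<phi> w = 2 * (\<phi> w / w - deriv \<phi> w)"

definition tail_transform :: "nat \<Rightarrow> (real \<Rightarrow> real) \<Rightarrow> real \<Rightarrow> real" where
  "tail_transform n h w =
     w powr (real n / 2) * (LINT t:{w<..}|lborel. t powr (- (real n / 2)) * (h t / t))"

definition g1 :: "nat \<Rightarrow> (real \<Rightarrow> real) \<Rightarrow> real \<Rightarrow> real" where
  "g1 n \<phi> = tail_transform n (h1 \<phi>)"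

definition g2 :: "nat \<Rightarrow> (real \<Rightarrow> real) \<Rightarrow> real \<Rightarrow> real" where
  "g2 n \<phi> = tail_transform n (h2 \<phi>)"

definition g3 :: "nat \<Rightarrow> (real \<Rightarrow> real) \<Rightarrow> real \<Rightarrow> real" where
  "g3 n \<phi> w = g2 n \<phi> w + (\<phi> w)\<^sup>2 / w"

definition M_hat ::
  "nat \<Rightarrow> (real \<Rightarrow> real) \<Rightarrow> (real \<Rightarrow> real) \<Rightarrow> (real \<Rightarrow> real) \<Rightarrow> (real^'p) \<times> real \<Rightarrow> real^'p^'p" where
  "M_hat n \<phi> \<xi> \<eta> z =
     (let w = W_stat z; P = P_stat z in
      snd z *\<^sub>R
        ((1 / real n - g1 n \<phi> w * \<xi> w) *\<^sub>R (mat 1 - P) +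
         (1 / real n - g1 n \<phi> w * \<eta> w + g3 n \<phi> w) *\<^sub>R P))"

definition M_hat0 :: "nat \<Rightarrow> (real \<Rightarrow> real) \<Rightarrow> (real^'p) \<times> real \<Rightarrow> real^'p^'p" where
  "M_hat0 n \<phi> = M_hat n \<phi> (\<lambda>_. 1) (\<lambda>_. 1)"

definition b_fun :: "nat \<Rightarrow> (real \<Rightarrow> real) \<Rightarrow> real \<Rightarrow> real" where
  "b_fun n \<phi> w =
     4 * \<phi> w / w + (real n + 2) * (\<phi> w)\<^sup>2 / w - 4 * deriv \<phi> w - 4 * \<phi> w * deriv \<phi> w"

definition beta1_integrand :: "nat \<Rightarrow> nat \<Rightarrow> (real \<Rightarrow> real) \<Rightarrow> nat \<Rightarrow> real \<times> real \<Rightarrow> real" where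
  "beta1_integrand p n \<phi> j = (\<lambda>(u, v).
     2 * (real p - 1) * \<phi> (u / v) / (u / v)
     - (real p + 2 * real j - 1) * b_fun n \<phi> (u / v) / (real p + 2 * real j))"

definition beta1_at :: "nat \<Rightarrow> nat \<Rightarrow> (real \<Rightarrow> real) \<Rightarrow> nat \<Rightarrow> real" where
  "beta1_at p n \<phi> j =
     (\<integral>z. beta1_integrand p n \<phi> j z \<partial>(chi_square (p + 2 * j) \<Otimes>\<^sub>M chi_square n))"

text \<open>The infimum is taken in the extended reals, since it may be \<open>-\<infinity>\<close>.\<close>

definition beta1 :: "nat \<Rightarrow> nat \<Rightarrow> (real \<Rightarrow> real) \<Rightarrow> ereal" where
  "beta1 p n \<phi> = (INF j. ereal (beta1_at p n \<phi> j))"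

definition xi0 :: "nat \<Rightarrow> nat \<Rightarrow> (real \<Rightarrow> real) \<Rightarrow> real \<Rightarrow> real" where
  "xi0 p n \<phi> w =
     max (min 1 (1 / (real n * g1 n \<phi> w)))
         (1 / g1 n \<phi> w * (1 / real n - (1 + w) / (real n + real p + 1)))"

definition eta0 :: "nat \<Rightarrow> (real \<Rightarrow> real) \<Rightarrow> real \<Rightarrow> real" where
  "eta0 n \<phi> w = min 1 (1 / g1 n \<phi> w * (1 / real n + g3 n \<phi> w))"

end

theory Submission
  imports Defs "HOL-Real_Asymp.Real_Asymp"
begin

text \<open>Put \<open>S' = (S + \<parallel>X\<parallel>\<^sup>2) / (n + p + 1)\<close> and let \<open>M\<close> be the MSE matrix. The function \<open>\<eta>\<^sub>0\<close> and the
  term \<open>min 1 (1 / (n g\<^sub>1))\<close> truncate at zero an eigenvalue of the estimator whose target is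
  nonnegative, which lowers the loss pointwise. The remaining truncation lowers the eigenvalue on
  the complement of \<open>X\<close> to \<open>S'\<close> wherever it is larger. As its target \<open>tr ((I - P) M) / (p - 1)\<close> is at
  most \<open>\<sigma>\<^sup>2\<close>, it suffices that \<open>E (q(W) S (S' - \<sigma>\<^sup>2)) \<ge> 0\<close> for nonnegative \<open>q\<close>. This holds because, given
  \<open>W\<close> and the Poisson index \<open>j\<close> of the noncentral chi-square law of \<open>\<parallel>X\<parallel>\<^sup>2 / \<sigma>\<^sup>2\<close>, the sum
  \<open>(S + \<parallel>X\<parallel>\<^sup>2) / \<sigma>\<^sup>2\<close> is chi-square with \<open>n + p + 2 j\<close> degrees of freedom.

  The bound \<open>tr ((I - P) M) \<le> (p - 1) \<sigma>\<^sup>2\<close> holds for every rank-one projection \<open>P\<close>. Conditioning on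
  \<open>j\<close> reduces it to an integration by parts on the half line that produces the integrand of
  \<open>\<beta>(j)\<close>. The boundary term at \<open>0\<close> vanishes by integrability; the one at infinity could survive only
  if \<open>\<phi>(w)\<^sup>2 / w \<rightarrow> \<infinity>\<close>, which is impossible because \<open>\<delta>\<^sub>\<phi>\<close> improves on \<open>X\<close>. That \<open>\<phi> \<ge> 0\<close>, which is
  used throughout, follows from the positivity and monotonicity of \<open>g\<^sub>1\<close>.\<close>

subsection \<open>Chi-square laws\<close>

text \<open>Expectations live in \<open>ennreal\<close>, and signed identities are stated with
  nonnegative terms on both sides, so that Fubini, power series and Poisson mixtures need no
  integrability; a term is cancelled only once it is known to be finite. Nothing is assumed about
  the moments of phi(W)/W. Its second moment is finite because the estimator improves on X, and the
  first moments follow by elementary bounds such as 2h <= h^2 u + 1/u. The loss is not shown to be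
  measurable, as it involves \<open>g3\<close> and through it \<open>deriv \<phi>\<close>. The risks
  are therefore compared through a gain and a cost built only from S, W and the monotone
  \<open>g1\<close>, using one-sided additivity of the integral. Most constants come from
  size-biasing: weighting a chi-square law by its variable adds two degrees of freedom. Weighted by
  S, the sum in the overview has mean n + p + 2j + 2, which leaves room for the divisor n + p + 1.
  In the integration by parts the mismatch between p - 1 and p + 2j - 1 leaves a multiple of j,
  which is what controls the noncentral part of the risk.\<close>

lemma Gamma_real_ge_0: "(x::real) \<ge> 0 \<Longrightarrow> Gamma x \<ge> 0"
  by (cases "x = 0") (auto intro: Gamma_real_nonneg)

lemma chi_square_density_nonneg: "chi_square_density k x \<ge> 0"
  by (auto simp: chi_square_density_def intro!: divide_nonneg_nonneg mult_nonneg_nonneg Gamma_real_ge_0)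

lemma measurable_chi_square_density [measurable]: "chi_square_density k \<in> borel_measurable borel"
  unfolding chi_square_density_def by measurable

lemma sets_chi_square [measurable_cong, simp]: "sets (chi_square k) = sets borel"
  by (simp add: chi_square_def)

lemma space_chi_square [simp]: "space (chi_square k) = UNIV"
  by (simp add: chi_square_def)

lemma nn_integral_chi_square:
  assumes [measurable]: "f \<in> borel_measurable borel"
  shows "(\<integral>\<^sup>+x. f x \<partial>chi_square k) = (\<integral>\<^sup>+x. ennreal (chi_square_density k x) * f x \<partial>lborel)"
  unfolding chi_square_def by (subst nn_integral_density) auto

lemma sigma_finite_chi_square: "sigma_finite_measure (chi_square k)"
  unfolding chi_square_def
  by (subst sigma_finite_measure.sigma_finite_iff_density_finite)
     (auto simp: sigma_finite_lborel)

lemma AE_chi_square_pos: "AE x in chi_square k. x > 0"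
  unfolding chi_square_def
  by (subst AE_density) (auto simp: chi_square_density_def)

lemma nn_integral_scale:
  assumes [measurable]: "f \<in> borel_measurable borel" and c: "(c::real) > 0"
  shows "(\<integral>\<^sup>+x. f (c * x) \<partial>lborel) = ennreal (1/c) * (\<integral>\<^sup>+x. f x \<partial>lborel)"
  using c by (subst nn_integral_real_affine[of f c 0])
    (auto simp: mult.assoc[symmetric] ennreal_mult[symmetric])

lemma nn_integral_powr_exp:
  assumes a: "(a::real) > 0" and c: "c > 0"
  shows "(\<integral>\<^sup>+x. ennreal (indicator {0<..} x * (x powr (a - 1) * exp (- c * x))) \<partial>lborel)
    = ennreal (Gamma a * c powr (- a))"
proof -
  let ?f = "\<lambda>t. ennreal (indicator {0..} t * t powr (a - 1) / exp t)"
  have f: "(\<integral>\<^sup>+x. ?f (c * x) \<partial>lborel) = ennreal (1/c) * ennreal (Gamma a)"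
    using c by (subst nn_integral_scale) (auto simp: Gamma_conv_nn_integral_real[OF a])
  have "(\<integral>\<^sup>+x. ennreal (indicator {0<..} x * (x powr (a - 1) * exp (- c * x))) \<partial>lborel)
    = (\<integral>\<^sup>+x. ennreal (c powr (1 - a)) * ?f (c * x) \<partial>lborel)"
    using c by (intro nn_integral_cong)
      (auto simp: ennreal_mult[symmetric] indicator_def powr_mult powr_diff exp_minus field_simps zero_le_mult_iff)
  also have "\<dots> = ennreal (c powr (1 - a)) * (ennreal (1/c) * ennreal (Gamma a))"
    unfolding f[symmetric] by (subst nn_integral_cmult) auto
  also have "\<dots> = ennreal (Gamma a * c powr (- a))"
    using c a by (simp add: ennreal_mult[symmetric] powr_diff powr_minus field_simps Gamma_real_nonneg)
  finally show ?thesis .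
qed

lemma chi_square_density_eq:
  "chi_square_density k x =
    indicator {0<..} x * (x powr (real k / 2 - 1) * exp (- (1/2) * x)) *
      (2 powr (- (real k / 2)) / Gamma (real k / 2))"
  by (auto simp: chi_square_density_def indicator_def powr_minus field_simps)

lemma prob_space_chi_square:
  assumes "k > 0"
  shows "prob_space (chi_square k)"
proof
  have g: "Gamma (real k / 2) > 0" using assms by (intro Gamma_real_pos) auto
  have "emeasure (chi_square k) (space (chi_square k)) = (\<integral>\<^sup>+x. 1 \<partial>chi_square k)"
    by simp
  also have "\<dots> = (\<integral>\<^sup>+x. ennreal (indicator {0<..} x * (x powr (real k / 2 - 1) * exp (- (1/2) * x)))
     * ennreal (2 powr (- (real k / 2)) / Gamma (real k / 2)) \<partial>lborel)"
    using g by (subst nn_integral_chi_square) (auto simp: chi_square_density_eq ennreal_mult[symmetric] intro!: nn_integral_cong)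
  also have "\<dots> = ennreal (Gamma (real k / 2) * (1/2) powr (- (real k / 2))) * ennreal (2 powr (- (real k / 2)) / Gamma (real k / 2))"
    using assms by (subst nn_integral_multc, measurable, subst nn_integral_powr_exp) auto
  also have "\<dots> = 1"
    using g by (simp add: ennreal_mult[symmetric] powr_divide powr_minus field_simps powr_add[symmetric])
  finally show "emeasure (chi_square k) (space (chi_square k)) = 1" .
qed

text \<open>Size-biasing: weighting by the variable adds two degrees of freedom, because Gamma(k/2 +
  1) = (k/2) Gamma(k/2).\<close>

lemma chi_square_density_shift:
  assumes "k > 0"
  shows "chi_square_density k x * x = real k * chi_square_density (k + 2) x"
proof -
  have "real k / 2 \<notin> \<int>\<^sub>\<le>\<^sub>0" using assms by (auto simp: nonpos_Ints_def)
  from Gamma_plus1[OF this] have 1: "Gamma (real (k + 2) / 2) = real k / 2 * Gamma (real k / 2)"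
    by (simp add: add_divide_distrib add.commute)
  have 2: "x powr (real (k + 2) / 2 - 1) = x powr (real k / 2 - 1) * x" if "x > 0"
    using that powr_add[of x "real k / 2 - 1" 1] by (simp add: add_divide_distrib)
  have 3: "2 powr (real (k + 2) / 2) = (2::real) powr (real k / 2) * 2"
    using powr_add[of 2 "real k / 2" 1] by (simp add: add_divide_distrib add.commute)
  have "X * e / (P * G) * x = r * (X * x * e / (P * 2 * (r / 2 * G)))"
    if "r > 0" for X e P G r :: real
    using that by (cases "P = 0 \<or> G = 0") auto
  from this[of "real k"] assms show ?thesis
    unfolding chi_square_density_def 1 3 by (cases "x > 0") (simp_all only: 2 if_True if_False mult_zero_left mult_zero_right of_nat_0_less_iff)
qed

lemma nn_integral_chi_square_mult:
  assumes "k > 0" and [measurable]: "f \<in> borel_measurable borel"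
  shows "(\<integral>\<^sup>+x. f x * ennreal x \<partial>chi_square k) = of_nat k * (\<integral>\<^sup>+x. f x \<partial>chi_square (k + 2))"
proof -
  have *: "ennreal (chi_square_density k x) * (f x * ennreal x) =
    of_nat k * (ennreal (chi_square_density (k + 2) x) * f x)" for x
  proof (cases "x > 0")
    case True
    have "ennreal (chi_square_density k x) * (f x * ennreal x) = ennreal (chi_square_density k x * x) * f x"
      using True by (simp add: ennreal_mult chi_square_density_nonneg mult_ac)
    also have "\<dots> = of_nat k * (ennreal (chi_square_density (k + 2) x) * f x)"
      by (subst chi_square_density_shift[OF assms(1)])
         (simp add: ennreal_mult chi_square_density_nonneg mult_ac ennreal_of_nat_eq_real_of_nat)
    finally show ?thesis .
  qed (auto simp: chi_square_density_def)
  show ?thesis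
    by (simp add: nn_integral_chi_square * nn_integral_cmult)
qed

lemma nn_integral_Beta:
  assumes a: "(a::real) > 0" and b: "b > 0" and t: "t > 0"
  shows "(\<integral>\<^sup>+x. ennreal (indicator {0<..<t} x * (x powr (a - 1) * (t - x) powr (b - 1))) \<partial>lborel)
    = ennreal (Beta a b * t powr (a + b - 1))"
proof -
  have 1: "(\<integral>\<^sup>+x. ennreal (indicator {0<..<1} x * (x powr (a - 1) * (1 - x) powr (b - 1))) \<partial>lborel) = ennreal (Beta a b)"
  proof -
    have "((\<lambda>x. x powr (a - 1) * (1 - x) powr (b - 1)) has_integral Beta a b) {0<..<1}"
      using has_integral_Beta_real[OF a b] by (simp add: has_integral_Icc_iff_Ioo)
    from nn_integral_has_integral_lebesgue[OF _ this] show ?thesis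
      by (simp add: indicator_def mult_ac)
  qed
  have "(\<integral>\<^sup>+x. ennreal (indicator {0<..<t} x * (x powr (a - 1) * (t - x) powr (b - 1))) \<partial>lborel)
     = ennreal t * (\<integral>\<^sup>+x. ennreal (indicator {0<..<t} (t * x) * ((t * x) powr (a - 1) * (t - t * x) powr (b - 1))) \<partial>lborel)"
    using t by (subst nn_integral_real_affine[where c=t and t=0]) auto
  also have "(\<integral>\<^sup>+x. ennreal (indicator {0<..<t} (t * x) * ((t * x) powr (a - 1) * (t - t * x) powr (b - 1))) \<partial>lborel)
    = (\<integral>\<^sup>+x. ennreal (t powr (a + b - 2)) * ennreal (indicator {0<..<1} x * (x powr (a - 1) * (1 - x) powr (b - 1))) \<partial>lborel)"
  proof (rule nn_integral_cong, goal_cases)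
    case (1 x)
    show ?case
    proof (cases "0 < x \<and> x < 1")
      case True
      then have "t - t * x = t * (1 - x)" "t * x < t" using t by (auto simp: algebra_simps)
      moreover have "t powr (a + b - 2) = t powr (a - 1) * t powr (b - 1)"
        by (simp add: powr_add[symmetric])
      ultimately show ?thesis using True t
        by (simp add: indicator_def powr_mult ennreal_mult[symmetric] mult_ac)
    next
      case False
      then show ?thesis using t by (auto simp: indicator_def zero_less_mult_iff)
    qed
  qed
  also have "\<dots> = ennreal (t powr (a + b - 2)) * ennreal (Beta a b)"
    by (subst nn_integral_cmult) (auto simp: 1)
  also have "ennreal t * \<dots> = ennreal (Beta a b * t powr (a + b - 1))"
    using t a b powr_add[of t "a + b - 2" 1]
    by (simp add: ennreal_mult[symmetric] Beta_def Gamma_real_nonneg mult_ac)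
  finally show ?thesis .
qed

text \<open>In the convolution of the densities the exponentials multiply to a function of the sum
  alone. What remains is the integral of \<open>nn_integral_Beta\<close>, whose value combines with
  the Gamma constants.\<close>

lemma chi_square_convolution:
  assumes a: "a > 0" and b: "b > 0" and [measurable]: "g \<in> borel_measurable borel"
  shows "(\<integral>\<^sup>+x. \<integral>\<^sup>+y. g (x + y) \<partial>chi_square b \<partial>chi_square a) = (\<integral>\<^sup>+t. g t \<partial>chi_square (a + b))"
proof -
  let ?fa = "\<lambda>x. ennreal (chi_square_density a x)" and ?fb = "\<lambda>x. ennreal (chi_square_density b x)"
  have dens: "(\<integral>\<^sup>+x. ?fa x * ?fb (t - x) \<partial>lborel) = ennreal (chi_square_density (a + b) t)" for t
  proof (cases "t > 0")
    case False
    then have *: "?fa x * ?fb (t - x) = 0" for x by (auto simp: chi_square_density_def)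
    show ?thesis using False unfolding * by (simp add: chi_square_density_def)
  next
    case True
    define c where "c = exp (- (1/2) * t) * (2 powr (- (real a / 2)) / Gamma (real a / 2)) * (2 powr (- (real b / 2)) / Gamma (real b / 2))"
    have c: "c \<ge> 0" unfolding c_def by (intro mult_nonneg_nonneg divide_nonneg_nonneg Gamma_real_ge_0) auto
    have "(\<integral>\<^sup>+x. ?fa x * ?fb (t - x) \<partial>lborel) =
      (\<integral>\<^sup>+x. ennreal c * ennreal (indicator {0<..<t} x * (x powr (real a / 2 - 1) * (t - x) powr (real b / 2 - 1))) \<partial>lborel)"
    proof (rule nn_integral_cong, goal_cases)
      case (1 x)
      have "exp (- (1/2) * t) = exp (- (1/2) * x) * exp (- (1/2) * (t - x))"
        by (simp add: exp_add[symmetric] field_simps)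
      then show ?case
        using c by (simp add: ennreal_mult[symmetric] chi_square_density_nonneg)
          (simp add: chi_square_density_eq c_def indicator_def mult_ac)
    qed
    also have "\<dots> = ennreal c * ennreal (Beta (real a / 2) (real b / 2) * t powr (real a / 2 + real b / 2 - 1))"
      using a b True by (subst nn_integral_cmult) (auto simp: nn_integral_Beta)
    also have "\<dots> = ennreal (chi_square_density (a + b) t)"
    proof -
      have G: "Gamma (real a / 2) > 0" "Gamma (real b / 2) > 0" using a b by (auto intro: Gamma_real_pos)
      have "E * (p1 / x) * (p2 / y) * (x * y / z * T) = T * E * (p1 * p2 / z)"
        if "x > 0" "y > 0" for E p1 p2 x y z T :: real using that by simp
      moreover have "(2::real) powr (- (real a / 2)) * 2 powr (- (real b / 2)) = 2 powr (- (real (a + b) / 2))"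
        by (simp add: powr_add[symmetric] add_divide_distrib)
      ultimately have "c * (Beta (real a / 2) (real b / 2) * t powr (real a / 2 + real b / 2 - 1)) = chi_square_density (a + b) t"
        using True G by (simp add: chi_square_density_eq c_def Beta_def add_divide_distrib)
      then show ?thesis using c
        by (simp add: ennreal_mult'[symmetric])
    qed
    finally show ?thesis .
  qed
  have "(\<integral>\<^sup>+x. \<integral>\<^sup>+y. g (x + y) \<partial>chi_square b \<partial>chi_square a)
    = (\<integral>\<^sup>+x. ?fa x * (\<integral>\<^sup>+y. ?fb y * g (x + y) \<partial>lborel) \<partial>lborel)"
    by (subst nn_integral_chi_square) (auto simp: nn_integral_chi_square)
  also have "\<dots> = (\<integral>\<^sup>+x. (\<integral>\<^sup>+t. ?fa x * ?fb (t - x) * g t \<partial>lborel) \<partial>lborel)"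
  proof (rule nn_integral_cong, goal_cases)
    case (1 x)
    have "(\<integral>\<^sup>+y. ?fb y * g (x + y) \<partial>lborel) = (\<integral>\<^sup>+t. ?fb (t - x) * g t \<partial>lborel)"
      by (subst nn_integral_real_affine[where c=1 and t="-x"]) auto
    then show ?case
      by (simp add: nn_integral_cmult[symmetric] mult_ac)
  qed
  also have "\<dots> = (\<integral>\<^sup>+t. (\<integral>\<^sup>+x. ?fa x * ?fb (t - x) * g t \<partial>lborel) \<partial>lborel)"
    by (rule lborel_pair.Fubini') measurable
  also have "\<dots> = (\<integral>\<^sup>+t. ennreal (chi_square_density (a + b) t) * g t \<partial>lborel)"
    by (simp add: nn_integral_multc dens)
  finally show ?thesis by (simp add: nn_integral_chi_square)
qed

text \<open>For independent chi-square variables \<open>u\<close> and \<open>v\<close> with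
  \<open>m\<close> and \<open>n\<close> degrees of freedom, this is the density of
  \<open>u / v\<close> weighted by \<open>v ^ k\<close>. For \<open>k = 0\<close> it is the beta
  prime density.\<close>

definition ratio_weight :: "nat \<Rightarrow> nat \<Rightarrow> nat \<Rightarrow> real \<Rightarrow> real" where
  "ratio_weight m n k w = indicator {0<..} w *
     (2 ^ k * Gamma (real (m + n) / 2 + real k) / (Gamma (real m / 2) * Gamma (real n / 2)) *
      (w powr (real m / 2 - 1) * (1 + w) powr (- (real (m + n) / 2 + real k))))"

lemma measurable_ratio_weight [measurable]: "ratio_weight m n k \<in> borel_measurable borel"
  unfolding ratio_weight_def by measurable

lemma ratio_weight_nonneg: "ratio_weight m n k w \<ge> 0"
  unfolding ratio_weight_def
  by (intro mult_nonneg_nonneg divide_nonneg_nonneg Gamma_real_ge_0) auto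

text \<open>Given \<open>u / v = w\<close>, the sum u + v = v (1 + w) is chi-square with
  \<open>m + n\<close> degrees of freedom; weighted by \<open>v ^ k\<close> it has mean
  \<open>m + n + 2 * k\<close>. The case \<open>k = 0\<close> serves the integration by parts,
  \<open>k = 1\<close> the truncation.\<close>

lemma ratio_weight_Suc:
  assumes "m > 0" "n > 0"
  shows "ratio_weight m n (Suc k) w * (1 + w) = real (m + n + 2 * k) * ratio_weight m n k w"
proof (cases "w > 0")
  case True
  have "real (m + n) / 2 + real k > 0" using assms by (simp add: add_pos_nonneg)
  then have "real (m + n) / 2 + real k \<notin> \<int>\<^sub>\<le>\<^sub>0" by (auto simp: nonpos_Ints_def)
  from Gamma_plus1[OF this]
  have "Gamma (real (m + n) / 2 + real (Suc k)) = (real (m + n) / 2 + real k) * Gamma (real (m + n) / 2 + real k)"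
    by (simp add: add_ac)
  moreover have "(1 + w) powr (- (real (m + n) / 2 + real k)) = (1 + w) powr (- (real (m + n) / 2 + real (Suc k))) * (1 + w)"
    using True powr_add[of "1 + w" "- (real (m + n) / 2 + real (Suc k))" 1] by (simp add: algebra_simps)
  ultimately show ?thesis using True
    by (simp add: ratio_weight_def del: of_nat_add of_nat_Suc)
qed (simp add: ratio_weight_def)

text \<open>Substitute \<open>u = v * w\<close> for fixed \<open>v\<close>, at the price of the
  Jacobian \<open>v\<close>, exchange the integrals, and integrate \<open>v\<close> out as a Gamma
  integral of rate \<open>(1 + w) / 2\<close>.\<close>

lemma nn_integral_ratio:
  assumes m: "m > 0" and n: "n > 0" and [measurable]: "F \<in> borel_measurable borel"
  shows "(\<integral>\<^sup>+u. \<integral>\<^sup>+v. F (u / v) * ennreal v ^ k \<partial>chi_square n \<partial>chi_square m)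
    = (\<integral>\<^sup>+w. F w * ennreal (ratio_weight m n k w) \<partial>lborel)"
proof -
  let ?f = "\<lambda>x. ennreal (chi_square_density m x)" and ?h = "\<lambda>x. ennreal (chi_square_density n x)"
  define C where "C = (2 powr (- (real m / 2)) / Gamma (real m / 2)) * (2 powr (- (real n / 2)) / Gamma (real n / 2))"
  have C: "C \<ge> 0" unfolding C_def by (intro mult_nonneg_nonneg divide_nonneg_nonneg Gamma_real_ge_0) auto
  interpret p: pair_sigma_finite "chi_square m" "chi_square n"
    by (intro pair_sigma_finite.intro sigma_finite_chi_square)
  have inner: "(\<integral>\<^sup>+v. ?h v * ennreal v ^ k * (ennreal v * ?f (v * w)) \<partial>lborel) = ennreal (ratio_weight m n k w)" for w
  proof (cases "w > 0")
    case False
    then have *: "?h v * ennreal v ^ k * (ennreal v * ?f (v * w)) = 0" for v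
      by (cases "v > 0") (auto simp: chi_square_density_def zero_less_mult_iff)
    show ?thesis using False unfolding * by (simp add: ratio_weight_def)
  next
    case True
    have "(\<integral>\<^sup>+v. ?h v * ennreal v ^ k * (ennreal v * ?f (v * w)) \<partial>lborel) =
      (\<integral>\<^sup>+v. ennreal (C * w powr (real m / 2 - 1)) *
         ennreal (indicator {0<..} v * (v powr ((real (m + n) / 2 + real k) - 1) * exp (- ((1 + w) / 2) * v))) \<partial>lborel)"
    proof (rule nn_integral_cong, goal_cases)
      case (1 v)
      show ?case
      proof (cases "v > 0")
        case v: True
        have "v powr ((real (m + n) / 2 + real k) - 1) = v powr ((real n / 2 - 1) + real k + 1 + (real m / 2 - 1))"
          by (simp add: add_divide_distrib algebra_simps)
        also have "\<dots> = v powr (real n / 2 - 1) * v ^ k * v * v powr (real m / 2 - 1)"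
          unfolding powr_add using v by (simp add: powr_realpow)
        finally have 1: "v powr ((real (m + n) / 2 + real k) - 1) = v powr (real n / 2 - 1) * v ^ k * v * v powr (real m / 2 - 1)" .
        have 2: "exp (- ((1 + w) / 2) * v) = exp (- (1/2) * v) * exp (- (1/2) * (v * w))"
          by (simp add: exp_add[symmetric] algebra_simps)
        have "?h v * ennreal v ^ k * (ennreal v * ?f (v * w)) = ennreal (chi_square_density n v * v ^ k * (v * chi_square_density m (v * w)))"
          using v by (simp add: ennreal_mult chi_square_density_nonneg ennreal_power)
        also have "chi_square_density n v * v ^ k * (v * chi_square_density m (v * w)) = 
           (C * w powr (real m / 2 - 1)) * (indicator {0<..} v * (v powr ((real (m + n) / 2 + real k) - 1) * exp (- ((1 + w) / 2) * v)))"
          unfolding 1 2 using v True by (simp add: chi_square_density_eq C_def powr_mult mult_ac)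
        finally show ?thesis using C v by (simp add: ennreal_mult)
      qed (auto simp: chi_square_density_def)
    qed
    also have "\<dots> = ennreal (C * w powr (real m / 2 - 1)) * ennreal (Gamma (real (m + n) / 2 + real k) * ((1 + w) / 2) powr (- (real (m + n) / 2 + real k)))"
      using m n True by (subst nn_integral_cmult, measurable, subst nn_integral_powr_exp) (auto intro: add_pos_nonneg)
    also have "\<dots> = ennreal (ratio_weight m n k w)"
    proof -
      have "2 powr - ((real (m + n) / 2 + real k)) * ((1 + w) / 2) powr (- (real (m + n) / 2 + real k)) = (1 + w) powr (- (real (m + n) / 2 + real k))"
        using powr_mult[of 2 "(1 + w) / 2"] by (metis nonzero_mult_div_cancel_left times_divide_eq_right zero_neq_numeral)
      moreover have "(2::real) powr (- (real m / 2)) * 2 powr (- (real n / 2)) = 2 powr - ((real (m + n) / 2 + real k)) * 2 ^ k"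
        by (simp add: powr_realpow[symmetric] powr_add[symmetric] add_divide_distrib)
      ultimately have "C * ((1 + w) / 2) powr (- (real (m + n) / 2 + real k)) = 2 ^ k / (Gamma (real m / 2) * Gamma (real n / 2)) * (1 + w) powr (- (real (m + n) / 2 + real k))"
        by (simp add: C_def mult_ac)
      moreover have "C * w powr (real m / 2 - 1) * (Gamma (real (m + n) / 2 + real k) * ((1 + w) / 2) powr (- (real (m + n) / 2 + real k)))
        = C * ((1 + w) / 2) powr (- (real (m + n) / 2 + real k)) * (w powr (real m / 2 - 1) * Gamma (real (m + n) / 2 + real k))"
        by (simp only: mult_ac)
      ultimately have "C * w powr (real m / 2 - 1) * (Gamma (real (m + n) / 2 + real k) * ((1 + w) / 2) powr (- (real (m + n) / 2 + real k))) = ratio_weight m n k w"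
        using True by (simp add: ratio_weight_def)
      then show ?thesis using C True by (subst ennreal_mult[symmetric]) (auto intro!: mult_nonneg_nonneg Gamma_real_ge_0)
    qed
    finally show ?thesis .
  qed
  have "(\<integral>\<^sup>+u. \<integral>\<^sup>+v. F (u / v) * ennreal v ^ k \<partial>chi_square n \<partial>chi_square m) = 
    (\<integral>\<^sup>+v. \<integral>\<^sup>+u. F (u / v) * ennreal v ^ k \<partial>chi_square m \<partial>chi_square n)"
    by (rule p.Fubini'[symmetric]) measurable
  also have "\<dots> = (\<integral>\<^sup>+v. ?h v * (\<integral>\<^sup>+u. ?f u * (F (u / v) * ennreal v ^ k) \<partial>lborel) \<partial>lborel)"
    by (subst nn_integral_chi_square) (auto simp: nn_integral_chi_square)
  also have "\<dots> = (\<integral>\<^sup>+v. (\<integral>\<^sup>+w. F w * (?h v * ennreal v ^ k * (ennreal v * ?f (v * w))) \<partial>lborel) \<partial>lborel)"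
  proof (rule nn_integral_cong, goal_cases)
    case (1 v)
    show ?case
    proof (cases "v > 0")
      case True
      have "(\<integral>\<^sup>+u. ?f u * (F (u / v) * ennreal v ^ k) \<partial>lborel) = ennreal v * (\<integral>\<^sup>+w. ?f (v * w) * (F w * ennreal v ^ k) \<partial>lborel)"
        using True by (subst nn_integral_real_affine[where c=v and t=0]) auto
      then show ?thesis
        by (simp add: nn_integral_cmult[symmetric] mult_ac)
    qed (simp add: chi_square_density_def)
  qed
  also have "\<dots> = (\<integral>\<^sup>+w. (\<integral>\<^sup>+v. F w * (?h v * ennreal v ^ k * (ennreal v * ?f (v * w))) \<partial>lborel) \<partial>lborel)"
    by (rule lborel_pair.Fubini') measurable
  also have "\<dots> = (\<integral>\<^sup>+w. F w * ennreal (ratio_weight m n k w) \<partial>lborel)"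
    by (subst nn_integral_cmult) (auto simp: inner)
  finally show ?thesis .
qed

subsection \<open>Poisson mixtures and noncentral chi-square laws\<close>

text \<open>The Poisson mean is \<open>l / 2\<close>, so that \<open>l\<close> is the noncentrality
  parameter of the chi-square law mixed with these weights.\<close>

definition poisson_weight :: "real \<Rightarrow> nat \<Rightarrow> real" where
  "poisson_weight l j = exp (- l / 2) * (l / 2) ^ j / fact j"

definition poisson_mix :: "real \<Rightarrow> (nat \<Rightarrow> ennreal) \<Rightarrow> ennreal" where
  "poisson_mix l c = (\<Sum>j. ennreal (poisson_weight l j) * c j)"

lemma poisson_weight_nonneg: "l \<ge> 0 \<Longrightarrow> poisson_weight l j \<ge> 0"
  by (simp add: poisson_weight_def)

lemma poisson_mix_add: "poisson_mix l (\<lambda>j. c j + d j) = poisson_mix l c + poisson_mix l d"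
  by (simp add: poisson_mix_def distrib_left suminf_add)

lemma poisson_mix_cmult: "poisson_mix l (\<lambda>j. r * c j) = r * poisson_mix l c"
  unfolding poisson_mix_def by (subst ennreal_suminf_cmult[symmetric]) (simp add: mult_ac)

lemma poisson_mix_mono: "(\<And>j. c j \<le> d j) \<Longrightarrow> poisson_mix l c \<le> poisson_mix l d"
  unfolding poisson_mix_def by (intro suminf_le mult_left_mono) auto

lemma poisson_mix_const:
  assumes "l \<ge> 0"
  shows "poisson_mix l (\<lambda>_. c) = c"
proof -
  have "(\<lambda>j. (l / 2) ^ j /\<^sub>R fact j) sums exp (l / 2)"
    by (rule exp_converges)
  then have "(\<lambda>j. exp (- l / 2) * ((l / 2) ^ j /\<^sub>R fact j)) sums (exp (- l / 2) * exp (l / 2))"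
    by (rule sums_mult)
  then have "poisson_weight l sums 1"
    by (simp add: poisson_weight_def[abs_def] exp_minus field_simps)
  then have "(\<Sum>j. ennreal (poisson_weight l j)) = ennreal 1"
    by (intro suminf_ennreal_eq poisson_weight_nonneg assms)
  then show ?thesis by (simp add: poisson_mix_def)
qed

text \<open>The Poisson identity E (J c(J)) = (l/2) E c(J + 1). It trades a factor in the index for
  the noncentrality and a shift, which later appears as two more degrees of freedom.\<close>

lemma poisson_mix_shift:
  assumes "l \<ge> 0"
  shows "poisson_mix l (\<lambda>j. of_nat (2 * j) * c j) = ennreal l * poisson_mix l (\<lambda>j. c (Suc j))"
proof -
  have *: "poisson_weight l (Suc j) * (2 * real (Suc j)) = l * poisson_weight l j" for j
    by (simp add: poisson_weight_def field_simps del: of_nat_Suc)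
  have "poisson_mix l (\<lambda>j. of_nat (2 * j) * c j) =
    (\<Sum>j. ennreal (poisson_weight l (Suc j)) * (of_nat (2 * Suc j) * c (Suc j)))"
    unfolding poisson_mix_def
    by (subst suminf_offset[where i=1]) auto
  also have "\<dots> = (\<Sum>j. ennreal l * (ennreal (poisson_weight l j) * c (Suc j)))"
  proof (rule suminf_cong, goal_cases)
    case (1 j)
    have "ennreal (poisson_weight l (Suc j)) * (of_nat (2 * Suc j) * c (Suc j)) =
      ennreal (poisson_weight l (Suc j) * (2 * real (Suc j))) * c (Suc j)"
      using assms by (subst ennreal_mult)
        (auto simp: poisson_weight_nonneg mult.assoc ennreal_of_nat_eq_real_of_nat simp del: of_nat_Suc mult_Suc_right)
    then show ?case
      unfolding * using assms by (simp add: ennreal_mult poisson_weight_nonneg mult_ac)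
  qed
  finally show ?thesis by (simp add: poisson_mix_def)
qed

lemma suminf_swap_ennreal: "(\<Sum>i. \<Sum>j. f i j) = (\<Sum>j. \<Sum>i. f i j :: ennreal)"
proof -
  have "(\<Sum>i. \<Sum>j. f i j) = (\<Sum>i. \<integral>\<^sup>+j. f i j \<partial>count_space UNIV)"
    by (simp add: nn_integral_count_space_nat)
  also have "\<dots> = (\<integral>\<^sup>+j. (\<Sum>i. f i j) \<partial>count_space UNIV)"
    by (rule nn_integral_suminf[symmetric]) simp
  finally show ?thesis by (simp add: nn_integral_count_space_nat)
qed

text \<open>A sum of independent Poisson variables is Poisson; the weights combine by the binomial
  theorem.\<close>

lemma poisson_mix_convolution:
  assumes l: "l \<ge> 0" "m \<ge> 0"
  shows "poisson_mix l (\<lambda>i. poisson_mix m (\<lambda>j. c (i + j))) = poisson_mix (l + m) c"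
proof -
  let ?F = "\<lambda>i j. ennreal (poisson_weight l i) * (ennreal (poisson_weight m j) * c (i + j))"
  have "poisson_mix l (\<lambda>i. poisson_mix m (\<lambda>j. c (i + j))) = (\<Sum>i. \<Sum>j. ?F i j)"
    by (simp add: poisson_mix_def)
  \<comment> \<open>Filling the triangle \<open>i \<le> k\<close> up with zeros makes the double sum
    rectangular, so that the two sums can be exchanged.\<close>
  also have "\<dots> = (\<Sum>i. \<Sum>k. if i \<le> k then ?F i (k - i) else 0)"
  proof (rule suminf_cong, goal_cases)
    case (1 i)
    show ?case
      by (subst (2) suminf_offset[where i=i]) auto
  qed
  also have "\<dots> = (\<Sum>k. \<Sum>i. if i \<le> k then ?F i (k - i) else 0)"
    by (rule suminf_swap_ennreal)
  also have "\<dots> = (\<Sum>k. ennreal (poisson_weight (l + m) k) * c k)"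
  proof (rule suminf_cong, goal_cases)
    case (1 k)
    have "(\<Sum>i. if i \<le> k then ?F i (k - i) else 0) = (\<Sum>i\<le>k. ?F i (k - i))"
      by (subst suminf_finite[where N="{..k}"]) auto
    also have "\<dots> = (\<Sum>i\<le>k. ennreal (poisson_weight l i * poisson_weight m (k - i)) * c k)"
      using l by (intro sum.cong) (auto simp: ennreal_mult poisson_weight_nonneg mult_ac)
    also have "\<dots> = ennreal (\<Sum>i\<le>k. poisson_weight l i * poisson_weight m (k - i)) * c k"
      using l by (simp add: sum_distrib_right[symmetric] sum_ennreal poisson_weight_nonneg)
    also have "(\<Sum>i\<le>k. poisson_weight l i * poisson_weight m (k - i)) = poisson_weight (l + m) k"
    proof -
      have "((l + m) / 2) ^ k / fact k = (\<Sum>i\<le>k. (l / 2) ^ i / fact i * ((m / 2) ^ (k - i) / fact (k - i)))"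
        unfolding add_divide_distrib binomial_ring sum_divide_distrib
        by (intro sum.cong) (auto simp: binomial_fact)
      moreover have "exp (- (l + m) / 2) = exp (- l / 2) * exp (- m / 2)"
        by (simp add: exp_add[symmetric] field_simps)
      ultimately have "poisson_weight (l + m) k = exp (- l / 2) * exp (- m / 2) *
          (\<Sum>i\<le>k. (l / 2) ^ i / fact i * ((m / 2) ^ (k - i) / fact (k - i)))"
        unfolding poisson_weight_def by (metis times_divide_eq_right)
      then show ?thesis
        by (simp add: poisson_weight_def sum_distrib_left mult_ac)
    qed
    finally show ?case .
  qed
  finally show ?thesis by (simp add: poisson_mix_def)
qed

text \<open>Substitution on \<open>{0..real k}\<close> and monotone convergence in \<open>k\<close>
  give the claim for indicators. This is an equality of two measures, which covers every other
  integrand.\<close>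

lemma nn_integral_square:
  assumes [measurable]: "f \<in> borel_measurable borel"
  shows "(\<integral>\<^sup>+x. ennreal (indicator {0<..} x * (2 * x)) * f (x\<^sup>2) \<partial>lborel) = (\<integral>\<^sup>+t. indicator {0<..} t * f t \<partial>lborel)"
proof -
  let ?D = "density lborel (\<lambda>x::real. ennreal (indicator {0<..} x * (2 * x)))"
  have "distr ?D borel (\<lambda>x. x\<^sup>2) = density lborel (indicator {0<..})"
  proof (rule measure_eqI)
    fix A assume "A \<in> sets (distr ?D borel (\<lambda>x. x\<^sup>2))"
    then have A[measurable]: "A \<in> sets borel" by simp
    have fin: "(\<integral>\<^sup>+t. ennreal (indicator A t * indicator {0..(real k)\<^sup>2} t) \<partial>lborel) =
      (\<integral>\<^sup>+x. ennreal (indicator A (x\<^sup>2) * (2 * x) * indicator {0..real k} x) \<partial>lborel)" for k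
    proof -
      have d: "((\<lambda>x. x\<^sup>2) has_real_derivative 2 * x) (at x)" for x :: real
        by (auto intro!: derivative_eq_intros)
      show ?thesis
        using nn_integral_substitution[of "\<lambda>x. x\<^sup>2" 0 "real k" "indicator A" "\<lambda>x. 2 * x", OF _ d]
        by (auto intro!: continuous_intros simp: set_borel_measurable_def)
    qed
    have mono: "incseq (\<lambda>k. indicator {0..real k} x :: real)" for x :: real
      by (intro incseq_SucI) (auto simp: indicator_def)
    have "emeasure (distr ?D borel (\<lambda>x. x\<^sup>2)) A = (\<integral>\<^sup>+x. ennreal (indicator {0<..} x * (2 * x)) * indicator A (x\<^sup>2) \<partial>lborel)"
    proof -
      have "emeasure (distr ?D borel (\<lambda>x. x\<^sup>2)) A = (\<integral>\<^sup>+t. indicator A t \<partial>distr ?D borel (\<lambda>x. x\<^sup>2))"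
        by (simp del: nn_integral_distr)
      also have "\<dots> = (\<integral>\<^sup>+x. ennreal (indicator {0<..} x * (2 * x)) * indicator A (x\<^sup>2) \<partial>lborel)"
        by (subst nn_integral_distr) (auto simp: nn_integral_density)
      finally show ?thesis .
    qed
    also have "\<dots> = (\<integral>\<^sup>+x. (SUP k. ennreal (indicator A (x\<^sup>2) * (2 * x) * indicator {0..real k} x)) \<partial>lborel)"
    proof (rule nn_integral_cong, goal_cases)
      case (1 x)
      show ?case
      proof (cases "x > 0")
        case True
        obtain n where "x \<le> real n" using real_arch_simple by blast
        with True show ?thesis
          by (intro antisym SUP_upper2[of n] SUP_least) (auto simp: indicator_def)
      next
        case False
        then have "ennreal (indicator A (x\<^sup>2) * (2 * x) * indicator {0..real k} x) = 0" for k
          by (auto simp: indicator_def)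
        then show ?thesis using False by simp
      qed
    qed
    also have "\<dots> = (SUP k. \<integral>\<^sup>+x. ennreal (indicator A (x\<^sup>2) * (2 * x) * indicator {0..real k} x) \<partial>lborel)"
      by (intro nn_integral_monotone_convergence_SUP) (auto intro!: incseq_SucI le_funI ennreal_leI simp: indicator_def)
    also have "\<dots> = (SUP k. \<integral>\<^sup>+t. ennreal (indicator A t * indicator {0..(real k)\<^sup>2} t) \<partial>lborel)"
      by (simp only: fin)
    also have "\<dots> = (\<integral>\<^sup>+t. (SUP k. ennreal (indicator A t * indicator {0..(real k)\<^sup>2} t)) \<partial>lborel)"
      by (intro nn_integral_monotone_convergence_SUP[symmetric])
         (auto intro!: incseq_SucI le_funI ennreal_leI simp: indicator_def power2_eq_square algebra_simps)
    also have "\<dots> = (\<integral>\<^sup>+t. indicator {0<..} t * indicator A t \<partial>lborel)"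
    proof (intro nn_integral_cong_AE, use AE_lborel_singleton[of "0::real"] in eventually_elim)
      fix t :: real assume "t \<noteq> 0"
      show "(SUP k. ennreal (indicator A t * indicator {0..(real k)\<^sup>2} t)) = indicator {0<..} t * indicator A t"
      proof (cases "t > 0")
        case True
        obtain n where "max t 1 \<le> real n" using real_arch_simple by blast
        then have "t \<le> real n" "1 \<le> real n" by auto
        then have "t \<le> (real n)\<^sup>2" by (metis order_trans self_le_power zero_less_numeral)
        with True show ?thesis
          by (intro antisym SUP_upper2[of n] SUP_least) (auto simp: indicator_def)
      qed (use \<open>t \<noteq> 0\<close> in \<open>auto simp: indicator_def\<close>)
    qed
    also have "\<dots> = emeasure (density lborel (indicator {0<..})) A"
      by (subst emeasure_density) (auto simp: mult_ac)
    finally show "emeasure (distr ?D borel (\<lambda>x. x\<^sup>2)) A = emeasure (density lborel (indicator {0<..})) A" .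
  qed simp
  then have "(\<integral>\<^sup>+t. f t \<partial>distr ?D borel (\<lambda>x. x\<^sup>2)) = (\<integral>\<^sup>+t. f t \<partial>density lborel (indicator {0<..}))" by simp
  then show ?thesis
    by (simp add: nn_integral_distr nn_integral_density)
qed

section \<open>Folding normal densities at the origin\<close>

lemma nn_integral_reflect:
  fixes f :: "real \<Rightarrow> ennreal"
  assumes [measurable]: "f \<in> borel_measurable borel"
  shows "(\<integral>\<^sup>+x. f (- x) \<partial>lborel) = (\<integral>\<^sup>+x. f x \<partial>lborel)"
  by (subst (2) nn_integral_real_affine[where c="-1" and t=0]) auto

lemma nn_integral_symmetrize:
  fixes f :: "real \<Rightarrow> ennreal"
  assumes [measurable]: "f \<in> borel_measurable borel"
  shows "2 * (\<integral>\<^sup>+x. f x \<partial>lborel) = (\<integral>\<^sup>+x. f x + f (- x) \<partial>lborel)"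
  by (subst nn_integral_add) (auto simp: nn_integral_reflect mult_2)

lemma nn_integral_even:
  fixes f :: "real \<Rightarrow> ennreal"
  assumes [measurable]: "f \<in> borel_measurable borel" and e: "\<And>x. f (- x) = f x"
  shows "(\<integral>\<^sup>+x. f x \<partial>lborel) = 2 * (\<integral>\<^sup>+x. indicator {0<..} x * f x \<partial>lborel)"
proof -
  have "(\<integral>\<^sup>+x. f x \<partial>lborel) = (\<integral>\<^sup>+x. indicator {0<..} x * f x + indicator {0<..} (- x) * f (- x) \<partial>lborel)"
  proof (intro nn_integral_cong_AE, use AE_lborel_singleton[of "0::real"] in eventually_elim)
    fix x :: real assume "x \<noteq> 0"
    then show "f x = indicator {0<..} x * f x + indicator {0<..} (- x) * f (- x)"
      by (cases "x > 0") (auto simp: indicator_def e)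
  qed
  then show ?thesis by (simp add: nn_integral_symmetrize)
qed

lemma std_normal_square_chi_square:
  assumes [measurable]: "g \<in> borel_measurable borel"
  shows "(\<integral>\<^sup>+x. g (x\<^sup>2) * ennreal (std_normal_density x) \<partial>lborel) = (\<integral>\<^sup>+t. g t \<partial>chi_square 1)"
proof -
  have "(\<integral>\<^sup>+x. g (x\<^sup>2) * ennreal (std_normal_density x) \<partial>lborel) =
    2 * (\<integral>\<^sup>+x. indicator {0<..} x * (g (x\<^sup>2) * ennreal (std_normal_density x)) \<partial>lborel)"
    by (rule nn_integral_even) (auto simp: std_normal_density_def)
  also have "\<dots> = (\<integral>\<^sup>+x. ennreal (indicator {0<..} x * (2 * x)) * (ennreal (chi_square_density 1 (x\<^sup>2)) * g (x\<^sup>2)) \<partial>lborel)"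
  proof (subst nn_integral_cmult[symmetric], simp, intro nn_integral_cong, goal_cases)
    case (1 x)
    show ?case
    proof (cases "x > 0")
      case True
      have "std_normal_density x = x * chi_square_density 1 (x\<^sup>2)"
        using True by (simp add: std_normal_density_def chi_square_density_def Gamma_one_half_real
          powr_half_sqrt powr_minus powr_minus_divide real_sqrt_mult powr_power[symmetric] field_simps)
      then show ?thesis using True
        by (simp add: ennreal_mult chi_square_density_nonneg mult_ac)
    qed simp
  qed
  also have "\<dots> = (\<integral>\<^sup>+t. indicator {0<..} t * (ennreal (chi_square_density 1 t) * g t) \<partial>lborel)"
    by (rule nn_integral_square) measurable
  also have "\<dots> = (\<integral>\<^sup>+t. ennreal (chi_square_density 1 t) * g t \<partial>lborel)"
    by (intro nn_integral_cong) (auto simp: indicator_def chi_square_density_def)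
  finally show ?thesis by (simp add: nn_integral_chi_square)
qed

text \<open>Iterated size-biasing. The constant is (2j - 1)!!, the moment of order
  \<open>2 * j\<close> of a standard normal variable.\<close>

lemma chi_square_1_power:
  assumes [measurable]: "g \<in> borel_measurable borel"
  shows "(\<integral>\<^sup>+t. g t * ennreal t ^ j \<partial>chi_square 1) = ennreal (fact (2 * j) / (2 ^ j * fact j)) * (\<integral>\<^sup>+t. g t \<partial>chi_square (1 + 2 * j))"
  using assms
proof (induction j arbitrary: g)
  case 0
  then show ?case by simp
next
  case (Suc j)
  note [measurable] = Suc.prems
  have "(\<integral>\<^sup>+t. g t * ennreal t ^ Suc j \<partial>chi_square 1) = (\<integral>\<^sup>+t. (g t * ennreal t) * ennreal t ^ j \<partial>chi_square 1)"
    by (simp add: mult_ac)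
  also have "\<dots> = ennreal (fact (2 * j) / (2 ^ j * fact j)) * (of_nat (1 + 2 * j) * (\<integral>\<^sup>+t. g t \<partial>chi_square (1 + 2 * j + 2)))"
    by (subst Suc.IH, measurable, subst nn_integral_chi_square_mult) auto
  also have "\<dots> = ennreal (fact (2 * j) / (2 ^ j * fact j) * real (1 + 2 * j)) * (\<integral>\<^sup>+t. g t \<partial>chi_square (1 + 2 * Suc j))"
    by (subst ennreal_mult) (auto simp: ennreal_of_nat_eq_real_of_nat mult_ac)
  also have "fact (2 * j) / (2 ^ j * fact j) * real (1 + 2 * j) = fact (2 * Suc j) / (2 ^ Suc j * fact (Suc j))"
  proof -
    have 1: "fact (2 * Suc j) = 2 * real (Suc j) * real (1 + 2 * j) * fact (2 * j)"
      by (simp add: algebra_simps)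
    have 2: "fact (Suc j) = real (Suc j) * fact j" by simp
    show ?thesis unfolding 1 2 by (simp del: of_nat_Suc of_nat_add)
  qed
  finally show ?case .
qed

lemma measurable_cosh_sinh [measurable]:
  "cosh \<in> borel_measurable (borel :: real measure)" "sinh \<in> borel_measurable (borel :: real measure)"
  by (auto intro!: borel_measurable_continuous_onI continuous_intros)

lemma even_exp_series:
  "(\<lambda>j. y ^ (2 * j) / fact (2 * j)) sums cosh (y::real)"
  "(\<lambda>j. y ^ (2 * j + 2) / fact (2 * j + 1)) sums (y * sinh y)"
proof -
  have "(\<lambda>j. if even (2 * j) then y ^ (2 * j) /\<^sub>R fact (2 * j) else 0) sums cosh y"
    using cosh_converges[of y]
    by (subst sums_mono_reindex[of "\<lambda>j. 2 * j" "\<lambda>n. if even n then y ^ n /\<^sub>R fact n else 0"])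
       (auto simp: strict_mono_def elim!: evenE)
  then show "(\<lambda>j. y ^ (2 * j) / fact (2 * j)) sums cosh y"
    by (simp add: divide_inverse mult_ac)
  have "(\<lambda>j. if even (2 * j + 1) then 0 else y ^ (2 * j + 1) /\<^sub>R fact (2 * j + 1)) sums sinh y"
    using sinh_converges[of y]
    by (subst sums_mono_reindex[of "\<lambda>j. 2 * j + 1" "\<lambda>n. if even n then 0 else y ^ n /\<^sub>R fact n"])
       (auto simp: strict_mono_def elim!: oddE)
  from sums_mult[OF this, of y] show "(\<lambda>j. y ^ (2 * j + 2) / fact (2 * j + 1)) sums (y * sinh y)"
    by (simp add: divide_inverse mult_ac)
qed

lemma even_powers_normal:
  assumes [measurable]: "g \<in> borel_measurable borel"
  shows "(\<integral>\<^sup>+x. g (x\<^sup>2) * (ennreal ((x\<^sup>2) ^ j) * ennreal (std_normal_density x)) \<partial>lborel)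
    = ennreal (fact (2 * j) / (2 ^ j * fact j)) * (\<integral>\<^sup>+t. g t \<partial>chi_square (1 + 2 * j))"
proof -
  have "(\<integral>\<^sup>+x. g (x\<^sup>2) * (ennreal ((x\<^sup>2) ^ j) * ennreal (std_normal_density x)) \<partial>lborel) =
    (\<integral>\<^sup>+x. (\<lambda>t. g t * ennreal t ^ j) (x\<^sup>2) * ennreal (std_normal_density x) \<partial>lborel)"
    by (simp add: ennreal_power mult_ac)
  also have "\<dots> = ennreal (fact (2 * j) / (2 ^ j * fact j)) * (\<integral>\<^sup>+t. g t \<partial>chi_square (1 + 2 * j))"
    by (subst std_normal_square_chi_square, measurable, subst chi_square_1_power) auto
  finally show ?thesis .
qed

lemma normal_density_exp:
  "normal_density \<mu> 1 x = std_normal_density x * exp (- (\<mu>\<^sup>2) / 2) * exp (x * \<mu>)"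
proof -
  have "- ((x - \<mu>)\<^sup>2) / 2 = - (x\<^sup>2) / 2 + (- (\<mu>\<^sup>2) / 2) + x * \<mu>"
    by (simp add: power2_eq_square field_simps)
  then have "exp (- ((x - \<mu>)\<^sup>2) / 2) = exp (- (x\<^sup>2) / 2) * exp (- (\<mu>\<^sup>2) / 2) * exp (x * \<mu>)"
    by (simp only: exp_add)
  then show ?thesis by (simp add: normal_density_def std_normal_density_def)
qed

text \<open>All terms are nonnegative, so the series is integrated termwise. The lowest power
  \<open>k\<close> is 0 for cosh and 1 for y sinh y.\<close>

lemma nn_integral_series_normal:
  assumes [measurable]: "g \<in> borel_measurable borel" and c: "\<And>j. c j \<ge> 0"
    and s: "\<And>x. (\<lambda>j. c j * (x\<^sup>2) ^ (j + k)) sums S x"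
  shows "(\<integral>\<^sup>+x. g (x\<^sup>2) * ennreal (std_normal_density x * S x) \<partial>lborel)
     = (\<Sum>j. ennreal (c j * (fact (2 * (j + k)) / (2 ^ (j + k) * fact (j + k)))) * (\<integral>\<^sup>+t. g t \<partial>chi_square (1 + 2 * (j + k))))"
proof -
  have S: "ennreal (S x) = (\<Sum>j. ennreal (c j * (x\<^sup>2) ^ (j + k)))" for x
    by (intro suminf_ennreal_eq[symmetric] s mult_nonneg_nonneg c) auto
  have "(\<integral>\<^sup>+x. g (x\<^sup>2) * ennreal (std_normal_density x * S x) \<partial>lborel) =
    (\<integral>\<^sup>+x. (\<Sum>j. ennreal (c j) * (g (x\<^sup>2) * (ennreal ((x\<^sup>2) ^ (j + k)) * ennreal (std_normal_density x)))) \<partial>lborel)"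
  proof (rule nn_integral_cong, goal_cases)
    case (1 x)
    have "g (x\<^sup>2) * ennreal (std_normal_density x * S x) = (g (x\<^sup>2) * ennreal (std_normal_density x)) * ennreal (S x)"
      by (subst ennreal_mult') (auto simp: mult_ac std_normal_density_def)
    also have "\<dots> = (\<Sum>j. (g (x\<^sup>2) * ennreal (std_normal_density x)) * ennreal (c j * (x\<^sup>2) ^ (j + k)))"
      unfolding S by simp
    also have "\<dots> = (\<Sum>j. ennreal (c j) * (g (x\<^sup>2) * (ennreal ((x\<^sup>2) ^ (j + k)) * ennreal (std_normal_density x))))"
      using c by (intro suminf_cong) (auto simp: ennreal_mult mult_ac)
    finally show ?case .
  qed
  also have "\<dots> = (\<Sum>j. \<integral>\<^sup>+x. ennreal (c j) * (g (x\<^sup>2) * (ennreal ((x\<^sup>2) ^ (j + k)) * ennreal (std_normal_density x))) \<partial>lborel)"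
    by (rule nn_integral_suminf) measurable
  also have "\<dots> = (\<Sum>j. ennreal (c j * (fact (2 * (j + k)) / (2 ^ (j + k) * fact (j + k)))) * (\<integral>\<^sup>+t. g t \<partial>chi_square (1 + 2 * (j + k))))"
  proof (rule suminf_cong, goal_cases)
    case (1 j)
    show ?case
      using c by (subst nn_integral_cmult, measurable, subst even_powers_normal, measurable, subst ennreal_mult)
        (auto simp: mult.assoc)
  qed
  finally show ?thesis .
qed

text \<open>Adding the values at \<open>x\<close> and \<open>- x\<close> turns the tilt exp(x \<mu>)
  into cosh(x \<mu>). Its series has nonnegative coefficients, which together with the normal
  moments become Poisson weights.\<close>

lemma noncentral_square:
  assumes [measurable]: "g \<in> borel_measurable borel"
  shows "(\<integral>\<^sup>+x. g (x\<^sup>2) * ennreal (normal_density \<mu> 1 x) \<partial>lborel)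
    = poisson_mix (\<mu>\<^sup>2) (\<lambda>j. \<integral>\<^sup>+t. g t \<partial>chi_square (1 + 2 * j))"
proof -
  let ?I = "\<integral>\<^sup>+x. g (x\<^sup>2) * ennreal (normal_density \<mu> 1 x) \<partial>lborel"
  let ?S = "\<lambda>x. exp (- (\<mu>\<^sup>2) / 2) * cosh (x * \<mu>)"
  have "2 * ?I = (\<integral>\<^sup>+x. 2 * (g (x\<^sup>2) * ennreal (std_normal_density x * ?S x)) \<partial>lborel)"
  proof (subst nn_integral_symmetrize, measurable, intro nn_integral_cong, goal_cases)
    case (1 x)
    have "g (x\<^sup>2) * ennreal (normal_density \<mu> 1 x) + g ((- x)\<^sup>2) * ennreal (normal_density \<mu> 1 (- x)) =
      g (x\<^sup>2) * ennreal (normal_density \<mu> 1 x + normal_density \<mu> 1 (- x))"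
      by (simp add: distrib_left)
    also have "normal_density \<mu> 1 x + normal_density \<mu> 1 (- x) = 2 * (std_normal_density x * ?S x)"
      by (simp add: normal_density_exp[of \<mu>] cosh_field_def std_normal_density_def algebra_simps add_divide_distrib)
    finally show ?case
      by (simp add: ennreal_mult' mult_ac)
  qed
  then have "?I = (\<integral>\<^sup>+x. g (x\<^sup>2) * ennreal (std_normal_density x * ?S x) \<partial>lborel)"
    by (simp add: nn_integral_cmult ennreal_mult_cancel_left)
  also have "\<dots> = (\<Sum>j. ennreal (exp (- (\<mu>\<^sup>2) / 2) * ((\<mu>\<^sup>2) ^ j / fact (2 * j)) * (fact (2 * (j + 0)) / (2 ^ (j + 0) * fact (j + 0)))) *
      (\<integral>\<^sup>+t. g t \<partial>chi_square (1 + 2 * (j + 0))))"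
  proof (rule nn_integral_series_normal)
    fix x
    show "(\<lambda>j. exp (- (\<mu>\<^sup>2) / 2) * ((\<mu>\<^sup>2) ^ j / fact (2 * j)) * (x\<^sup>2) ^ (j + 0)) sums ?S x"
    proof -
      have "(x * \<mu>) ^ (2 * j) = (x\<^sup>2) ^ j * (\<mu>\<^sup>2) ^ j" for j
        by (simp only: power_mult power_mult_distrib)
      with sums_mult[OF even_exp_series(1)[of "x * \<mu>"], of "exp (- (\<mu>\<^sup>2) / 2)"]
      show ?thesis by (simp add: mult_ac)
    qed
  qed auto
  also have "\<dots> = poisson_mix (\<mu>\<^sup>2) (\<lambda>j. \<integral>\<^sup>+t. g t \<partial>chi_square (1 + 2 * j))"
    by (simp add: poisson_mix_def poisson_weight_def power_divide)
  finally show ?thesis .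
qed

text \<open>The expectation of g(x^2) x \<mu> has no fixed sign, so its positive part is equated
  with its negative part plus a remainder. Folding leaves y sinh y with y = x \<mu>, whose series
  starts at the second power; hence the 3 degrees of freedom.\<close>

lemma noncentral_signed:
  assumes [measurable]: "g \<in> borel_measurable borel"
  shows "(\<integral>\<^sup>+x. g (x\<^sup>2) * ennreal (x * \<mu>) * ennreal (normal_density \<mu> 1 x) \<partial>lborel)
    = (\<integral>\<^sup>+x. g (x\<^sup>2) * ennreal (- (x * \<mu>)) * ennreal (normal_density \<mu> 1 x) \<partial>lborel)
      + ennreal (\<mu>\<^sup>2) * poisson_mix (\<mu>\<^sup>2) (\<lambda>j. \<integral>\<^sup>+t. g t \<partial>chi_square (3 + 2 * j))"
proof -
  let ?P = "\<integral>\<^sup>+x. g (x\<^sup>2) * ennreal (x * \<mu>) * ennreal (normal_density \<mu> 1 x) \<partial>lborel"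
  let ?N = "\<integral>\<^sup>+x. g (x\<^sup>2) * ennreal (- (x * \<mu>)) * ennreal (normal_density \<mu> 1 x) \<partial>lborel"
  let ?S = "\<lambda>x. exp (- (\<mu>\<^sup>2) / 2) * (x * \<mu> * sinh (x * \<mu>))"
  let ?Q = "\<integral>\<^sup>+x. g (x\<^sup>2) * ennreal (std_normal_density x * ?S x) \<partial>lborel"
  have "2 * ?P = (\<integral>\<^sup>+x. (g (x\<^sup>2) * ennreal (- (x * \<mu>)) * ennreal (normal_density \<mu> 1 x) + g ((- x)\<^sup>2) * ennreal (- (- x * \<mu>)) * ennreal (normal_density \<mu> 1 (- x)))
    + 2 * (g (x\<^sup>2) * ennreal (std_normal_density x * ?S x)) \<partial>lborel)"
  proof (subst nn_integral_symmetrize, measurable, intro nn_integral_cong, goal_cases)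
    case (1 x)
    define K where "K = std_normal_density x * exp (- (\<mu>\<^sup>2) / 2)"
    have K: "K \<ge> 0" by (simp add: K_def)
    have n: "normal_density \<mu> 1 x = K * exp (x * \<mu>)" "normal_density \<mu> 1 (- x) = K * exp (- (x * \<mu>))"
      by (auto simp: normal_density_exp[of \<mu>] K_def std_normal_density_def)
    have S: "std_normal_density x * ?S x = K * (x * \<mu> * sinh (x * \<mu>))" by (simp add: K_def)
    \<comment> \<open>After folding, the positive part exceeds the negative part by a multiple of y
      (exp y - exp(-y)), which is nonnegative for either sign of \<open>y\<close>.\<close>
    have e: "ennreal y * ennreal (K * exp y) + ennreal (- y) * ennreal (K * exp (- y)) =
      (ennreal (- y) * ennreal (K * exp y) + ennreal y * ennreal (K * exp (- y))) + 2 * ennreal (K * (y * sinh y))" for y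
    proof -
      have s: "2 * ennreal (K * (y * sinh y)) = ennreal (y * K * exp y - y * K * exp (- y))"
      proof -
        have "y * K * exp y - y * K * exp (- y) = 2 * (K * (y * sinh y))"
          by (simp add: sinh_field_def algebra_simps)
        then show ?thesis by (simp add: ennreal_mult')
      qed
      show ?thesis
      proof (cases "y \<ge> 0")
        case True
        then have "y * K * exp y - y * K * exp (- y) \<ge> 0"
          using K by (simp add: mult_left_mono)
        with True K show ?thesis unfolding s
          by (simp add: ennreal_neg ennreal_mult'[symmetric] ennreal_plus[symmetric] mult_ac del: ennreal_plus)
      next
        case False
        then have "y * K * exp y - y * K * exp (- y) \<ge> 0"
          using K by (simp add: mult_left_mono_neg mult_nonpos_nonneg)
        moreover have "K * (y * exp y) \<le> 0" "K * (y * exp (- y)) \<le> 0"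
          using False K by (simp_all add: mult_nonneg_nonpos mult_nonpos_nonneg)
        ultimately show ?thesis unfolding s using False K
          by (simp add: ennreal_neg ennreal_mult'[symmetric] ennreal_plus[symmetric] mult_ac del: ennreal_plus)
      qed
    qed
    have "g (x\<^sup>2) * ennreal (x * \<mu>) * ennreal (normal_density \<mu> 1 x) + g ((- x)\<^sup>2) * ennreal (- x * \<mu>) * ennreal (normal_density \<mu> 1 (- x))
      = g (x\<^sup>2) * (ennreal (x * \<mu>) * ennreal (K * exp (x * \<mu>)) + ennreal (- (x * \<mu>)) * ennreal (K * exp (- (x * \<mu>))))"
      by (simp add: n distrib_left mult.assoc)
    then show ?case
      unfolding e by (simp only: S n) (simp add: distrib_left mult_ac)
  qed
  also have "\<dots> = 2 * ?N + 2 * ?Q"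
  proof -
    have N: "2 * ?N = (\<integral>\<^sup>+x. g (x\<^sup>2) * ennreal (- (x * \<mu>)) * ennreal (normal_density \<mu> 1 x) + g ((- x)\<^sup>2) * ennreal (- (- x * \<mu>)) * ennreal (normal_density \<mu> 1 (- x)) \<partial>lborel)"
      by (rule nn_integral_symmetrize) measurable
    have Q: "2 * ?Q = (\<integral>\<^sup>+x. 2 * (g (x\<^sup>2) * ennreal (std_normal_density x * ?S x)) \<partial>lborel)"
      by (rule nn_integral_cmult[symmetric]) measurable
    show ?thesis unfolding N Q
      by (rule nn_integral_add) measurable
  qed
  finally have "2 * ?P = 2 * (?N + ?Q)"
    by (simp only: distrib_left)
  moreover have "a = b" if "2 * a = 2 * b" for a b :: ennreal
    using that by (simp add: ennreal_mult_cancel_left)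
  ultimately have "?P = ?N + ?Q" by blast
  also have "?Q = (\<Sum>j. ennreal (exp (- (\<mu>\<^sup>2) / 2) * ((\<mu>\<^sup>2) ^ (j + 1) / fact (2 * j + 1)) * (fact (2 * (j + 1)) / (2 ^ (j + 1) * fact (j + 1)))) *
      (\<integral>\<^sup>+t. g t \<partial>chi_square (1 + 2 * (j + 1))))"
  proof (rule nn_integral_series_normal)
    fix x
    show "(\<lambda>j. exp (- (\<mu>\<^sup>2) / 2) * ((\<mu>\<^sup>2) ^ (j + 1) / fact (2 * j + 1)) * (x\<^sup>2) ^ (j + 1)) sums ?S x"
    proof -
      have e: "(x * \<mu>) ^ (2 * j + 2) = (x\<^sup>2) ^ (j + 1) * (\<mu>\<^sup>2) ^ (j + 1)" for j
      proof -
        have "2 * j + 2 = 2 * (j + 1)" by simp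
        then show ?thesis by (simp only: power_mult power_mult_distrib)
      qed
      show ?thesis
        using sums_mult[OF even_exp_series(2)[of "x * \<mu>"], of "exp (- (\<mu>\<^sup>2) / 2)"]
        unfolding e by (simp only: times_divide_eq_right times_divide_eq_left mult_ac)
    qed
  qed auto
  also have "\<dots> = (\<Sum>j. ennreal (\<mu>\<^sup>2) * (ennreal (poisson_weight (\<mu>\<^sup>2) j) * (\<integral>\<^sup>+t. g t \<partial>chi_square (3 + 2 * j))))"
  proof (rule suminf_cong, goal_cases)
    case (1 j)
    have 1: "fact (2 * (j + 1)) = 2 * real (Suc j) * fact (2 * j + 1)"
      by (simp add: algebra_simps)
    have 2: "fact (j + 1) = real (Suc j) * fact j" by simp
    have "exp (- (\<mu>\<^sup>2) / 2) * ((\<mu>\<^sup>2) ^ (j + 1) / fact (2 * j + 1)) * (fact (2 * (j + 1)) / (2 ^ (j + 1) * fact (j + 1))) = \<mu>\<^sup>2 * poisson_weight (\<mu>\<^sup>2) j"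
      unfolding 1 2 poisson_weight_def by (simp add: power_divide del: of_nat_Suc fact_Suc)
    then show ?case
      by (simp add: ennreal_mult poisson_weight_nonneg mult_ac numeral_3_eq_3)
  qed
  finally show ?thesis by (simp add: poisson_mix_def)
qed

section \<open>Rescaling to a general standard deviation\<close>

lemma nn_integral_normal_scale:
  assumes [measurable]: "f \<in> borel_measurable borel" and s: "\<sigma> > 0"
  shows "(\<integral>\<^sup>+x. f x * ennreal (normal_density \<mu> \<sigma> x) \<partial>lborel) = (\<integral>\<^sup>+z. f (\<sigma> * z) * ennreal (normal_density (\<mu> / \<sigma>) 1 z) \<partial>lborel)"
proof -
  have "(\<integral>\<^sup>+x. f x * ennreal (normal_density \<mu> \<sigma> x) \<partial>lborel) = ennreal \<sigma> * (\<integral>\<^sup>+z. f (\<sigma> * z) * ennreal (normal_density \<mu> \<sigma> (\<sigma> * z)) \<partial>lborel)"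
    using s by (subst nn_integral_real_affine[where c=\<sigma> and t=0]) auto
  also have "\<dots> = (\<integral>\<^sup>+z. f (\<sigma> * z) * (ennreal \<sigma> * ennreal (normal_density \<mu> \<sigma> (\<sigma> * z))) \<partial>lborel)"
    by (subst nn_integral_cmult[symmetric]) (auto simp: mult_ac)
  also have "\<dots> = (\<integral>\<^sup>+z. f (\<sigma> * z) * ennreal (normal_density (\<mu> / \<sigma>) 1 z) \<partial>lborel)"
  proof (rule nn_integral_cong, goal_cases)
    case (1 z)
    have "\<sigma> * z - \<mu> = \<sigma> * (z - \<mu> / \<sigma>)" using s by (simp add: field_simps)
    then have "(\<sigma> * z - \<mu>)\<^sup>2 / (2 * \<sigma>\<^sup>2) = (z - \<mu> / \<sigma>)\<^sup>2 / 2"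
      using s by (simp add: power_mult_distrib)
    then have "\<sigma> * normal_density \<mu> \<sigma> (\<sigma> * z) = normal_density (\<mu> / \<sigma>) 1 z"
      using s by (simp add: normal_density_def real_sqrt_mult)
    then show ?case
      using s by (simp add: ennreal_mult'[symmetric])
  qed
  finally show ?thesis .
qed

lemma normal_square_mix:
  assumes [measurable]: "g \<in> borel_measurable borel" and s: "\<sigma> > 0"
  shows "(\<integral>\<^sup>+x. g (x\<^sup>2) * ennreal (normal_density \<mu> \<sigma> x) \<partial>lborel)
    = poisson_mix ((\<mu> / \<sigma>)\<^sup>2) (\<lambda>j. \<integral>\<^sup>+t. g (\<sigma>\<^sup>2 * t) \<partial>chi_square (1 + 2 * j))"
  using s by (subst nn_integral_normal_scale) (auto simp: power_mult_distrib noncentral_square[of "\<lambda>t. g (\<sigma>\<^sup>2 * t)"])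

text \<open>Size-biasing the component with \<open>1 + 2 * j\<close> degrees of freedom gives the
  factor \<open>1 + 2 * j\<close> and two more degrees. The 1 produces the first term. The part
  \<open>2 * j\<close> moves to \<open>5 + 2 * j\<close> by \<open>poisson_mix_shift\<close>, and
  \<open>\<sigma>\<^sup>2\<close> times the noncentrality is \<open>\<mu>\<^sup>2\<close>.\<close>

lemma normal_square_moment_mix:
  assumes [measurable]: "g \<in> borel_measurable borel" and s: "\<sigma> > 0"
  shows "(\<integral>\<^sup>+x. g (x\<^sup>2) * ennreal (x\<^sup>2) * ennreal (normal_density \<mu> \<sigma> x) \<partial>lborel)
    = ennreal (\<sigma>\<^sup>2) * poisson_mix ((\<mu> / \<sigma>)\<^sup>2) (\<lambda>j. \<integral>\<^sup>+t. g (\<sigma>\<^sup>2 * t) \<partial>chi_square (3 + 2 * j))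
      + ennreal (\<mu>\<^sup>2) * poisson_mix ((\<mu> / \<sigma>)\<^sup>2) (\<lambda>j. \<integral>\<^sup>+t. g (\<sigma>\<^sup>2 * t) \<partial>chi_square (5 + 2 * j))"
proof -
  let ?l = "(\<mu> / \<sigma>)\<^sup>2"
  let ?C = "\<lambda>k. \<integral>\<^sup>+t. g (\<sigma>\<^sup>2 * t) \<partial>chi_square k"
  have "(\<integral>\<^sup>+x. g (x\<^sup>2) * ennreal (x\<^sup>2) * ennreal (normal_density \<mu> \<sigma> x) \<partial>lborel) =
    poisson_mix ?l (\<lambda>j. \<integral>\<^sup>+t. g (\<sigma>\<^sup>2 * t) * ennreal (\<sigma>\<^sup>2 * t) \<partial>chi_square (1 + 2 * j))"
    using s by (subst normal_square_mix[of "\<lambda>t. g t * ennreal t"]) auto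
  also have "(\<lambda>j. \<integral>\<^sup>+t. g (\<sigma>\<^sup>2 * t) * ennreal (\<sigma>\<^sup>2 * t) \<partial>chi_square (1 + 2 * j))
    = (\<lambda>j. ennreal (\<sigma>\<^sup>2) * (?C (3 + 2 * j) + of_nat (2 * j) * ?C (3 + 2 * j)))"
  proof
    fix j
    have "(\<integral>\<^sup>+t. g (\<sigma>\<^sup>2 * t) * ennreal (\<sigma>\<^sup>2 * t) \<partial>chi_square (1 + 2 * j)) =
      ennreal (\<sigma>\<^sup>2) * (\<integral>\<^sup>+t. g (\<sigma>\<^sup>2 * t) * ennreal t \<partial>chi_square (1 + 2 * j))"
      by (subst nn_integral_cmult[symmetric], measurable, simp only: ennreal_mult' zero_le_power2 mult.left_commute)
    also have "\<dots> = ennreal (\<sigma>\<^sup>2) * (of_nat (1 + 2 * j) * ?C (1 + 2 * j + 2))"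
      by (subst nn_integral_chi_square_mult) auto
    also have "of_nat (1 + 2 * j) * ?C (1 + 2 * j + 2) = ?C (3 + 2 * j) + of_nat (2 * j) * ?C (3 + 2 * j)"
      by (simp add: distrib_right numeral_3_eq_3)
    finally show "(\<integral>\<^sup>+t. g (\<sigma>\<^sup>2 * t) * ennreal (\<sigma>\<^sup>2 * t) \<partial>chi_square (1 + 2 * j))
      = ennreal (\<sigma>\<^sup>2) * (?C (3 + 2 * j) + of_nat (2 * j) * ?C (3 + 2 * j))" .
  qed
  also have "poisson_mix ?l \<dots> = ennreal (\<sigma>\<^sup>2) * (poisson_mix ?l (\<lambda>j. ?C (3 + 2 * j)) + ennreal ?l * poisson_mix ?l (\<lambda>j. ?C (3 + 2 * Suc j)))"
    by (simp only: poisson_mix_cmult poisson_mix_add poisson_mix_shift zero_le_power2)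
  also have "\<dots> = ennreal (\<sigma>\<^sup>2) * poisson_mix ?l (\<lambda>j. ?C (3 + 2 * j)) + (ennreal (\<sigma>\<^sup>2) * ennreal ?l) * poisson_mix ?l (\<lambda>j. ?C (5 + 2 * j))"
    by (simp add: distrib_left mult.assoc eval_nat_numeral)
  also have "ennreal (\<sigma>\<^sup>2) * ennreal ?l = ennreal (\<mu>\<^sup>2)"
    using s by (simp add: ennreal_mult'[symmetric] power_divide)
  finally show ?thesis .
qed

lemma normal_signed_mix:
  assumes [measurable]: "g \<in> borel_measurable borel" and s: "\<sigma> > 0"
  shows "(\<integral>\<^sup>+x. g (x\<^sup>2) * ennreal (x * \<mu>) * ennreal (normal_density \<mu> \<sigma> x) \<partial>lborel)
    = (\<integral>\<^sup>+x. g (x\<^sup>2) * ennreal (- (x * \<mu>)) * ennreal (normal_density \<mu> \<sigma> x) \<partial>lborel)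
      + ennreal (\<mu>\<^sup>2) * poisson_mix ((\<mu> / \<sigma>)\<^sup>2) (\<lambda>j. \<integral>\<^sup>+t. g (\<sigma>\<^sup>2 * t) \<partial>chi_square (3 + 2 * j))"
proof -
  define \<nu> where "\<nu> = \<mu> / \<sigma>"
  have \<mu>: "\<mu> = \<sigma> * \<nu>" using s by (simp add: \<nu>_def)
  have e: "ennreal (\<sigma> * z * \<mu>) = ennreal (\<sigma>\<^sup>2) * ennreal (z * \<nu>)" "ennreal (- (\<sigma> * z * \<mu>)) = ennreal (\<sigma>\<^sup>2) * ennreal (- (z * \<nu>))" for z
  proof -
    have "\<sigma> * z * \<mu> = \<sigma>\<^sup>2 * (z * \<nu>)" "- (\<sigma> * z * \<mu>) = \<sigma>\<^sup>2 * (- (z * \<nu>))"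
      by (simp_all add: \<mu> power2_eq_square)
    then show "ennreal (\<sigma> * z * \<mu>) = ennreal (\<sigma>\<^sup>2) * ennreal (z * \<nu>)" "ennreal (- (\<sigma> * z * \<mu>)) = ennreal (\<sigma>\<^sup>2) * ennreal (- (z * \<nu>))"
      by (simp_all only: ennreal_mult' zero_le_power2)
  qed
  have m: "ennreal (\<mu>\<^sup>2) = ennreal (\<sigma>\<^sup>2) * ennreal (\<nu>\<^sup>2)"
    by (simp add: \<mu> ennreal_mult'[symmetric] power_mult_distrib)
  have "(\<integral>\<^sup>+z. g ((\<sigma> * z)\<^sup>2) * ennreal (\<sigma> * z * \<mu>) * ennreal (normal_density \<nu> 1 z) \<partial>lborel)
    = ennreal (\<sigma>\<^sup>2) * (\<integral>\<^sup>+z. g (\<sigma>\<^sup>2 * z\<^sup>2) * ennreal (z * \<nu>) * ennreal (normal_density \<nu> 1 z) \<partial>lborel)"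
    by (subst nn_integral_cmult[symmetric], measurable, intro nn_integral_cong, simp only: e power_mult_distrib) (simp only: mult_ac)
  also have "\<dots> = ennreal (\<sigma>\<^sup>2) * (\<integral>\<^sup>+z. g (\<sigma>\<^sup>2 * z\<^sup>2) * ennreal (- (z * \<nu>)) * ennreal (normal_density \<nu> 1 z) \<partial>lborel)
    + ennreal (\<mu>\<^sup>2) * poisson_mix (\<nu>\<^sup>2) (\<lambda>j. \<integral>\<^sup>+t. g (\<sigma>\<^sup>2 * t) \<partial>chi_square (3 + 2 * j))"
    by (subst noncentral_signed[of "\<lambda>t. g (\<sigma>\<^sup>2 * t)"]) (auto simp: distrib_left m mult.assoc)
  also have "ennreal (\<sigma>\<^sup>2) * (\<integral>\<^sup>+z. g (\<sigma>\<^sup>2 * z\<^sup>2) * ennreal (- (z * \<nu>)) * ennreal (normal_density \<nu> 1 z) \<partial>lborel)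
    = (\<integral>\<^sup>+z. g ((\<sigma> * z)\<^sup>2) * ennreal (- (\<sigma> * z * \<mu>)) * ennreal (normal_density \<nu> 1 z) \<partial>lborel)"
    by (subst nn_integral_cmult[symmetric], measurable, intro nn_integral_cong, simp only: e power_mult_distrib) (simp only: mult_ac)
  finally show ?thesis
    using s by (simp add: nn_integral_normal_scale[of "\<lambda>x. g (x\<^sup>2) * ennreal (x * \<mu>)"]
      nn_integral_normal_scale[of "\<lambda>x. g (x\<^sup>2) * ennreal (- (x * \<mu>))"] \<nu>_def)
qed

text \<open>Expectation under the noncentral chi-square law with \<open>k\<close> degrees of freedom
  and noncentrality \<open>l\<close>. Kept as a Poisson mixture, it allows inequalities to be proved
  for each index separately.\<close>

definition noncentral :: "nat \<Rightarrow> real \<Rightarrow> (real \<Rightarrow> ennreal) \<Rightarrow> ennreal" where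
  "noncentral k l g = poisson_mix l (\<lambda>j. \<integral>\<^sup>+t. g t \<partial>chi_square (k + 2 * j))"

interpretation chi_square: sigma_finite_measure "chi_square k" for k
  by (rule sigma_finite_chi_square)

lemma measurable_noncentral [measurable (raw)]:
  assumes [measurable]: "case_prod f \<in> borel_measurable (M \<Otimes>\<^sub>M borel)"
  shows "(\<lambda>x. noncentral k l (f x)) \<in> borel_measurable M"
  unfolding noncentral_def poisson_mix_def by measurable

lemma normal_square_noncentral:
  assumes [measurable]: "g \<in> borel_measurable borel" and s: "\<sigma> > 0"
  shows "(\<integral>\<^sup>+x. g (x\<^sup>2) * ennreal (normal_density \<mu> \<sigma> x) \<partial>lborel)
      = noncentral 1 ((\<mu> / \<sigma>)\<^sup>2) (\<lambda>t. g (\<sigma>\<^sup>2 * t))"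
    and "(\<integral>\<^sup>+x. g (x\<^sup>2) * ennreal (x\<^sup>2) * ennreal (normal_density \<mu> \<sigma> x) \<partial>lborel)
      = ennreal (\<sigma>\<^sup>2) * noncentral 3 ((\<mu> / \<sigma>)\<^sup>2) (\<lambda>t. g (\<sigma>\<^sup>2 * t))
        + ennreal (\<mu>\<^sup>2) * noncentral 5 ((\<mu> / \<sigma>)\<^sup>2) (\<lambda>t. g (\<sigma>\<^sup>2 * t))"
    and "(\<integral>\<^sup>+x. g (x\<^sup>2) * ennreal (x * \<mu>) * ennreal (normal_density \<mu> \<sigma> x) \<partial>lborel)
      = (\<integral>\<^sup>+x. g (x\<^sup>2) * ennreal (- (x * \<mu>)) * ennreal (normal_density \<mu> \<sigma> x) \<partial>lborel)
        + ennreal (\<mu>\<^sup>2) * noncentral 3 ((\<mu> / \<sigma>)\<^sup>2) (\<lambda>t. g (\<sigma>\<^sup>2 * t))"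
  unfolding noncentral_def
  by (rule normal_square_mix[OF assms] normal_square_moment_mix[OF assms] normal_signed_mix[OF assms])+

text \<open>Given the two Poisson indices the chi-square laws convolve, and the result depends on
  the indices only through their sum, which is again Poisson.\<close>

lemma noncentral_convolution:
  assumes k: "k > 0" "k' > 0" and l: "l \<ge> 0" "m \<ge> 0" and [measurable]: "g \<in> borel_measurable borel"
  shows "noncentral k l (\<lambda>x. noncentral k' m (\<lambda>y. g (x + y))) = noncentral (k + k') (l + m) g"
proof -
  let ?c = "\<lambda>j. \<integral>\<^sup>+t. g t \<partial>chi_square (k + k' + 2 * j)"
  have "(\<integral>\<^sup>+x. noncentral k' m (\<lambda>y. g (x + y)) \<partial>chi_square (k + 2 * i)) = poisson_mix m (\<lambda>j. ?c (i + j))" for i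
  proof -
    have "(\<integral>\<^sup>+x. noncentral k' m (\<lambda>y. g (x + y)) \<partial>chi_square (k + 2 * i)) =
      (\<Sum>j. \<integral>\<^sup>+x. ennreal (poisson_weight m j) * (\<integral>\<^sup>+y. g (x + y) \<partial>chi_square (k' + 2 * j)) \<partial>chi_square (k + 2 * i))"
      unfolding noncentral_def poisson_mix_def by (rule nn_integral_suminf) measurable
    also have "\<dots> = (\<Sum>j. ennreal (poisson_weight m j) * ?c (i + j))"
    proof (rule suminf_cong, goal_cases)
      case (1 j)
      have "(k + 2 * i) + (k' + 2 * j) = k + k' + 2 * (i + j)" by simp
      then show ?case
        using k by (subst nn_integral_cmult, measurable, subst chi_square_convolution) (simp_all only:, auto)
    qed
    finally show ?thesis by (simp add: poisson_mix_def)
  qed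
  then have "noncentral k l (\<lambda>x. noncentral k' m (\<lambda>y. g (x + y))) = poisson_mix l (\<lambda>i. poisson_mix m (\<lambda>j. ?c (i + j)))"
    by (simp add: noncentral_def)
  also have "\<dots> = poisson_mix (l + m) ?c" by (rule poisson_mix_convolution[OF l])
  finally show ?thesis by (simp add: noncentral_def)
qed

text \<open>Stated over product measures rather than vectors, so that coordinates can be split off
  one at a time; \<open>noncentral_convolution\<close> adds up the degrees of freedom and the
  noncentralities.\<close>

lemma sum_squares_noncentral:
  assumes "finite I" "I \<noteq> {}" and \<sigma>: "\<sigma> > 0" and "g \<in> borel_measurable borel"
  shows "(\<integral>\<^sup>+f. g (\<Sum>i\<in>I. (f i)\<^sup>2) * (\<Prod>i\<in>I. ennreal (normal_density (\<theta> i) \<sigma> (f i))) \<partial>Pi\<^sub>M I (\<lambda>_. lborel))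
    = noncentral (card I) (\<Sum>i\<in>I. (\<theta> i / \<sigma>)\<^sup>2) (\<lambda>t. g (\<sigma>\<^sup>2 * t))"
  using assms(1,2,4)
proof (induction I arbitrary: g rule: finite_ne_induct)
  case (singleton i)
  note [measurable] = singleton
  interpret product_sigma_finite "\<lambda>_. lborel :: real measure" ..
  show ?case
    by (simp add: product_nn_integral_singleton[where f="\<lambda>x. g (x\<^sup>2) * ennreal (normal_density (\<theta> i) \<sigma> x)"]
      normal_square_noncentral(1) \<sigma>)
next
  case (insert i I)
  note [measurable] = insert.prems
  interpret product_sigma_finite "\<lambda>_. lborel :: real measure" ..
  let ?l = "\<Sum>i\<in>I. (\<theta> i / \<sigma>)\<^sup>2"
  have "(\<integral>\<^sup>+f. g (\<Sum>i\<in>insert i I. (f i)\<^sup>2) * (\<Prod>i\<in>insert i I. ennreal (normal_density (\<theta> i) \<sigma> (f i))) \<partial>Pi\<^sub>M (insert i I) (\<lambda>_. lborel))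
    = (\<integral>\<^sup>+y. \<integral>\<^sup>+f. g (\<Sum>j\<in>insert i I. ((f(i := y)) j)\<^sup>2) * (\<Prod>j\<in>insert i I. ennreal (normal_density (\<theta> j) \<sigma> ((f(i := y)) j))) \<partial>Pi\<^sub>M I (\<lambda>_. lborel) \<partial>lborel)"
    using insert.hyps by (intro product_nn_integral_insert_rev) auto
  also have "\<dots> = (\<integral>\<^sup>+y. noncentral (card I) ?l (\<lambda>t. g (y\<^sup>2 + \<sigma>\<^sup>2 * t)) * ennreal (normal_density (\<theta> i) \<sigma> y) \<partial>lborel)"
  proof (rule nn_integral_cong, goal_cases)
    case (1 y)
    have e: "(\<Sum>j\<in>insert i I. ((f(i := y)) j)\<^sup>2) = y\<^sup>2 + (\<Sum>j\<in>I. (f j)\<^sup>2)"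
      "(\<Prod>j\<in>insert i I. ennreal (normal_density (\<theta> j) \<sigma> ((f(i := y)) j))) =
        ennreal (normal_density (\<theta> i) \<sigma> y) * (\<Prod>j\<in>I. ennreal (normal_density (\<theta> j) \<sigma> (f j)))" for f :: "'a \<Rightarrow> real"
    proof -
      have j: "(f(i := y)) j = f j" if "j \<in> I" for j using that insert.hyps by auto
      show "(\<Sum>j\<in>insert i I. ((f(i := y)) j)\<^sup>2) = y\<^sup>2 + (\<Sum>j\<in>I. (f j)\<^sup>2)"
        by (subst sum.insert[OF insert.hyps(1,3)]) (simp add: j fun_upd_same del: fun_upd_apply)
      show "(\<Prod>j\<in>insert i I. ennreal (normal_density (\<theta> j) \<sigma> ((f(i := y)) j))) =
        ennreal (normal_density (\<theta> i) \<sigma> y) * (\<Prod>j\<in>I. ennreal (normal_density (\<theta> j) \<sigma> (f j)))"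
        by (subst prod.insert[OF insert.hyps(1,3)]) (simp add: j fun_upd_same del: fun_upd_apply)
    qed
    have "(\<integral>\<^sup>+f. g (\<Sum>j\<in>insert i I. ((f(i := y)) j)\<^sup>2) * (\<Prod>j\<in>insert i I. ennreal (normal_density (\<theta> j) \<sigma> ((f(i := y)) j))) \<partial>Pi\<^sub>M I (\<lambda>_. lborel))
      = (\<integral>\<^sup>+f. ennreal (normal_density (\<theta> i) \<sigma> y) * (g (y\<^sup>2 + (\<Sum>j\<in>I. (f j)\<^sup>2)) * (\<Prod>j\<in>I. ennreal (normal_density (\<theta> j) \<sigma> (f j)))) \<partial>Pi\<^sub>M I (\<lambda>_. lborel))"
      unfolding e by (simp add: mult_ac)
    also have "\<dots> = noncentral (card I) ?l (\<lambda>t. g (y\<^sup>2 + \<sigma>\<^sup>2 * t)) * ennreal (normal_density (\<theta> i) \<sigma> y)"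
      by (subst nn_integral_cmult, measurable, subst insert.IH[of "\<lambda>t. g (y\<^sup>2 + t)"]) (auto simp: mult_ac)
    finally show ?case .
  qed
  also have "\<dots> = noncentral 1 ((\<theta> i / \<sigma>)\<^sup>2) (\<lambda>x. noncentral (card I) ?l (\<lambda>t. g (\<sigma>\<^sup>2 * x + \<sigma>\<^sup>2 * t)))"
    using \<sigma> by (subst normal_square_noncentral(1)[where g="\<lambda>s. noncentral (card I) ?l (\<lambda>t. g (s + \<sigma>\<^sup>2 * t))"]) auto
  also have "\<dots> = noncentral 1 ((\<theta> i / \<sigma>)\<^sup>2) (\<lambda>x. noncentral (card I) ?l (\<lambda>t. g (\<sigma>\<^sup>2 * (x + t))))"
    by (simp add: distrib_left)
  also have "\<dots> = noncentral (1 + card I) ((\<theta> i / \<sigma>)\<^sup>2 + ?l) (\<lambda>t. g (\<sigma>\<^sup>2 * t))"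
    using insert.hyps by (subst noncentral_convolution[where g="\<lambda>t. g (\<sigma>\<^sup>2 * t)"]) (auto simp: card_gt_0_iff sum_nonneg)
  finally show ?case using insert.hyps by simp
qed

subsection \<open>Spherical normal laws\<close>

lemma measurable_spherical_density [measurable]:
  "(\<lambda>x::real^'p. \<Prod>i\<in>UNIV. normal_density (\<theta> $ i) s (x $ i)) \<in> borel_measurable borel"
  by measurable

lemma sets_spherical_normal [measurable_cong, simp]: "sets (spherical_normal \<theta> s) = sets borel"
  by (simp add: spherical_normal_def)

lemma space_spherical_normal [simp]: "space (spherical_normal \<theta> s) = UNIV"
  by (simp add: spherical_normal_def)

lemma nn_integral_spherical_normal:
  assumes [measurable]: "f \<in> borel_measurable borel"
  shows "(\<integral>\<^sup>+x. f x \<partial>spherical_normal \<theta> s)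
    = (\<integral>\<^sup>+x. ennreal (\<Prod>i\<in>UNIV. normal_density (\<theta> $ i) (sqrt s) (x $ i)) * f x \<partial>lborel)"
  unfolding spherical_normal_def by (subst nn_integral_density) auto

lemma prod_Basis_vec: "(\<Prod>b\<in>Basis. F ((\<theta>::real^'p) \<bullet> b) (x \<bullet> b)) = (\<Prod>i\<in>UNIV. F (\<theta> $ i) (x $ i))"
proof -
  have B: "(Basis :: (real^'p) set) = range (\<lambda>i. axis i 1)"
    by (auto simp: Basis_vec_def)
  have inj: "inj (\<lambda>i. axis i 1 :: real^'p)"
    by (auto simp: inj_on_def axis_eq_axis)
  show ?thesis
    unfolding B prod.reindex[OF inj] by (simp add: o_def cart_eq_inner_axis)
qed

text \<open>All coordinates but one enter through the sum of their squares alone, which is a scaled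
  noncentral chi-square variable with one degree of freedom less. The weight \<open>c\<close> of the
  separated coordinate stays arbitrary.\<close>

lemma spherical_normal_coordinate:
  fixes \<theta> :: "real^'p"
  assumes p: "CARD('p) \<ge> 2" and s: "s > 0"
    and [measurable]: "g \<in> borel_measurable borel" "c \<in> borel_measurable borel"
  shows "(\<integral>\<^sup>+x. g ((norm x)\<^sup>2) * c (x $ k) \<partial>spherical_normal \<theta> s)
    = (\<integral>\<^sup>+y. noncentral (CARD('p) - 1) (((norm \<theta>)\<^sup>2 - (\<theta> $ k)\<^sup>2) / s) (\<lambda>t. g (y\<^sup>2 + s * t))
        * c y * ennreal (normal_density (\<theta> $ k) (sqrt s) y) \<partial>lborel)"
proof -
  interpret product_sigma_finite "\<lambda>_. lborel :: real measure" ..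
  let ?k = "axis k 1 :: real^'p"
  let ?B = "Basis - {?k}"
  let ?N = "\<lambda>b. normal_density (\<theta> \<bullet> b) (sqrt s)"
  have k: "?k \<in> Basis" by (simp add: axis_in_Basis_iff)
  have ins: "Basis = insert ?k ?B" using k by auto
  have card: "card ?B = CARD('p) - 1" using k by simp
  have ne: "?B \<noteq> {}" using card p by (metis One_nat_def card.empty diff_is_0_eq not_less_eq_eq numeral_2_eq_2)
  have n2: "(norm x)\<^sup>2 = (\<Sum>b\<in>Basis. (x \<bullet> b)\<^sup>2)" for x :: "real^'p"
    unfolding power2_norm_eq_inner by (subst euclidean_inner) (simp add: power2_eq_square)
  have l: "(\<Sum>b\<in>?B. (\<theta> \<bullet> b / sqrt s)\<^sup>2) = ((norm \<theta>)\<^sup>2 - (\<theta> $ k)\<^sup>2) / s"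
    using s k by (simp add: n2 sum_diff1 power_divide sum_divide_distrib[symmetric] cart_eq_inner_axis diff_divide_distrib)
  have "(\<integral>\<^sup>+x. g ((norm x)\<^sup>2) * c (x $ k) \<partial>spherical_normal \<theta> s)
    = (\<integral>\<^sup>+x. (\<Prod>b\<in>Basis. ennreal (?N b (x \<bullet> b))) * (g (\<Sum>b\<in>Basis. (x \<bullet> b)\<^sup>2) * c (x \<bullet> ?k)) \<partial>lborel)"
    by (subst nn_integral_spherical_normal, measurable)
       (simp add: prod_ennreal prod_Basis_vec[of "\<lambda>m. normal_density m (sqrt s)" \<theta>] n2 cart_eq_inner_axis)
  also have "\<dots> = (\<integral>\<^sup>+f. (\<Prod>b\<in>Basis. ennreal (?N b (f b))) * (g (\<Sum>b\<in>Basis. (f b)\<^sup>2) * c (f ?k)) \<partial>Pi\<^sub>M Basis (\<lambda>_. lborel))"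
  proof -
    let ?F = "\<lambda>x. (\<Prod>b\<in>Basis. ennreal (?N b (x \<bullet> b))) * (g (\<Sum>b\<in>Basis. (x \<bullet> b)\<^sup>2) * c (x \<bullet> ?k))"
    have "(\<integral>\<^sup>+x. ?F x \<partial>lborel) = (\<integral>\<^sup>+x. ?F x \<partial>distr (Pi\<^sub>M Basis (\<lambda>_. lborel)) borel (\<lambda>f. \<Sum>b\<in>Basis. f b *\<^sub>R b))"
      by (simp only: lborel_eq[symmetric])
    also have "\<dots> = (\<integral>\<^sup>+f. ?F (\<Sum>b\<in>Basis. f b *\<^sub>R b) \<partial>Pi\<^sub>M Basis (\<lambda>_. lborel))"
      by (rule nn_integral_distr) measurable
    finally show ?thesis
      by (simp add: k inner_sum_left_Basis cong: prod.cong sum.cong)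
  qed
  also have "\<dots> = (\<integral>\<^sup>+f. (\<Prod>b\<in>insert ?k ?B. ennreal (?N b (f b))) * (g (\<Sum>b\<in>insert ?k ?B. (f b)\<^sup>2) * c (f ?k)) \<partial>Pi\<^sub>M (insert ?k ?B) (\<lambda>_. lborel))"
    using ins by simp
  also have "\<dots> = (\<integral>\<^sup>+y. \<integral>\<^sup>+f. (\<Prod>b\<in>insert ?k ?B. ennreal (?N b ((f(?k := y)) b))) * (g (\<Sum>b\<in>insert ?k ?B. ((f(?k := y)) b)\<^sup>2) * c ((f(?k := y)) ?k)) \<partial>Pi\<^sub>M ?B (\<lambda>_. lborel) \<partial>lborel)"
    by (rule product_nn_integral_insert_rev) auto
  also have "\<dots> = (\<integral>\<^sup>+y. noncentral (CARD('p) - 1) (((norm \<theta>)\<^sup>2 - (\<theta> $ k)\<^sup>2) / s) (\<lambda>t. g (y\<^sup>2 + s * t))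
        * c y * ennreal (normal_density (\<theta> $ k) (sqrt s) y) \<partial>lborel)"
  proof (rule nn_integral_cong, goal_cases)
    case (1 y)
    have e: "(\<Sum>b\<in>insert ?k ?B. ((f(?k := y)) b)\<^sup>2) = y\<^sup>2 + (\<Sum>b\<in>?B. (f b)\<^sup>2)"
      "(\<Prod>b\<in>insert ?k ?B. ennreal (?N b ((f(?k := y)) b))) = ennreal (?N ?k y) * (\<Prod>b\<in>?B. ennreal (?N b (f b)))" for f
    proof -
      have j: "(f(?k := y)) b = f b" if "b \<in> ?B" for b using that by auto
      show "(\<Sum>b\<in>insert ?k ?B. ((f(?k := y)) b)\<^sup>2) = y\<^sup>2 + (\<Sum>b\<in>?B. (f b)\<^sup>2)"
        by (subst sum.insert) (simp_all add: j fun_upd_same del: fun_upd_apply)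
      show "(\<Prod>b\<in>insert ?k ?B. ennreal (?N b ((f(?k := y)) b))) = ennreal (?N ?k y) * (\<Prod>b\<in>?B. ennreal (?N b (f b)))"
        by (subst prod.insert) (simp_all add: j fun_upd_same del: fun_upd_apply)
    qed
    have "(\<integral>\<^sup>+f. (\<Prod>b\<in>insert ?k ?B. ennreal (?N b ((f(?k := y)) b))) * (g (\<Sum>b\<in>insert ?k ?B. ((f(?k := y)) b)\<^sup>2) * c ((f(?k := y)) ?k)) \<partial>Pi\<^sub>M ?B (\<lambda>_. lborel))
      = (\<integral>\<^sup>+f. (c y * ennreal (?N ?k y)) * (g (y\<^sup>2 + (\<Sum>b\<in>?B. (f b)\<^sup>2)) * (\<Prod>b\<in>?B. ennreal (?N b (f b)))) \<partial>Pi\<^sub>M ?B (\<lambda>_. lborel))"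
      unfolding e by (simp add: mult_ac)
    also have "\<dots> = (c y * ennreal (?N ?k y)) * noncentral (CARD('p) - 1) (((norm \<theta>)\<^sup>2 - (\<theta> $ k)\<^sup>2) / s) (\<lambda>t. g (y\<^sup>2 + s * t))"
      using ne s by (subst nn_integral_cmult, measurable, subst sum_squares_noncentral[of ?B "sqrt s" "\<lambda>t. g (y\<^sup>2 + t)"]) (auto simp: l card)
    finally show ?case
      by (simp add: cart_eq_inner_axis mult_ac)
  qed
  finally show ?thesis .
qed

context
  fixes \<theta> :: "real^'p" and s :: real and g :: "real \<Rightarrow> ennreal" and k :: 'p
  assumes p: "CARD('p) \<ge> 2" and s: "s > 0" and g[measurable]: "g \<in> borel_measurable borel"
begin

text \<open>Puts the separated coordinate back. Here \<open>m\<close> is 1, 3 or 5, as in the terms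
  of \<open>normal_square_noncentral\<close>, and the two noncentralities add up to that of the
  whole vector.\<close>

lemma noncentral_join:
  assumes "m > 0" "q = m + CARD('p) - 1"
  shows "noncentral m ((\<theta> $ k / sqrt s)\<^sup>2) (\<lambda>x. noncentral (CARD('p) - 1) (((norm \<theta>)\<^sup>2 - (\<theta> $ k)\<^sup>2) / s) (\<lambda>t. g (s * x + s * t)))
    = noncentral q ((norm \<theta>)\<^sup>2 / s) (\<lambda>t. g (s * t))"
proof -
  have "(\<theta> $ k)\<^sup>2 \<le> (norm \<theta>)\<^sup>2"
    using component_le_norm_cart[of \<theta> k] by (metis abs_ge_zero power2_abs power_mono)
  moreover have "(\<theta> $ k / sqrt s)\<^sup>2 + ((norm \<theta>)\<^sup>2 - (\<theta> $ k)\<^sup>2) / s = (norm \<theta>)\<^sup>2 / s"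
    using s by (simp add: power_divide diff_divide_distrib)
  moreover have "m + (CARD('p) - 1) = m + CARD('p) - 1" using p by simp
  ultimately show ?thesis
    using noncentral_convolution[of m "CARD('p) - 1" "(\<theta> $ k / sqrt s)\<^sup>2" "((norm \<theta>)\<^sup>2 - (\<theta> $ k)\<^sup>2) / s" "\<lambda>t. g (s * t)"] p s assms
    by (simp add: distrib_left)
qed

lemma spherical_normal_norm:
  "(\<integral>\<^sup>+x. g ((norm x)\<^sup>2) \<partial>spherical_normal \<theta> s) = noncentral CARD('p) ((norm \<theta>)\<^sup>2 / s) (\<lambda>t. g (s * t))"
proof -
  let ?h = "\<lambda>r. noncentral (CARD('p) - 1) (((norm \<theta>)\<^sup>2 - (\<theta> $ k)\<^sup>2) / s) (\<lambda>t. g (r + s * t))"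
  have "(\<integral>\<^sup>+x. g ((norm x)\<^sup>2) * 1 \<partial>spherical_normal \<theta> s) = (\<integral>\<^sup>+y. ?h (y\<^sup>2) * 1 * ennreal (normal_density (\<theta> $ k) (sqrt s) y) \<partial>lborel)"
    by (rule spherical_normal_coordinate[where c="\<lambda>_. 1"]) (use p s in auto)
  also have "\<dots> = (\<integral>\<^sup>+y. ?h (y\<^sup>2) * ennreal (normal_density (\<theta> $ k) (sqrt s) y) \<partial>lborel)" by simp
  also have "\<dots> = noncentral 1 ((\<theta> $ k / sqrt s)\<^sup>2) (\<lambda>x. ?h (s * x))"
    using s by (subst normal_square_noncentral(1)) auto
  also have "\<dots> = noncentral CARD('p) ((norm \<theta>)\<^sup>2 / s) (\<lambda>t. g (s * t))"
    by (rule noncentral_join) auto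
  finally show ?thesis by simp
qed

lemma spherical_normal_second_moment:
  "(\<integral>\<^sup>+x. g ((norm x)\<^sup>2) * ennreal ((x $ k)\<^sup>2) \<partial>spherical_normal \<theta> s)
    = ennreal s * noncentral (CARD('p) + 2) ((norm \<theta>)\<^sup>2 / s) (\<lambda>t. g (s * t))
      + ennreal ((\<theta> $ k)\<^sup>2) * noncentral (CARD('p) + 4) ((norm \<theta>)\<^sup>2 / s) (\<lambda>t. g (s * t))"
proof -
  let ?h = "\<lambda>r. noncentral (CARD('p) - 1) (((norm \<theta>)\<^sup>2 - (\<theta> $ k)\<^sup>2) / s) (\<lambda>t. g (r + s * t))"
  have "(\<integral>\<^sup>+x. g ((norm x)\<^sup>2) * ennreal ((x $ k)\<^sup>2) \<partial>spherical_normal \<theta> s)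
    = (\<integral>\<^sup>+y. ?h (y\<^sup>2) * ennreal (y\<^sup>2) * ennreal (normal_density (\<theta> $ k) (sqrt s) y) \<partial>lborel)"
    by (rule spherical_normal_coordinate[where c="\<lambda>y. ennreal (y\<^sup>2)"]) (use p s in auto)
  also have "\<dots> = ennreal s * noncentral 3 ((\<theta> $ k / sqrt s)\<^sup>2) (\<lambda>x. ?h (s * x))
      + ennreal ((\<theta> $ k)\<^sup>2) * noncentral 5 ((\<theta> $ k / sqrt s)\<^sup>2) (\<lambda>x. ?h (s * x))"
    using s by (subst normal_square_noncentral(2)) auto
  also have "noncentral 3 ((\<theta> $ k / sqrt s)\<^sup>2) (\<lambda>x. ?h (s * x)) = noncentral (CARD('p) + 2) ((norm \<theta>)\<^sup>2 / s) (\<lambda>t. g (s * t))"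
    by (rule noncentral_join) auto
  also have "noncentral 5 ((\<theta> $ k / sqrt s)\<^sup>2) (\<lambda>x. ?h (s * x)) = noncentral (CARD('p) + 4) ((norm \<theta>)\<^sup>2 / s) (\<lambda>t. g (s * t))"
    by (rule noncentral_join) auto
  finally show ?thesis .
qed

lemma spherical_normal_signed_moment:
  "(\<integral>\<^sup>+x. g ((norm x)\<^sup>2) * ennreal (x $ k * \<theta> $ k) \<partial>spherical_normal \<theta> s)
    = (\<integral>\<^sup>+x. g ((norm x)\<^sup>2) * ennreal (- (x $ k * \<theta> $ k)) \<partial>spherical_normal \<theta> s)
      + ennreal ((\<theta> $ k)\<^sup>2) * noncentral (CARD('p) + 2) ((norm \<theta>)\<^sup>2 / s) (\<lambda>t. g (s * t))"
proof -
  let ?h = "\<lambda>r. noncentral (CARD('p) - 1) (((norm \<theta>)\<^sup>2 - (\<theta> $ k)\<^sup>2) / s) (\<lambda>t. g (r + s * t))"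
  have 1: "(\<integral>\<^sup>+x. g ((norm x)\<^sup>2) * ennreal (c * (x $ k * \<theta> $ k)) \<partial>spherical_normal \<theta> s)
    = (\<integral>\<^sup>+y. ?h (y\<^sup>2) * ennreal (c * (y * \<theta> $ k)) * ennreal (normal_density (\<theta> $ k) (sqrt s) y) \<partial>lborel)" for c
    by (rule spherical_normal_coordinate[where c="\<lambda>y. ennreal (c * (y * \<theta> $ k))"]) (use p s in auto)
  have "(\<integral>\<^sup>+y. ?h (y\<^sup>2) * ennreal (y * \<theta> $ k) * ennreal (normal_density (\<theta> $ k) (sqrt s) y) \<partial>lborel)
    = (\<integral>\<^sup>+y. ?h (y\<^sup>2) * ennreal (- (y * \<theta> $ k)) * ennreal (normal_density (\<theta> $ k) (sqrt s) y) \<partial>lborel)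
      + ennreal ((\<theta> $ k)\<^sup>2) * noncentral 3 ((\<theta> $ k / sqrt s)\<^sup>2) (\<lambda>x. ?h (s * x))"
    using s by (subst normal_square_noncentral(3)) auto
  also have "noncentral 3 ((\<theta> $ k / sqrt s)\<^sup>2) (\<lambda>x. ?h (s * x)) = noncentral (CARD('p) + 2) ((norm \<theta>)\<^sup>2 / s) (\<lambda>t. g (s * t))"
    by (rule noncentral_join) auto
  finally show ?thesis
    using 1[of 1] 1[of "-1"] by simp
qed

end

section \<open>Rotation and translation invariance\<close>

lemma spherical_density_norm:
  fixes \<theta> :: "real^'p"
  assumes s: "s > 0"
  shows "(\<Prod>i\<in>UNIV. normal_density (\<theta> $ i) (sqrt s) (x $ i)) =
    (1 / sqrt (2 * pi * s)) ^ CARD('p) * exp (- ((norm (x - \<theta>))\<^sup>2) / (2 * s))"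
proof -
  have n: "(norm (x - \<theta>))\<^sup>2 = (\<Sum>i\<in>UNIV. (x $ i - \<theta> $ i)\<^sup>2)"
    by (simp add: norm_vec_def L2_set_def sum_nonneg)
  show ?thesis
    unfolding n using s
    by (simp add: normal_density_def prod_dividef prod.distrib exp_sum[symmetric] sum_negf sum_divide_distrib power_one_over)
qed

lemma nn_integral_lborel_translate:
  fixes c :: "'a::euclidean_space"
  assumes [measurable]: "f \<in> borel_measurable borel"
  shows "(\<integral>\<^sup>+x. f (c + x) \<partial>lborel) = (\<integral>\<^sup>+x. f x \<partial>lborel)"
  by (subst (2) lborel_distr_plus[of c, symmetric], subst nn_integral_distr) auto

text \<open>The library's change of variables for linear maps on \<^typ>\<open>real^'p\<close> requires the index type to be
  well-ordered. For isometries, translation invariance together with the invariance of the unit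
  ball \<open>b\<close> suffices, by computing \<open>\<integral>\<integral> f (T x) b (y - T x)\<close> in two ways.\<close>

lemma nn_integral_orthogonal:
  fixes T :: "real^'p \<Rightarrow> real^'p"
  assumes T: "orthogonal_transformation T" and [measurable]: "f \<in> borel_measurable borel"
  shows "(\<integral>\<^sup>+x. f (T x) \<partial>lborel) = (\<integral>\<^sup>+x. f x \<partial>lborel)"
proof -
  have lin: "linear T" using T by (rule orthogonal_transformation_linear)
  then have [measurable]: "T \<in> borel_measurable borel"
    by (intro borel_measurable_continuous_onI linear_continuous_on linear_conv_bounded_linear[THEN iffD1])
  define b :: "real^'p \<Rightarrow> ennreal" where "b = indicator (ball 0 1)"
  have [measurable]: "b \<in> borel_measurable borel" unfolding b_def by (intro borel_measurable_indicator borel_open) auto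
  define \<beta> where "\<beta> = (\<integral>\<^sup>+x. b x \<partial>lborel)"
  have "\<beta> = emeasure lborel (ball (0::real^'p) 1)" unfolding \<beta>_def b_def by (rule nn_integral_indicator) simp
  then have \<beta>: "\<beta> \<noteq> 0" "\<beta> \<noteq> \<top>"
    using emeasure_lborel_ball_finite[of "0::real^'p" 1] open_not_negligible[of "ball (0::real^'p) 1"]
    by (auto simp: negligible_iff_null_sets null_sets_def emeasure_completion)
  have bT: "b (- T x) = b (T x)" "b (T x) = b x" for x
    using orthogonal_transformation_norm[OF T] by (auto simp: b_def indicator_def)
  have "(\<integral>\<^sup>+x. f (T x) \<partial>lborel) * \<beta> = (\<integral>\<^sup>+x. f (T x) * (\<integral>\<^sup>+y. b (y - T x) \<partial>lborel) \<partial>lborel)"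
    using nn_integral_lborel_translate[of b "- T x" for x]
    by (simp add: nn_integral_multc \<beta>_def)
  also have "\<dots> = (\<integral>\<^sup>+x. \<integral>\<^sup>+y. f (T x) * b (y - T x) \<partial>lborel \<partial>lborel)"
    by (intro nn_integral_cong nn_integral_cmult[symmetric]) measurable
  also have "\<dots> = (\<integral>\<^sup>+y. \<integral>\<^sup>+x. f (T x) * b (y - T x) \<partial>lborel \<partial>lborel)"
    by (rule lborel_pair.Fubini') measurable
  also have "\<dots> = (\<integral>\<^sup>+y. \<integral>\<^sup>+x. f (y + T x) * b (T x) \<partial>lborel \<partial>lborel)"
  proof (rule nn_integral_cong, goal_cases)
    case (1 y)
    obtain z where z: "T z = y" using orthogonal_transformation_surj[OF T] by (metis surjD)
    have "(\<integral>\<^sup>+x. f (T x) * b (y - T x) \<partial>lborel) = (\<integral>\<^sup>+x. f (T (z + x)) * b (y - T (z + x)) \<partial>lborel)"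
      by (rule nn_integral_lborel_translate[symmetric]) measurable
    then show ?case
      by (simp add: linear_add[OF lin] z bT(1))
  qed
  also have "\<dots> = (\<integral>\<^sup>+x. \<integral>\<^sup>+y. f (y + T x) * b (T x) \<partial>lborel \<partial>lborel)"
    by (rule lborel_pair.Fubini') measurable
  also have "\<dots> = (\<integral>\<^sup>+x. (\<integral>\<^sup>+y. f y \<partial>lborel) * b x \<partial>lborel)"
    using nn_integral_lborel_translate[of f "T x" for x]
    by (simp add: nn_integral_multc bT(2) add.commute)
  also have "\<dots> = (\<integral>\<^sup>+y. f y \<partial>lborel) * \<beta>"
    by (simp add: nn_integral_cmult \<beta>_def)
  finally show ?thesis
    using \<beta> by (simp add: mult.commute[of _ \<beta>] ennreal_mult_cancel_left)
qed

lemma spherical_normal_orthogonal: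
  fixes \<theta> :: "real^'p" and T :: "real^'p \<Rightarrow> real^'p"
  assumes s: "s > 0" and T: "orthogonal_transformation T" and [measurable]: "F \<in> borel_measurable borel"
  shows "(\<integral>\<^sup>+x. F (T x) \<partial>spherical_normal \<theta> s) = (\<integral>\<^sup>+x. F x \<partial>spherical_normal (T \<theta>) s)"
proof -
  have lin: "linear T" using T by (rule orthogonal_transformation_linear)
  then have [measurable]: "T \<in> borel_measurable borel"
    by (intro borel_measurable_continuous_onI linear_continuous_on linear_conv_bounded_linear[THEN iffD1])
  let ?d = "\<lambda>\<theta> x::real^'p. ennreal (\<Prod>i\<in>UNIV. normal_density (\<theta> $ i) (sqrt s) (x $ i))"
  have d: "?d (T \<theta>) (T x) = ?d \<theta> x" for x
    using s by (simp only: spherical_density_norm linear_diff[OF lin, symmetric] orthogonal_transformation_norm[OF T])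
  have "(\<integral>\<^sup>+x. F x \<partial>spherical_normal (T \<theta>) s) = (\<integral>\<^sup>+x. ?d (T \<theta>) x * F x \<partial>lborel)"
    by (rule nn_integral_spherical_normal) measurable
  also have "\<dots> = (\<integral>\<^sup>+x. ?d (T \<theta>) (T x) * F (T x) \<partial>lborel)"
    by (rule nn_integral_orthogonal[OF T, symmetric]) measurable
  also have "\<dots> = (\<integral>\<^sup>+x. F (T x) \<partial>spherical_normal \<theta> s)"
    unfolding d by (rule nn_integral_spherical_normal[symmetric]) measurable
  finally show ?thesis by simp
qed

lemma spherical_normal_translate:
  fixes \<theta> :: "real^'p"
  assumes s: "s > 0" and [measurable]: "F \<in> borel_measurable borel"
  shows "(\<integral>\<^sup>+x. F x \<partial>spherical_normal \<theta> s) = (\<integral>\<^sup>+x. F (\<theta> + x) \<partial>spherical_normal 0 s)"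
proof -
  let ?d = "\<lambda>\<theta> x::real^'p. ennreal (\<Prod>i\<in>UNIV. normal_density (\<theta> $ i) (sqrt s) (x $ i))"
  have d: "?d \<theta> (\<theta> + x) = ?d 0 x" for x
    using s by (simp only: spherical_density_norm) simp
  have "(\<integral>\<^sup>+x. F x \<partial>spherical_normal \<theta> s) = (\<integral>\<^sup>+x. ?d \<theta> x * F x \<partial>distr lborel borel ((+) \<theta>))"
    by (simp add: nn_integral_spherical_normal lborel_distr_plus)
  also have "\<dots> = (\<integral>\<^sup>+x. ?d \<theta> (\<theta> + x) * F (\<theta> + x) \<partial>lborel)"
    by (rule nn_integral_distr) measurable
  also have "\<dots> = (\<integral>\<^sup>+x. F (\<theta> + x) \<partial>spherical_normal 0 s)"
    unfolding d by (rule nn_integral_spherical_normal[symmetric]) measurable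
  finally show ?thesis .
qed

lemma noncentral_const: "k > 0 \<Longrightarrow> l \<ge> 0 \<Longrightarrow> noncentral k l (\<lambda>_. c) = c"
  using prob_space.emeasure_space_1[OF prob_space_chi_square]
  by (simp add: noncentral_def poisson_mix_const)

lemma prob_space_spherical_normal:
  fixes \<theta> :: "real^'p"
  assumes "CARD('p) \<ge> 2" "s > 0"
  shows "prob_space (spherical_normal \<theta> s)"
proof
  have "(\<integral>\<^sup>+x. 1 \<partial>spherical_normal \<theta> s) = 1"
    using spherical_normal_norm[OF assms, where g = "\<lambda>_. 1"] assms by (simp add: noncentral_const)
  then show "emeasure (spherical_normal \<theta> s) (space (spherical_normal \<theta> s)) = 1"
    by simp
qed

lemma spherical_normal_variance:
  fixes \<theta> :: "real^'p"
  assumes p: "CARD('p) \<ge> 2" and s: "s > 0"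
  shows "(\<integral>\<^sup>+x. ennreal ((x $ k - \<theta> $ k)\<^sup>2) \<partial>spherical_normal \<theta> s) = ennreal s"
  using spherical_normal_second_moment[OF p s, where g = "\<lambda>_. 1" and k = k and \<theta> = 0] p s
  by (subst spherical_normal_translate) (auto simp: noncentral_const)

lemma sigma_finite_spherical_normal: "sigma_finite_measure (spherical_normal \<theta> s)"
  unfolding spherical_normal_def
  by (subst sigma_finite_measure.sigma_finite_iff_density_finite)
     (auto simp: sigma_finite_lborel)

interpretation spherical_normal: sigma_finite_measure "spherical_normal \<theta> s" for \<theta> s
  by (rule sigma_finite_spherical_normal)

section \<open>The joint law of \<open>X\<close> and \<open>S\<close>\<close>

lemma sets_model [measurable_cong]: "sets (model n \<theta> s) = sets (borel \<Otimes>\<^sub>M borel)"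
  unfolding model_def by (intro sets_pair_measure_cong) auto

lemma space_model [simp]: "space (model n \<theta> s) = UNIV"
  by (simp add: model_def space_pair_measure)

lemma prob_space_model:
  fixes \<theta> :: "real^'p"
  assumes "CARD('p) \<ge> 2" "n > 0" "s > 0"
  shows "prob_space (model n \<theta> s)"
proof -
  interpret a: prob_space "spherical_normal \<theta> s" by (rule prob_space_spherical_normal) fact+
  interpret c: prob_space "chi_square n" by (rule prob_space_chi_square) fact
  interpret b: prob_space "distr (chi_square n) borel (\<lambda>v. s * v)" by (rule c.prob_space_distr) simp
  interpret pair_prob_space "spherical_normal \<theta> s" "distr (chi_square n) borel (\<lambda>v. s * v)" ..
  show ?thesis unfolding model_def by unfold_locales
qed

lemma nn_integral_model:
  fixes \<theta> :: "real^'p"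
  assumes "n > 0" and [measurable]: "f \<in> borel_measurable (borel \<Otimes>\<^sub>M borel)"
  shows "(\<integral>\<^sup>+z. f z \<partial>model n \<theta> s) = (\<integral>\<^sup>+x. \<integral>\<^sup>+v. f (x, s * v) \<partial>chi_square n \<partial>spherical_normal \<theta> s)"
proof -
  interpret c: prob_space "chi_square n" by (rule prob_space_chi_square) fact
  interpret b: prob_space "distr (chi_square n) borel (\<lambda>v. s * v)" by (rule c.prob_space_distr) simp
  show ?thesis
    unfolding model_def by (subst b.nn_integral_fst[symmetric]) (auto simp: nn_integral_distr)
qed

subsection \<open>Absolutely continuous functions\<close>

text \<open>For the gauge integral the argument is direct. Tags outside \<open>N\<close> are handled
  by differentiability; intervals tagged in \<open>N\<close> lie in an open set of small measure,
  where absolute continuity bounds their increments. Integrability of \<open>f'\<close> is part of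
  the result.\<close>

lemma absolutely_continuous_has_integral:
  fixes f f' :: "real \<Rightarrow> real"
  assumes ac: "absolutely_continuous_on_cbox a b f" and ab: "a \<le> b" and N: "negligible N"
    and d: "\<And>x. x \<in> {a..b} - N \<Longrightarrow> (f has_real_derivative f' x) (at x)"
  shows "(f' has_integral (f b - f a)) {a..b}"
proof -
  \<comment> \<open>With the derivative set to 0 on \<open>N\<close>, a tag in \<open>N\<close>
    contributes only the increment of \<open>f\<close>.\<close>
  define g where "g x = (if x \<in> N then 0 else f' x)" for x
  have "(g has_integral (f b - f a)) (cbox a b)"
    unfolding has_integral
  proof (intro allI impI)
    fix e :: real assume e: "e > 0"
    \<comment> \<open>One half of \<open>e\<close> is spread over the length \<open>b - a\<close>,
      the other is kept for the tags in \<open>N\<close>. The added 1 covers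
      \<open>a = b\<close>.\<close>
    define \<epsilon> where "\<epsilon> = e / (2 * (b - a + 1))"
    have \<epsilon>: "\<epsilon> > 0" and \<epsilon>2: "\<epsilon> * (b - a) < e / 2"
      using e ab by (auto simp: \<epsilon>_def field_simps add_pos_nonneg)
    have "\<exists>r>0. \<forall>y. \<bar>y - x\<bar> < r \<longrightarrow> \<bar>f y - f x - f' x * (y - x)\<bar> \<le> \<epsilon> * \<bar>y - x\<bar>" if "x \<in> {a..b} - N" for x
    proof -
      have "(f has_derivative (\<lambda>h. f' x * h)) (at x)"
        using d[OF that] by (simp add: has_field_derivative_def)
      then show ?thesis
        using \<epsilon> by (auto simp: has_derivative_at_alt)
    qed
    then obtain r where r: "\<And>x. x \<in> {a..b} - N \<Longrightarrow> r x > 0"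
      "\<And>x y. x \<in> {a..b} - N \<Longrightarrow> \<bar>y - x\<bar> < r x \<Longrightarrow> \<bar>f y - f x - f' x * (y - x)\<bar> \<le> \<epsilon> * \<bar>y - x\<bar>"
      by metis
    obtain \<delta> where \<delta>: "\<delta> > 0" and ac': "\<And>D :: (real \<times> real) set. finite D \<Longrightarrow>
        (\<forall>(x, y)\<in>D. a \<le> x \<and> x \<le> y \<and> y \<le> b) \<Longrightarrow>
        pairwise (\<lambda>I J. disjnt {fst I<..<snd I} {fst J<..<snd J}) D \<Longrightarrow>
        (\<Sum>(x, y)\<in>D. y - x) < \<delta> \<Longrightarrow> (\<Sum>(x, y)\<in>D. \<bar>f y - f x\<bar>) < e / 2"
      using ac[unfolded absolutely_continuous_on_cbox_def, rule_format, of "e / 2"] e by (auto simp: case_prod_unfold)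
    have N0: "N \<in> null_sets lebesgue" using N by (simp add: negligible_iff_null_sets)
    obtain U where U: "open U" "N \<subseteq> U" "emeasure lebesgue (U - N) < ennreal \<delta>"
      using sets_lebesgue_outer_open[OF _ \<delta>, of N] N0 by blast
    have "emeasure lebesgue U \<le> emeasure lebesgue (U - N) + emeasure lebesgue N"
    proof -
      have "U = (U - N) \<union> N" using U by auto
      then have "emeasure lebesgue U = emeasure lebesgue ((U - N) \<union> N)" by simp
      also have "\<dots> \<le> emeasure lebesgue (U - N) + emeasure lebesgue N"
        using U(1) null_setsD2[OF N0] by (intro emeasure_subadditive sets.Diff) auto
      finally show ?thesis .
    qed
    then have Um: "emeasure lborel U < ennreal \<delta>"
      using U N0 by (auto simp: null_sets_def)
    have "\<exists>s>0. ball x s \<subseteq> U" if "x \<in> N" for x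
      using that U by (meson openE subsetD)
    then obtain s where s: "\<And>x. x \<in> N \<Longrightarrow> s x > 0" "\<And>x. x \<in> N \<Longrightarrow> ball x (s x) \<subseteq> U" by metis
    define \<gamma> where "\<gamma> x = (if x \<in> N then ball x (s x) else if x \<in> {a..b} then ball x (r x) else ball x 1)" for x
    have gauge: "gauge \<gamma>"
      unfolding \<gamma>_def using r s by (auto simp: gauge_def)
    have bound: "norm ((\<Sum>(x, K)\<in>D. measure lborel K *\<^sub>R g x) - (f b - f a)) < e"
      if D: "D tagged_division_of cbox a b" and fine: "\<gamma> fine D" for D
    proof -
      have fin: "finite D" using D by auto
      let ?\<Delta> = "\<lambda>K. f (Sup K) - f (Inf K)"
      have K: "\<exists>u v. K = {u..v} \<and> u \<le> x \<and> x \<le> v \<and> Inf K = u \<and> Sup K = v \<and> a \<le> u \<and> v \<le> b \<and> {u..v} \<subseteq> \<gamma> x"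
        if xK: "(x, K) \<in> D" for x K
      proof -
        obtain u v where "K = cbox u v" "x \<in> K" "K \<subseteq> cbox a b"
          using tagged_division_ofD(2,3,4)[OF D xK] by blast
        moreover have "K \<subseteq> \<gamma> x" using fineD[OF fine xK] .
        ultimately show ?thesis by (auto intro!: exI[of _ u] exI[of _ v] simp: subset_iff)
      qed
      have sum: "(\<Sum>(x, K)\<in>D. ?\<Delta> K) = f b - f a"
        using additive_tagged_division_1[of a b D f] ab D by simp
      have "(\<Sum>(x, K)\<in>D. measure lborel K *\<^sub>R g x) - (f b - f a) = (\<Sum>(x, K)\<in>D. measure lborel K * g x - ?\<Delta> K)"
        unfolding sum[symmetric] by (simp add: sum_subtractf case_prod_unfold)
      also have "norm \<dots> \<le> (\<Sum>(x, K)\<in>D. \<bar>measure lborel K * g x - ?\<Delta> K\<bar>)"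
        by (rule order_trans[OF norm_sum]) (simp add: case_prod_unfold)
      also have "\<dots> \<le> (\<Sum>(x, K)\<in>D. \<epsilon> * measure lborel K + (if x \<in> N then \<bar>?\<Delta> K\<bar> else 0))"
      proof (intro sum_mono, clarify)
        fix x K assume xK: "(x, K) \<in> D"
        from K[OF this] obtain u v where uv: "K = {u..v}" "u \<le> x" "x \<le> v" "Inf K = u" "Sup K = v" "a \<le> u" "v \<le> b" "{u..v} \<subseteq> \<gamma> x" by blast
        have c: "measure lborel K = v - u" using uv by simp
        show "\<bar>measure lborel K * g x - ?\<Delta> K\<bar> \<le> \<epsilon> * measure lborel K + (if x \<in> N then \<bar>?\<Delta> K\<bar> else 0)"
        proof (cases "x \<in> N")
          case True
          then show ?thesis using \<epsilon> c uv by (simp add: g_def abs_minus_commute)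
        next
          case False
          then have x: "x \<in> {a..b} - N" using uv by auto
          have "u \<in> \<gamma> x" "v \<in> \<gamma> x" using uv by auto
          then have "\<bar>u - x\<bar> < r x" "\<bar>v - x\<bar> < r x"
            using x by (auto simp: \<gamma>_def dist_real_def abs_minus_commute)
          then have "\<bar>f u - f x - f' x * (u - x)\<bar> \<le> \<epsilon> * \<bar>u - x\<bar>" "\<bar>f v - f x - f' x * (v - x)\<bar> \<le> \<epsilon> * \<bar>v - x\<bar>"
            using r(2)[OF x] by auto
          moreover have "measure lborel K * g x - ?\<Delta> K = (f u - f x - f' x * (u - x)) - (f v - f x - f' x * (v - x))"
            using False uv c by (simp add: g_def algebra_simps)
          ultimately have "\<bar>measure lborel K * g x - ?\<Delta> K\<bar> \<le> \<epsilon> * \<bar>u - x\<bar> + \<epsilon> * \<bar>v - x\<bar>" by linarith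
          also have "\<dots> = \<epsilon> * measure lborel K" using uv c by (simp add: algebra_simps)
          finally show ?thesis using False by simp
        qed
      qed
      also have "\<dots> = \<epsilon> * (\<Sum>(x, K)\<in>D. measure lborel K) + (\<Sum>(x, K)\<in>D. if x \<in> N then \<bar>?\<Delta> K\<bar> else 0)"
        by (simp add: sum.distrib sum_distrib_left case_prod_unfold)
      also have "(\<Sum>(x, K)\<in>D. measure lborel K) = b - a"
        using additive_content_tagged_division[OF D] ab by simp
      also have "(\<Sum>(x, K)\<in>D. if x \<in> N then \<bar>?\<Delta> K\<bar> else 0) < e / 2"
      proof -
        \<comment> \<open>Degenerate intervals contribute nothing. Without them \<open>J\<close> is
          injective, since two equal nonempty open intervals are not disjoint.\<close>
        define D' where "D' = {(x, K) \<in> D. x \<in> N \<and> Inf K < Sup K}"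
        define J where "J = (\<lambda>(x::real, K::real set). (Inf K, Sup K))"
        have D': "D' \<subseteq> D" "finite D'" using fin unfolding D'_def by (auto intro: finite_subset[of _ D])
        have disj: "disjnt {Inf K<..<Sup K} {Inf K'<..<Sup K'}"
          if "(x, K) \<in> D'" "(x', K') \<in> D'" "(x, K) \<noteq> (x', K')" for x K x' K'
        proof -
          have "interior K \<inter> interior K' = {}"
            using tagged_division_ofD(5)[OF D, of x K x' K'] that D' by blast
          moreover have "interior K = {Inf K<..<Sup K}" "interior K' = {Inf K'<..<Sup K'}"
            using K that D' by (metis interior_atLeastAtMost_real subsetD)+
          ultimately show ?thesis by (simp add: disjnt_def)
        qed
        have inj: "inj_on J D'"
        proof (rule inj_onI)
          fix y z assume yz: "y \<in> D'" "z \<in> D'" "J y = J z"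
          obtain x K x' K' where [simp]: "y = (x, K)" "z = (x', K')" by (metis surj_pair)
          show "y = z"
          proof (rule ccontr)
            assume "y \<noteq> z"
            then have "disjnt {Inf K<..<Sup K} {Inf K'<..<Sup K'}" using disj yz by simp
            then show False using yz by (auto simp: J_def D'_def disjnt_def)
          qed
        qed
        have "(\<Sum>(x, K)\<in>D. if x \<in> N then \<bar>?\<Delta> K\<bar> else 0) = (\<Sum>(x, K)\<in>D'. \<bar>?\<Delta> K\<bar>)"
        proof (rule sum.mono_neutral_cong_right)
          show "\<forall>i\<in>D - D'. (case i of (x, K) \<Rightarrow> if x \<in> N then \<bar>?\<Delta> K\<bar> else 0) = 0"
          proof clarify
            fix x K assume "(x, K) \<in> D" "(x, K) \<notin> D'"
            then show "(if x \<in> N then \<bar>?\<Delta> K\<bar> else 0) = 0"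
              using K[of x K] by (fastforce simp: D'_def)
          qed
        qed (use fin D' in \<open>auto simp: D'_def\<close>)
        also have "\<dots> = (\<Sum>(u, v)\<in>J ` D'. \<bar>f v - f u\<bar>)"
          by (subst sum.reindex[OF inj]) (simp add: J_def case_prod_unfold)
        also have "\<dots> < e / 2"
        proof (rule ac')
          show "finite (J ` D')" using D' by simp
          show "\<forall>(x, y)\<in>J ` D'. a \<le> x \<and> x \<le> y \<and> y \<le> b"
            using K D'(1) by (force simp: J_def)
          show "pairwise (\<lambda>I J. disjnt {fst I<..<snd I} {fst J<..<snd J}) (J ` D')"
            using disj by (fastforce simp: pairwise_def J_def)
          have "ennreal (\<Sum>(u, v)\<in>J ` D'. v - u) = (\<Sum>(x, K)\<in>D'. emeasure lborel {Inf K<..<Sup K})"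
          proof -
            have "(\<Sum>(u, v)\<in>J ` D'. v - u) = (\<Sum>(x, K)\<in>D'. Sup K - Inf K)"
              by (subst sum.reindex[OF inj]) (simp add: J_def case_prod_unfold)
            also have "ennreal \<dots> = (\<Sum>(x, K)\<in>D'. ennreal (Sup K - Inf K))"
              unfolding case_prod_unfold by (rule sum_ennreal[symmetric]) (auto simp: D'_def)
            also have "\<dots> = (\<Sum>(x, K)\<in>D'. emeasure lborel {Inf K<..<Sup K})"
              by (intro sum.cong) (auto simp: D'_def)
            finally show ?thesis .
          qed
          also have "\<dots> = emeasure lborel (\<Union>(x, K)\<in>D'. {Inf K<..<Sup K})"
          proof -
            have "disjoint_family_on (\<lambda>(x, K). {Inf K<..<Sup K}) D'"
              unfolding disjoint_family_on_def
            proof (intro ballI impI)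
              fix y z assume yz: "y \<in> D'" "z \<in> D'" "y \<noteq> z"
              obtain x K x' K' where [simp]: "y = (x, K)" "z = (x', K')" by (metis surj_pair)
              show "(case y of (x, K) \<Rightarrow> {Inf K<..<Sup K}) \<inter> (case z of (x, K) \<Rightarrow> {Inf K<..<Sup K}) = {}"
                using disj[of x K x' K'] yz unfolding disjnt_def by simp
            qed
            then show ?thesis
              using sum_emeasure[of "\<lambda>(x, K). {Inf K<..<Sup K}" D' lborel] D'(2)
              by (simp add: case_prod_unfold image_subset_iff)
          qed
          also have "\<dots> \<le> emeasure lborel U"
          proof (rule emeasure_mono)
            show "(\<Union>(x, K)\<in>D'. {Inf K<..<Sup K}) \<subseteq> U"
            proof clarify
              fix w x K assume "(x, K) \<in> D'" "w \<in> {Inf K<..<Sup K}"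
              then show "w \<in> U"
                using K[of x K] s(2)[of x] by (force simp: D'_def \<gamma>_def)
            qed
          qed (use U in simp)
          also have "\<dots> < ennreal \<delta>" by (rule Um)
          finally show "(\<Sum>(u, v)\<in>J ` D'. v - u) < \<delta>"
            using \<delta> by (simp add: ennreal_less_iff not_le) (metis ennreal_leI not_le)
        qed
        finally show ?thesis .
      qed
      finally show ?thesis using \<epsilon>2 by simp
    qed
    show "\<exists>\<gamma>. gauge \<gamma> \<and> (\<forall>D. D tagged_division_of cbox a b \<and> \<gamma> fine D \<longrightarrow> norm ((\<Sum>(x, K)\<in>D. measure lborel K *\<^sub>R g x) - (f b - f a)) < e)"
      by (rule exI[of _ \<gamma>]) (use gauge bound in auto)
  qed
  then show ?thesis
    by (intro has_integral_spike[OF N, of "{a..b}" f' g]) (auto simp: g_def)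
qed

text \<open>Meant for a polynomial in \<open>f\<close> times a Lipschitz weight: on a compact
  interval its increments are controlled by those of \<open>f\<close> and by the step
  length.\<close>

lemma absolutely_continuous_on_cbox_dominated:
  assumes f: "absolutely_continuous_on_cbox a b f" and C: "C \<ge> 0"
    and le: "\<And>x y. a \<le> x \<Longrightarrow> x \<le> y \<Longrightarrow> y \<le> b \<Longrightarrow> \<bar>g y - g x\<bar> \<le> C * (\<bar>f y - f x\<bar> + (y - x))"
  shows "absolutely_continuous_on_cbox a b g"
  unfolding absolutely_continuous_on_cbox_def
proof (intro allI impI)
  fix e :: real assume e: "e > 0"
  \<comment> \<open>The increments of \<open>f\<close> and the total length are both kept below
    \<open>e'\<close>, hence the factor 2; the added 1 covers \<open>C = 0\<close>.\<close>
  define e' where "e' = e / (2 * (C + 1))"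
  have e': "e' > 0" "C * (2 * e') < e" using e C by (auto simp: e'_def field_simps)
  obtain \<delta> where \<delta>: "\<delta> > 0" and ac: "\<And>D :: (real \<times> real) set. finite D \<Longrightarrow>
      (\<forall>(x, y)\<in>D. a \<le> x \<and> x \<le> y \<and> y \<le> b) \<Longrightarrow>
      pairwise (\<lambda>I J. disjnt {fst I<..<snd I} {fst J<..<snd J}) D \<Longrightarrow>
      (\<Sum>(x, y)\<in>D. y - x) < \<delta> \<Longrightarrow> (\<Sum>(x, y)\<in>D. \<bar>f y - f x\<bar>) < e'"
    using f[unfolded absolutely_continuous_on_cbox_def, rule_format, OF e'(1)] by (auto simp: case_prod_unfold)
  show "\<exists>\<delta>>0. \<forall>D. finite D \<longrightarrow> (\<forall>(x, y)\<in>D. a \<le> x \<and> x \<le> y \<and> y \<le> b) \<longrightarrow>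
      pairwise (\<lambda>I J. disjnt {fst I<..<snd I} {fst J<..<snd J}) D \<longrightarrow>
      (\<Sum>(x, y)\<in>D. y - x) < \<delta> \<longrightarrow> (\<Sum>(x, y)\<in>D. \<bar>g y - g x\<bar>) < e"
  proof (intro exI[of _ "min \<delta> e'"] conjI allI impI)
    fix D :: "(real \<times> real) set"
    assume D: "finite D" "\<forall>(x, y)\<in>D. a \<le> x \<and> x \<le> y \<and> y \<le> b"
      "pairwise (\<lambda>I J. disjnt {fst I<..<snd I} {fst J<..<snd J}) D" "(\<Sum>(x, y)\<in>D. y - x) < min \<delta> e'"
    have "(\<Sum>(x, y)\<in>D. \<bar>g y - g x\<bar>) \<le> (\<Sum>(x, y)\<in>D. C * (\<bar>f y - f x\<bar> + (y - x)))"
      using D(2) by (intro sum_mono) (auto intro!: le)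
    also have "\<dots> = C * ((\<Sum>(x, y)\<in>D. \<bar>f y - f x\<bar>) + (\<Sum>(x, y)\<in>D. y - x))"
      by (simp add: sum_distrib_left sum.distrib case_prod_unfold distrib_left)
    also have "\<dots> \<le> C * (2 * e')"
      using ac[of D] D C by (intro mult_left_mono) auto
    finally show "(\<Sum>(x, y)\<in>D. \<bar>g y - g x\<bar>) < e" using e' by simp
  qed (use \<delta> e' in auto)
qed

lemma absolutely_continuous_on_cbox_continuous:
  assumes "absolutely_continuous_on_cbox a b f"
  shows "continuous_on {a..b} f"
  unfolding continuous_on_iff
proof (intro ballI allI impI)
  fix x e :: real assume x: "x \<in> {a..b}" and e: "e > 0"
  obtain \<delta> where \<delta>: "\<delta> > 0" and ac: "\<And>D :: (real \<times> real) set. finite D \<Longrightarrow>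
      (\<forall>(x, y)\<in>D. a \<le> x \<and> x \<le> y \<and> y \<le> b) \<Longrightarrow>
      pairwise (\<lambda>I J. disjnt {fst I<..<snd I} {fst J<..<snd J}) D \<Longrightarrow>
      (\<Sum>(x, y)\<in>D. y - x) < \<delta> \<Longrightarrow> (\<Sum>(x, y)\<in>D. \<bar>f y - f x\<bar>) < e"
    using assms[unfolded absolutely_continuous_on_cbox_def, rule_format, OF e] by (auto simp: case_prod_unfold)
  show "\<exists>d>0. \<forall>x'\<in>{a..b}. dist x' x < d \<longrightarrow> dist (f x') (f x) < e"
  proof (intro exI[of _ \<delta>] conjI ballI impI)
    fix y assume y: "y \<in> {a..b}" "dist y x < \<delta>"
    show "dist (f y) (f x) < e"
      using ac[of "{(min x y, max x y)}"] x y
      by (cases "x \<le> y") (auto simp: dist_real_def abs_minus_commute min_def max_def)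
  qed fact
qed

lemma locally_absolutely_continuous_continuous:
  assumes "locally_absolutely_continuous_on {0<..} f"
  shows "continuous_on {0<..} f"
proof (rule continuous_at_imp_continuous_on, rule ballI)
  fix x :: real assume "x \<in> {0<..}"
  then have x: "x > 0" by simp
  have "{x / 2..2 * x} \<subseteq> {0<..}"
  proof
    fix y assume "y \<in> {x / 2..2 * x}"
    with x have "y \<ge> x / 2" "x / 2 > 0" by auto
    then show "y \<in> {0<..}" unfolding greaterThan_iff by linarith
  qed
  then have "absolutely_continuous_on_cbox (x / 2) (2 * x) f"
    using assms unfolding locally_absolutely_continuous_on_def by blast
  then have "continuous_on {x / 2..2 * x} f"
    by (rule absolutely_continuous_on_cbox_continuous)
  then show "isCont f x"
    by (rule continuous_on_interior) (use x in \<open>auto simp: interior_atLeastAtMost_real\<close>)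
qed

subsection \<open>Integration by parts on the half line\<close>

text \<open>If \<open>\<phi> w\<close> were negative, \<open>\<phi>\<close> would be negative just
  to the right of \<open>w\<close>. Across that stretch the tail integral does not decrease and the
  factor \<open>w powr (real n / 2)\<close> strictly increases, so \<open>g1\<close> would strictly
  increase.\<close>

lemma nonneg_of_tail_transform_antimono:
  assumes cont: "continuous_on {0<..} \<phi>"
    and pos: "\<And>w. w > 0 \<Longrightarrow> g1 n \<phi> w > 0"
    and anti: "antimono_on {0<..} (g1 n \<phi>)" and n: "n > 0" and w: "w > 0"
  shows "\<phi> w \<ge> 0"
proof (rule ccontr)
  assume neg: "\<not> \<phi> w \<ge> 0"
  define k where "k t = t powr (- (real n / 2)) * (h1 \<phi> t / t)" for t
  define I where "I y = (LINT t:{y<..}|lborel. k t)" for y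
  have g1: "g1 n \<phi> y = y powr (real n / 2) * I y" for y
    by (simp add: g1_def tail_transform_def I_def k_def)
  \<comment> \<open>A non-integrable tail has the default integral 0, so the positivity of
    \<open>g1\<close> forces integrability.\<close>
  have int: "set_integrable lborel {y<..} k" if "y > 0" for y
  proof (rule ccontr)
    assume "\<not> set_integrable lborel {y<..} k"
    then have "I y = 0"
      by (simp add: I_def set_lebesgue_integral_def set_integrable_def not_integrable_integral_eq)
    then show False using pos[OF that] g1[of y] by simp
  qed
  have "continuous (at w) \<phi>"
    using cont w by (simp add: continuous_on_eq_continuous_at)
  then obtain d where d: "d > 0" "\<And>y. dist y w < d \<Longrightarrow> dist (\<phi> y) (\<phi> w) < - \<phi> w"
    using neg unfolding continuous_at_eps_delta dist_real_def by (metis neg_0_less_iff_less not_le)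
  define e where "e = d / 2"
  have e: "e > 0" using d by (simp add: e_def)
  have phi: "\<phi> y < 0" if "y \<in> {w<..w + e}" for y
    using d(2)[of y] that neg d(1) by (auto simp: dist_real_def e_def)
  have "I w = (LINT t:{w<..w + e}|lborel. k t) + I (w + e)"
  proof -
    have "{w<..} = {w<..w + e} \<union> {w + e<..}" using e by auto
    moreover have "set_integrable lborel {w<..w + e} k" "set_integrable lborel {w + e<..} k"
      using w e by (auto intro!: int set_integrable_subset[OF int[OF w]])
    ultimately show ?thesis
      unfolding I_def using set_integral_Un[of "{w<..w + e}" "{w + e<..}" lborel k] by fastforce
  qed
  moreover have "(LINT t:{w<..w + e}|lborel. k t) \<le> 0"
    unfolding set_lebesgue_integral_def
  proof -
    have "indicator {w<..w + e} t *\<^sub>R k t \<le> 0" for t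
      using phi[of t] w by (auto simp: indicator_def k_def h1_def intro!: mult_nonneg_nonpos divide_nonpos_pos)
    then have "0 \<le> (\<integral>t. - (indicator {w<..w + e} t *\<^sub>R k t) \<partial>lborel)"
      by (intro integral_nonneg_AE AE_I2) simp
    then show "(\<integral>t. indicator {w<..w + e} t *\<^sub>R k t \<partial>lborel) \<le> 0" by simp
  qed
  ultimately have 1: "I w \<le> I (w + e)" by linarith
  have 2: "g1 n \<phi> (w + e) \<le> g1 n \<phi> w"
    using anti w e by (auto simp: monotone_on_def)
  have Ip: "I (w + e) > 0"
    using pos[of "w + e"] g1[of "w + e"] w e by (simp add: zero_less_mult_iff)
  have "w powr (real n / 2) * I w \<le> w powr (real n / 2) * I (w + e)"
    using 1 by (simp add: mult_left_mono)
  also have "\<dots> < (w + e) powr (real n / 2) * I (w + e)"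
    using Ip w e n by (intro mult_strict_right_mono powr_less_mono2) auto
  finally show False using 2 by (simp add: g1)
qed

lemma nn_integral_inverse_at_0:
  assumes "d > (0::real)"
  shows "(\<integral>\<^sup>+w. indicator {0<..<d} w * ennreal (1 / w) \<partial>lborel) = \<top>"
proof (rule ccontr)
  assume "(\<integral>\<^sup>+w. indicator {0<..<d} w * ennreal (1 / w) \<partial>lborel) \<noteq> \<top>"
  then obtain r where r: "r \<ge> 0" "(\<integral>\<^sup>+w. indicator {0<..<d} w * ennreal (1 / w) \<partial>lborel) = ennreal r"
    by (cases "\<integral>\<^sup>+w. indicator {0<..<d} w * ennreal (1 / w) \<partial>lborel" rule: ennreal_cases) auto
  \<comment> \<open>Chosen so that the integral of 1/w from \<open>a\<close> to \<open>d / 2\<close>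
    is \<open>r + 1\<close>, more than the supposed total \<open>r\<close>.\<close>
  define a where "a = d / 2 * exp (- (r + 1))"
  have a: "a > 0" "a \<le> d / 2" using assms r by (auto simp: a_def mult_le_cancel_left2)
  have "(\<integral>\<^sup>+w. ennreal (1 / w) * indicator {a..d / 2} w \<partial>lborel) = ennreal (ln (d / 2) - ln a)"
    by (rule nn_integral_FTC_Icc) (use a in \<open>auto intro!: derivative_eq_intros\<close>)
  moreover have "(\<integral>\<^sup>+w. ennreal (1 / w) * indicator {a..d / 2} w \<partial>lborel) \<le> ennreal r"
    unfolding r(2)[symmetric] using a assms
    by (intro nn_integral_mono) (auto simp: indicator_def)
  moreover have "ln (d / 2) - ln a = r + 1"
    using assms ln_mult[of "d / 2" "exp (- (r + 1))"] by (simp only: a_def ln_exp) simp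
  ultimately show False using r by simp
qed

section \<open>Density and tail of the chi-square ratio\<close>

lemma ratio_weight_deriv:
  assumes w: "w > 0"
  shows "(ratio_weight m n 0 has_real_derivative
    ratio_weight m n 0 w * ((real m / 2 - 1) / w - (real (m + n) / 2) / (1 + w))) (at w)"
proof -
  define C a c where "C = Gamma (real (m + n) / 2) / (Gamma (real m / 2) * Gamma (real n / 2))"
    and "a = real m / 2 - 1" and "c = real (m + n) / 2"
  have eq: "ratio_weight m n 0 x = C * (x powr a * (1 + x) powr (- c))" if "x > 0" for x
    using that by (simp add: ratio_weight_def C_def a_def c_def)
  have "((\<lambda>x. C * (x powr a * (1 + x) powr (- c))) has_real_derivative
    C * (w powr a * (1 + w) powr (- c)) * (a / w - c / (1 + w))) (at w)"
    using w by (auto intro!: derivative_eq_intros simp: powr_diff field_simps)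
  then have "(ratio_weight m n 0 has_real_derivative C * (w powr a * (1 + w) powr (- c)) * (a / w - c / (1 + w))) (at w)"
    by (rule has_field_derivative_transform_within_open[of _ _ _ "{0<..}"]) (use w eq in auto)
  then show ?thesis
    using eq[OF w] by (simp add: a_def c_def)
qed

lemma distr_ratio:
  assumes "m > 0" "n > 0"
  shows "distr (chi_square m \<Otimes>\<^sub>M chi_square n) borel (\<lambda>(u, v). u / v)
    = density lborel (\<lambda>w. ennreal (ratio_weight m n 0 w))"
proof (rule measure_eqI)
  fix A assume "A \<in> sets (distr (chi_square m \<Otimes>\<^sub>M chi_square n) borel (\<lambda>(u, v). u / v))"
  then have [measurable]: "A \<in> sets borel" by simp
  have [measurable]: "(\<lambda>(u, v). u / v) \<in> borel_measurable (chi_square m \<Otimes>\<^sub>M chi_square n)" by measurable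
  have "emeasure (distr (chi_square m \<Otimes>\<^sub>M chi_square n) borel (\<lambda>(u, v). u / v)) A
    = (\<integral>\<^sup>+z. indicator A z \<partial>distr (chi_square m \<Otimes>\<^sub>M chi_square n) borel (\<lambda>(u, v). u / v))"
    by (subst nn_integral_indicator) auto
  also have "\<dots> = (\<integral>\<^sup>+z. indicator A (case z of (u, v) \<Rightarrow> u / v) \<partial>(chi_square m \<Otimes>\<^sub>M chi_square n))"
    by (rule nn_integral_distr) measurable
  also have "\<dots> = (\<integral>\<^sup>+u. \<integral>\<^sup>+v. indicator A (u / v) * ennreal v ^ 0 \<partial>chi_square n \<partial>chi_square m)"
    by (subst chi_square.nn_integral_fst[symmetric]) (auto simp: case_prod_unfold)
  also have "\<dots> = (\<integral>\<^sup>+w. indicator A w * ennreal (ratio_weight m n 0 w) \<partial>lborel)"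
    by (rule nn_integral_ratio) (use assms in auto)
  also have "\<dots> = emeasure (density lborel (\<lambda>w. ennreal (ratio_weight m n 0 w))) A"
    by (subst emeasure_density) (auto simp: mult.commute)
  finally show "emeasure (distr (chi_square m \<Otimes>\<^sub>M chi_square n) borel (\<lambda>(u, v). u / v)) A
    = emeasure (density lborel (\<lambda>w. ennreal (ratio_weight m n 0 w))) A" .
qed simp

lemma integral_ratio:
  fixes F :: "real \<Rightarrow> real"
  assumes mn: "m > 0" "n > 0" and [measurable]: "F \<in> borel_measurable borel"
  shows "integrable (chi_square m \<Otimes>\<^sub>M chi_square n) (\<lambda>(u, v). F (u / v)) \<longleftrightarrow> integrable lborel (\<lambda>w. ratio_weight m n 0 w * F w)"
    and "(\<integral>z. (\<lambda>(u, v). F (u / v)) z \<partial>(chi_square m \<Otimes>\<^sub>M chi_square n)) = (\<integral>w. ratio_weight m n 0 w * F w \<partial>lborel)"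
proof -
  let ?R = "distr (chi_square m \<Otimes>\<^sub>M chi_square n) borel (\<lambda>(u, v). u / v)"
  have [measurable]: "(\<lambda>(u, v). u / v) \<in> borel_measurable (chi_square m \<Otimes>\<^sub>M chi_square n)" by measurable
  have "integrable ?R F \<longleftrightarrow> integrable (chi_square m \<Otimes>\<^sub>M chi_square n) (\<lambda>z. F (case z of (u, v) \<Rightarrow> u / v))"
    by (rule integrable_distr_eq) measurable
  moreover have "integrable ?R F \<longleftrightarrow> integrable lborel (\<lambda>w. ratio_weight m n 0 w * F w)"
    unfolding distr_ratio[OF mn] by (subst integrable_density) (auto simp: ratio_weight_nonneg)
  ultimately show "integrable (chi_square m \<Otimes>\<^sub>M chi_square n) (\<lambda>(u, v). F (u / v)) \<longleftrightarrow> integrable lborel (\<lambda>w. ratio_weight m n 0 w * F w)"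
    by (simp add: case_prod_unfold)
  have "integral\<^sup>L ?R F = (\<integral>z. F (case z of (u, v) \<Rightarrow> u / v) \<partial>(chi_square m \<Otimes>\<^sub>M chi_square n))"
    by (rule integral_distr) measurable
  moreover have "integral\<^sup>L ?R F = (\<integral>w. ratio_weight m n 0 w * F w \<partial>lborel)"
    unfolding distr_ratio[OF mn] by (subst integral_density) (auto simp: ratio_weight_nonneg)
  ultimately show "(\<integral>z. (\<lambda>(u, v). F (u / v)) z \<partial>(chi_square m \<Otimes>\<^sub>M chi_square n)) = (\<integral>w. ratio_weight m n 0 w * F w \<partial>lborel)"
    by (simp add: case_prod_unfold)
qed

lemma ratio_weight_0_upper:
  assumes "m > 0" "n > 0"
  obtains C where "C > 0" "\<And>w. w > 0 \<Longrightarrow> ratio_weight m n 0 w \<le> C * w powr (- 1 - real n / 2)"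
proof
  let ?C = "Gamma (real (m + n) / 2) / (Gamma (real m / 2) * Gamma (real n / 2))"
  show C: "?C > 0" using assms by (intro divide_pos_pos mult_pos_pos Gamma_real_pos) auto
  fix w :: real assume w: "w > 0"
  have "w powr (real m / 2 - 1) * (1 + w) powr (- (real (m + n) / 2)) \<le> w powr (real m / 2 - 1) * w powr (- (real (m + n) / 2))"
    using w by (intro mult_left_mono powr_mono2') auto
  also have "\<dots> = w powr (- 1 - real n / 2)"
    by (simp add: powr_add[symmetric] add_divide_distrib)
  finally have "w powr (real m / 2 - 1) * (1 + w) powr (- (real (m + n) / 2)) \<le> w powr (- 1 - real n / 2)" .
  from mult_left_mono[OF this, of ?C] C w show "ratio_weight m n 0 w \<le> ?C * w powr (- 1 - real n / 2)"
    by (simp add: ratio_weight_def)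
qed

text \<open>A boundary term of the integration by parts at infinity can only be present if the
  shrinkage function grows too fast.\<close>

lemma boundary_growth:
  assumes mn: "m > 0" "n > 0" and nn: "\<And>w. w > 0 \<Longrightarrow> \<phi> w \<ge> 0" and e: "\<epsilon> > 0"
    and ge: "\<And>w. w > R \<Longrightarrow> (4 * \<phi> w + 2 * (\<phi> w)\<^sup>2) * ratio_weight m n 0 w \<ge> \<epsilon>"
  shows "filterlim (\<lambda>w. (\<phi> w)\<^sup>2 / w) at_top at_top"
proof -
  obtain C where C: "C > 0" "\<And>w. w > 0 \<Longrightarrow> ratio_weight m n 0 w \<le> C * w powr (- 1 - real n / 2)"
    using ratio_weight_0_upper[OF mn] by blast
  define c where "c = \<epsilon> / C"
  have c: "c > 0" using e C by (simp add: c_def)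
  have "filterlim (\<lambda>w. c / 4 * w powr (1/2) - 1 / w) at_top at_top"
    using c by real_asymp
  moreover have "eventually (\<lambda>w. c / 4 * w powr (1/2) - 1 / w \<le> (\<phi> w)\<^sup>2 / w) at_top"
    using eventually_gt_at_top[of "max 1 R"]
  proof eventually_elim
    case (elim w)
    then have w: "w > 1" "w > R" by auto
    let ?P = "4 * \<phi> w + 2 * (\<phi> w)\<^sup>2"
    have P: "?P \<ge> 0" using nn[of w] w by simp
    have "\<epsilon> \<le> ?P * (C * w powr (- 1 - real n / 2))"
      using ge[OF w(2)] C(2)[of w] w P by (meson mult_left_mono order_trans zero_less_one less_trans)
    then have "c \<le> ?P * w powr (- 1 - real n / 2)"
      using C by (simp add: c_def field_simps)
    \<comment> \<open>As \<open>n\<close> is at least 1, the weight decays at least like w^(-3/2).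
      So \<open>?P\<close> grows at least like w^(3/2), and by 4 \<phi> \<le> 2 \<phi>^2 + 2 the
      quotient \<phi>^2 / w grows at least like the square root of \<open>w\<close>.\<close>
    also have "\<dots> \<le> ?P * w powr (- (3/2))"
      using P w mn by (intro mult_left_mono powr_mono) auto
    finally have "c * w powr (3/2) \<le> ?P * (w powr (- (3/2)) * w powr (3/2))"
      using w by (simp add: mult.assoc[symmetric])
    also have "w powr (- (3/2)) * w powr (3/2) = 1"
      using w by (simp add: powr_add[symmetric])
    finally have "c * w powr (3/2) \<le> ?P" by simp
    moreover have "?P \<le> 4 * (\<phi> w)\<^sup>2 + 2"
      using zero_le_power2[of "\<phi> w - 1"] by (simp add: power2_eq_square algebra_simps)
    moreover have "w powr (3/2) = w powr (1/2) * w"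
      using w powr_add[of w "1/2" 1] by simp
    ultimately have "c * (w powr (1/2) * w) \<le> 4 * (\<phi> w)\<^sup>2 + 4" by simp
    moreover have "(c / 4 * w powr (1/2) - 1 / w) * w = c * (w powr (1/2) * w) / 4 - 1"
      using w by (simp add: left_diff_distrib)
    ultimately have "(c / 4 * w powr (1/2) - 1 / w) * w \<le> (\<phi> w)\<^sup>2" by linarith
    then show ?case using w by (subst pos_le_divide_eq) auto
  qed
  ultimately show ?thesis by (rule filterlim_at_top_mono)
qed

section \<open>The boundary term and its derivative\<close>

context
  fixes \<phi> :: "real \<Rightarrow> real" and n m p j :: nat
  assumes p: "p \<ge> 3" and n: "n \<ge> 1" and m: "m = p + 2 * j"
    and lac: "locally_absolutely_continuous_on {0<..} \<phi>"
    and diff: "AE w in lborel. w > 0 \<longrightarrow> \<phi> differentiable (at w)"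
    and nn: "\<And>w. w > 0 \<Longrightarrow> \<phi> w \<ge> 0"
begin

definition rw0 :: "real \<Rightarrow> real" where "rw0 = ratio_weight m n 0"

text \<open>The derivative of 4 \<phi> + 2 \<phi>^2 is, up to sign, the part of \<open>b_fun\<close>
  that contains \<phi>'. Taken against the density of the ratio, integration by parts removes that
  part.\<close>

definition boundary_term :: "real \<Rightarrow> real" where
  "boundary_term w = (4 * \<phi> w + 2 * (\<phi> w)\<^sup>2) * rw0 w"

text \<open>Minus the derivative of \<open>boundary_term\<close>, arranged so that
  \<open>b_fun\<close> appears as a whole and the other terms contain \<phi> but not
  \<phi>'.\<close>

definition boundary_deriv :: "real \<Rightarrow> real" where
  "boundary_deriv w = indicator {0<..} w * rw0 w *
     (2 * real (m + n) * \<phi> w / (1 + w) - 2 * real m * \<phi> w / w + b_fun n \<phi> w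
       - real (m + n) * (\<phi> w)\<^sup>2 / (w * (1 + w)))"

lemma boundary_term_deriv:
  assumes w: "w > 0" and d: "\<phi> differentiable (at w)"
  shows "(boundary_term has_real_derivative - boundary_deriv w) (at w)"
proof -
  have d: "(\<phi> has_real_derivative deriv \<phi> w) (at w)"
    using d by (simp add: DERIV_deriv_iff_real_differentiable)
  have "(boundary_term has_real_derivative
      (4 * deriv \<phi> w + 2 * (2 * \<phi> w * deriv \<phi> w)) * rw0 w
      + rw0 w * ((real m / 2 - 1) / w - (real (m + n) / 2) / (1 + w)) * (4 * \<phi> w + 2 * (\<phi> w)\<^sup>2)) (at w)"
    unfolding boundary_term_def[abs_def] rw0_def
    by (rule derivative_eq_intros ratio_weight_deriv d w refl | simp)+
  moreover have "(4 * deriv \<phi> w + 2 * (2 * \<phi> w * deriv \<phi> w)) * rw0 w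
      + rw0 w * ((real m / 2 - 1) / w - (real (m + n) / 2) / (1 + w)) * (4 * \<phi> w + 2 * (\<phi> w)\<^sup>2) = - boundary_deriv w"
  proof -
    have r: "1 / (w * (1 + w)) = 1 / w - 1 / (1 + w)" using w by (simp add: field_simps)
    \<comment> \<open>A polynomial identity with X = 1/w and Y = 1/(1 + w). The relation XY = X - Y
      is applied separately to the last term of \<open>boundary_deriv\<close>, so only
      \<open>N = M + l\<close> is left to use.\<close>
    have core: "(4 * d + 2 * (2 * a * d)) * r + r * ((M / 2 - 1) * X - N / 2 * Y) * (4 * a + 2 * a\<^sup>2) =
      - (r * (2 * N * a * Y - 2 * M * a * X + (4 * a * X + (l + 2) * a\<^sup>2 * X - 4 * d - 4 * a * d) - N * a\<^sup>2 * (X - Y)))"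
      if "N = M + l" for a d r M N X Y l :: real
    proof -
      have l: "l = N - M" using that by simp
      show ?thesis unfolding l by (simp add: field_simps power2_eq_square)
    qed
    have e: "real (m + n) * (\<phi> w)\<^sup>2 / (w * (1 + w)) = real (m + n) * (\<phi> w)\<^sup>2 * (1 / w - 1 / (1 + w))"
      by (simp only: r[symmetric]) simp
    have rhs: "boundary_deriv w = rw0 w * (2 * real (m + n) * \<phi> w * (1 / (1 + w)) - 2 * real m * \<phi> w * (1 / w)
      + (4 * \<phi> w * (1 / w) + (real n + 2) * (\<phi> w)\<^sup>2 * (1 / w) - 4 * deriv \<phi> w - 4 * \<phi> w * deriv \<phi> w)
      - real (m + n) * (\<phi> w)\<^sup>2 * (1 / w - 1 / (1 + w)))"
      unfolding boundary_deriv_def b_fun_def e using w by simp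
    have lhs: "(real m / 2 - 1) / w - real (m + n) / 2 / (1 + w) = (real m / 2 - 1) * (1 / w) - real (m + n) / 2 * (1 / (1 + w))"
      by simp
    show ?thesis unfolding lhs rhs by (rule core) simp
  qed
  ultimately show ?thesis by simp
qed

lemma boundary_term_ac:
  assumes x: "0 < x" and xy: "x \<le> y"
  shows "absolutely_continuous_on_cbox x y boundary_term"
proof -
  have sub: "{x..y} \<subseteq> {0<..}" using x by auto
  have ac: "absolutely_continuous_on_cbox x y \<phi>"
    using lac sub by (auto simp: locally_absolutely_continuous_on_def)
  have "continuous_on {x..y} \<phi>" by (rule absolutely_continuous_on_cbox_continuous[OF ac])
  then obtain B where B: "\<And>w. w \<in> {x..y} \<Longrightarrow> \<bar>\<phi> w\<bar> \<le> B" "B \<ge> 0"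
    using compact_continuous_image[of "{x..y}" \<phi>] compact_imp_bounded bounded_pos
    by (metis (no_types, opaque_lifting) compact_Icc image_eqI less_eq_real_def real_norm_def)
  have d: "(rw0 has_real_derivative rw0 w * ((real m / 2 - 1) / w - (real (m + n) / 2) / (1 + w))) (at w)" if "w \<in> {x..y}" for w
    unfolding rw0_def using that x by (intro ratio_weight_deriv) auto
  then have contf: "continuous_on {x..y} rw0"
    by (meson DERIV_isCont continuous_at_imp_continuous_on)
  then have "continuous_on {x..y} (\<lambda>w. rw0 w * ((real m / 2 - 1) / w - (real (m + n) / 2) / (1 + w)))"
    using x by (auto intro!: continuous_intros)
  then obtain L where L: "\<And>w. w \<in> {x..y} \<Longrightarrow> \<bar>rw0 w * ((real m / 2 - 1) / w - (real (m + n) / 2) / (1 + w))\<bar> \<le> L" "L \<ge> 0"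
    using compact_continuous_image[of "{x..y}"] compact_imp_bounded bounded_pos
    by (metis (no_types, lifting) compact_Icc image_eqI less_eq_real_def real_norm_def)
  obtain K where K: "\<And>w. w \<in> {x..y} \<Longrightarrow> \<bar>rw0 w\<bar> \<le> K" "K \<ge> 0"
    using compact_continuous_image[OF contf] compact_imp_bounded bounded_pos
    by (metis (no_types, lifting) compact_Icc image_eqI less_eq_real_def real_norm_def)
  have lip: "\<bar>rw0 v - rw0 u\<bar> \<le> L * (v - u)" if "x \<le> u" "u \<le> v" "v \<le> y" for u v
  proof -
    have "norm (rw0 v - rw0 u) \<le> L * norm (v - u)"
      by (rule field_differentiable_bound[of "{x..y}" rw0 "\<lambda>w. rw0 w * ((real m / 2 - 1) / w - (real (m + n) / 2) / (1 + w))"])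
         (use that d L in \<open>auto intro: has_field_derivative_at_within\<close>)
    then show ?thesis using that by simp
  qed
  \<comment> \<open>The first summand pays for the increment of 4 \<phi> + 2 \<phi>^2 times the
    bound \<open>K\<close> of the weight, the second for the Lipschitz increment of the weight times
    the bound of 4 \<phi> + 2 \<phi>^2.\<close>
  define C where "C = K * (4 + 4 * B) + L * (4 * B + 2 * B\<^sup>2)"
  show ?thesis
  proof (rule absolutely_continuous_on_cbox_dominated[OF ac, of C])
    show "C \<ge> 0" using K L B by (simp add: C_def)
    fix u v assume uv: "x \<le> u" "u \<le> v" "v \<le> y"
    then have u: "u \<in> {x..y}" and v: "v \<in> {x..y}" by auto
    let ?A = "4 * (\<phi> v - \<phi> u) + 2 * ((\<phi> v)\<^sup>2 - (\<phi> u)\<^sup>2)" and ?G = "4 * \<phi> u + 2 * (\<phi> u)\<^sup>2"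
    have "?A = (\<phi> v - \<phi> u) * (4 + 2 * (\<phi> v + \<phi> u))" by (simp add: power2_eq_square algebra_simps)
    then have "\<bar>?A\<bar> = \<bar>\<phi> v - \<phi> u\<bar> * \<bar>4 + 2 * (\<phi> v + \<phi> u)\<bar>" by (simp add: abs_mult)
    also have "\<dots> \<le> \<bar>\<phi> v - \<phi> u\<bar> * (4 + 4 * B)"
      using B(1)[OF u] B(1)[OF v] by (intro mult_left_mono) auto
    finally have A: "\<bar>?A\<bar> \<le> \<bar>\<phi> v - \<phi> u\<bar> * (4 + 4 * B)" .
    have "(\<phi> u)\<^sup>2 \<le> B\<^sup>2" using B(1)[OF u] by (metis abs_ge_zero power2_abs power_mono)
    then have G: "\<bar>?G\<bar> \<le> 4 * B + 2 * B\<^sup>2"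
      using B(1)[OF u] zero_le_power2[of "\<phi> u"] by linarith
    have "boundary_term v - boundary_term u = rw0 v * ?A + (rw0 v - rw0 u) * ?G"
      by (simp add: boundary_term_def algebra_simps)
    then have "\<bar>boundary_term v - boundary_term u\<bar> \<le> \<bar>rw0 v\<bar> * \<bar>?A\<bar> + \<bar>rw0 v - rw0 u\<bar> * \<bar>?G\<bar>"
      by (metis abs_mult abs_triangle_ineq)
    also have "\<dots> \<le> K * (\<bar>\<phi> v - \<phi> u\<bar> * (4 + 4 * B)) + L * (v - u) * (4 * B + 2 * B\<^sup>2)"
      using K(1)[OF v] A lip[OF uv] G L(2) K(2) uv by (intro add_mono mult_mono) auto
    also have "\<dots> \<le> C * \<bar>\<phi> v - \<phi> u\<bar> + C * (v - u)"
    proof (intro add_mono)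
      have "K * (4 + 4 * B) \<le> C" "L * (4 * B + 2 * B\<^sup>2) \<le> C" using K L B by (auto simp: C_def)
      from mult_right_mono[OF this(1), of "\<bar>\<phi> v - \<phi> u\<bar>"] mult_right_mono[OF this(2), of "v - u"] uv
      show "K * (\<bar>\<phi> v - \<phi> u\<bar> * (4 + 4 * B)) \<le> C * \<bar>\<phi> v - \<phi> u\<bar>" "L * (v - u) * (4 * B + 2 * B\<^sup>2) \<le> C * (v - u)"
        by (simp_all add: mult_ac)
    qed
    finally show "\<bar>boundary_term v - boundary_term u\<bar> \<le> C * (\<bar>\<phi> v - \<phi> u\<bar> + (v - u))"
      by (simp add: distrib_left)
  qed
qed

lemma boundary_deriv_has_integral:
  assumes x: "0 < x" and xy: "x \<le> y"
  shows "(boundary_deriv has_integral (boundary_term x - boundary_term y)) {x..y}"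
proof -
  \<comment> \<open>The exceptional set need not be Borel; it is null for the completed measure and
    hence negligible for the gauge integral.\<close>
  have "{w. w > 0 \<and> \<not> \<phi> differentiable (at w)} \<in> null_sets lebesgue"
    using diff by (subst (asm) AE_completion_iff[symmetric]) (auto simp: eventually_ae_filter completion.complete2 intro: null_sets_completion_subset)
  then have N: "negligible {w. w > 0 \<and> \<not> \<phi> differentiable (at w)}"
    by (simp add: negligible_iff_null_sets)
  have "((\<lambda>w. - boundary_deriv w) has_integral (boundary_term y - boundary_term x)) {x..y}"
    by (rule absolutely_continuous_has_integral[OF boundary_term_ac[OF x xy] xy N])
       (use x in \<open>auto intro!: boundary_term_deriv\<close>)
  from has_integral_neg[OF this] show ?thesis by simp
qed

text \<open>Cutting at 0 makes \<phi>(w)/w Borel measurable and nonnegative on the whole line, while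
  \<phi> is controlled on the positive half line only.\<close>

definition hfun :: "real \<Rightarrow> real" where "hfun w = indicator {0<..} w * (\<phi> w / w)"

definition rw1 :: "real \<Rightarrow> real" where "rw1 = ratio_weight m n 1"

lemma measurable_hfun [measurable]: "hfun \<in> borel_measurable borel"
proof -
  have "continuous_on {0<..} (\<lambda>w. \<phi> w / w)"
    by (intro continuous_intros locally_absolutely_continuous_continuous[OF lac]) auto
  then have "(\<lambda>w. indicator {0<..} w *\<^sub>R (\<phi> w / w)) \<in> borel_measurable borel"
    by (intro borel_measurable_continuous_on_indicator) auto
  then show ?thesis by (simp add: hfun_def[abs_def])
qed

lemma measurable_rw [measurable]: "rw0 \<in> borel_measurable borel" "rw1 \<in> borel_measurable borel"
  by (auto simp: rw0_def rw1_def)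

lemma hfun_nonneg: "hfun w \<ge> 0"
  by (auto simp: hfun_def indicator_def nn)

lemma rw_nonneg: "rw0 w \<ge> 0" "rw1 w \<ge> 0"
  by (auto simp: rw0_def rw1_def ratio_weight_nonneg)

lemma rw_eq: "rw1 w * (1 + w) = real (m + n) * rw0 w"
proof -
  have "m > 0" "n > 0" using p n m by auto
  from ratio_weight_Suc[OF this, of 0 w] show ?thesis
    by (simp add: rw0_def rw1_def)
qed

lemma hfun_rw:
  assumes w: "w > 0"
  shows "hfun w * w * rw1 w = real (m + n) * \<phi> w / (1 + w) * rw0 w"
    "(hfun w)\<^sup>2 * w * rw1 w = real (m + n) * (\<phi> w)\<^sup>2 / (w * (1 + w)) * rw0 w"
proof -
  have r: "rw1 w = real (m + n) * rw0 w / (1 + w)"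
    using rw_eq[of w] w by (simp add: field_simps)
  show "hfun w * w * rw1 w = real (m + n) * \<phi> w / (1 + w) * rw0 w"
    "(hfun w)\<^sup>2 * w * rw1 w = real (m + n) * (\<phi> w)\<^sup>2 / (w * (1 + w)) * rw0 w"
    unfolding r using w by (simp_all add: hfun_def power2_eq_square)
qed

text \<open>The integral of \<open>boundary_deriv\<close> over the half line vanishes. Its integrand
  is a combination of those of the three expectations below and of the one of
  \<open>beta1_at\<close>, which is nonnegative and is dropped.\<close>

lemma weighted_inequality:
  assumes H: "integrable lborel (\<lambda>w. hfun w * rw0 w)"
    and Q: "integrable lborel (\<lambda>w. (hfun w)\<^sup>2 * w * rw1 w)"
    and B: "integrable lborel (\<lambda>w. rw0 w * beta1_integrand p n \<phi> j (w, 1))"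
    and B0: "(\<integral>w. rw0 w * beta1_integrand p n \<phi> j (w, 1) \<partial>lborel) \<ge> 0"
    and grow: "\<not> filterlim (\<lambda>w. (\<phi> w)\<^sup>2 / w) at_top at_top"
  shows "integrable lborel (\<lambda>w. hfun w * w * rw1 w)"
    and "real (m - 1) * (\<integral>w. (hfun w)\<^sup>2 * w * rw1 w \<partial>lborel) + 4 * real j * (real m * (\<integral>w. hfun w * rw0 w \<partial>lborel))
      \<le> 2 * real (m - 1) * (\<integral>w. hfun w * w * rw1 w \<partial>lborel)"
proof -
  let ?B = "\<lambda>w. rw0 w * beta1_integrand p n \<phi> j (w, 1)"
  let ?V = "\<lambda>w. hfun w * w * rw1 w" and ?Q = "\<lambda>w. (hfun w)\<^sup>2 * w * rw1 w" and ?H = "\<lambda>w. hfun w * rw0 w"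
  have m1: "m > 1" "n > 0" using m p n by auto
  have rw00: "rw0 w = 0" "rw1 w = 0" if "\<not> w > 0" for w
    using that by (simp_all add: rw0_def rw1_def ratio_weight_def)
  show V: "integrable lborel ?V"
  proof (rule Bochner_Integration.integrable_bound[OF integrable_mult_right[OF H, of "real (m + n)"]])
    show "AE w in lborel. norm (?V w) \<le> norm (real (m + n) * (hfun w * rw0 w))"
    proof (rule AE_I2)
      fix w :: real
      show "norm (?V w) \<le> norm (real (m + n) * (hfun w * rw0 w))"
      proof (cases "w > 0")
        case True
        have "?V w \<le> hfun w * (rw1 w * (1 + w))"
          using True hfun_nonneg[of w] rw_nonneg[of w] by (simp add: algebra_simps)
        also have "\<dots> = real (m + n) * (hfun w * rw0 w)" by (simp add: rw_eq)
        finally show ?thesis using True hfun_nonneg[of w] rw_nonneg[of w] by simp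
      qed (simp add: rw00)
    qed
  qed measurable
  \<comment> \<open>Undoes the factor (m - 1)/m that \<open>beta1_integrand\<close> puts in front of
    \<open>b_fun\<close>.\<close>
  define \<kappa> where "\<kappa> = real m / real (m - 1)"
  have \<kappa>: "real (m - 1) * \<kappa> = real m" "\<kappa> > 0" using m1 by (auto simp: \<kappa>_def)
  have dec: "boundary_deriv w = 2 * ?V w - 2 * real m * ?H w + \<kappa> * (2 * (real p - 1) * ?H w - ?B w) - ?Q w" for w
  proof (cases "w > 0")
    case True
    have mj: "real p + 2 * real j = real m" "real m - 1 = real (m - 1)" using m m1 by auto
    have "beta1_integrand p n \<phi> j (w, 1) = 2 * (real p - 1) * hfun w - real (m - 1) * b_fun n \<phi> w / real m"
      using True unfolding beta1_integrand_def split_conv mj by (simp add: hfun_def)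
    then have "\<kappa> * (2 * (real p - 1) * ?H w - ?B w) = \<kappa> * (real (m - 1) * b_fun n \<phi> w / real m) * rw0 w"
      by (simp only:) (simp add: right_diff_distrib mult_ac)
    also have "\<kappa> * (real (m - 1) * b_fun n \<phi> w / real m) = b_fun n \<phi> w"
      using \<kappa>(1) m1 by (simp add: mult.assoc[symmetric] mult.commute[of \<kappa>])
    finally have b: "\<kappa> * (2 * (real p - 1) * ?H w - ?B w) = b_fun n \<phi> w * rw0 w" .
    have H: "?H w = \<phi> w / w * rw0 w" using True by (simp add: hfun_def)
    show ?thesis
      unfolding b hfun_rw[OF True] unfolding H boundary_deriv_def using True by (simp add: algebra_simps)
  qed (simp add: boundary_deriv_def rw00)
  have int: "integrable lborel boundary_deriv"
    unfolding dec using V Q H B by (intro Bochner_Integration.integrable_diff Bochner_Integration.integrable_add integrable_mult_right) auto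
  have zero: "(\<integral>w. boundary_deriv w \<partial>lborel) = 0"
  proof -
    have bt_nonneg: "boundary_term w \<ge> 0" if "w > 0" for w
      using nn[OF that] rw_nonneg by (simp add: boundary_term_def)
    \<comment> \<open>If the boundary term stayed above \<open>\<epsilon>\<close> near 0, then
      \<open>\<epsilon> / w\<close> would lie below the integrable function \<open>?U\<close> there,
      but its integral diverges.\<close>
    have low: "\<exists>x. 0 < x \<and> x < d \<and> boundary_term x < \<epsilon>" if d: "d > 0" "d \<le> 1" and e: "\<epsilon> > 0" for d \<epsilon>
    proof (rule ccontr)
      assume "\<not> ?thesis"
      then have ge: "boundary_term x \<ge> \<epsilon>" if "0 < x" "x < d" for x using that by (meson not_le)
      let ?U = "\<lambda>w. 4 * ?H w + 4 * ?Q w"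
      have intU: "integrable lborel ?U" using H Q by simp
      have "ennreal \<epsilon> * (\<integral>\<^sup>+w. indicator {0<..<d} w * ennreal (1 / w) \<partial>lborel) = (\<integral>\<^sup>+w. ennreal \<epsilon> * (indicator {0<..<d} w * ennreal (1 / w)) \<partial>lborel)"
        by (rule nn_integral_cmult[symmetric]) measurable
      also have "\<dots> \<le> (\<integral>\<^sup>+w. ennreal (norm (?U w)) \<partial>lborel)"
      proof (rule nn_integral_mono, goal_cases)
        case (1 w)
        show ?case
        proof (cases "0 < w \<and> w < d")
          case True
          have "(\<phi> w)\<^sup>2 / w * rw0 w = (hfun w)\<^sup>2 * w * rw0 w"
            using True by (simp add: hfun_def power2_eq_square)
          also have "\<dots> \<le> (hfun w)\<^sup>2 * w * (2 * rw1 w)"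
          proof -
            \<comment> \<open>Near 0 the two weights are comparable, since 1 + w is at most 2 and m
              + n is at least 1.\<close>
            have "rw0 w \<le> real (m + n) * rw0 w" using m1 rw_nonneg(1)[of w] by (simp add: mult_le_cancel_right1)
            also have "\<dots> = rw1 w * (1 + w)" by (simp add: rw_eq)
            also have "\<dots> \<le> rw1 w * 2" using True d rw_nonneg(2)[of w] by (intro mult_left_mono) auto
            finally show ?thesis using True by (intro mult_left_mono) auto
          qed
          finally have 1: "(\<phi> w)\<^sup>2 / w * rw0 w \<le> 2 * ?Q w" by simp
          have "\<epsilon> * (1 / w) \<le> boundary_term w * (1 / w)"
            using ge[of w] True by (intro mult_right_mono) auto
          also have "\<dots> = 4 * ?H w + 2 * ((\<phi> w)\<^sup>2 / w * rw0 w)"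
            using True by (simp add: boundary_term_def hfun_def algebra_simps add_divide_distrib)
          also have "\<dots> \<le> ?U w" using 1 by simp
          finally have "\<epsilon> * (1 / w) \<le> norm (?U w)" by simp
          then show ?thesis using True e by (simp add: ennreal_mult[symmetric] ennreal_leI)
        qed (auto simp: indicator_def)
      qed
      also have "\<dots> < \<infinity>" using intU by (simp add: integrable_iff_bounded)
      finally show False
        unfolding nn_integral_inverse_at_0[OF d(1)] using e by (simp add: ennreal_mult_top)
    qed
    have high: "\<exists>y. y > R \<and> boundary_term y < \<epsilon>" if e: "\<epsilon> > 0" for R \<epsilon>
    proof (rule ccontr)
      assume "\<not> ?thesis"
      then have "boundary_term y \<ge> \<epsilon>" if "y > R" for y using that by (meson not_le)
      then show False
        using boundary_growth[of m n \<phi> \<epsilon> R] nn e m1 grow by (auto simp: boundary_term_def rw0_def)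
    qed
    \<comment> \<open>No limit of the boundary term is claimed. Two sequences along which it tends
      to 0 suffice, because the integrals over the growing intervals converge by domination.\<close>
    have "\<forall>k. \<exists>x y. 0 < x \<and> x < inverse (real (Suc k)) \<and> boundary_term x < inverse (real (Suc k)) \<and>
        y > real (Suc k) \<and> boundary_term y < inverse (real (Suc k))"
    proof
      fix k
      have k: "inverse (real (Suc k)) > 0" "inverse (real (Suc k)) \<le> 1" by (auto simp: field_simps)
      show "\<exists>x y. 0 < x \<and> x < inverse (real (Suc k)) \<and> boundary_term x < inverse (real (Suc k)) \<and>
        y > real (Suc k) \<and> boundary_term y < inverse (real (Suc k))"
        using low[OF k k(1)] high[OF k(1), of "real (Suc k)"] by blast
    qed
    then obtain x y where xy: "\<And>k. 0 < x k" "\<And>k. x k < inverse (real (Suc k))" "\<And>k. boundary_term (x k) < inverse (real (Suc k))"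
      "\<And>k. y k > real (Suc k)" "\<And>k. boundary_term (y k) < inverse (real (Suc k))" by metis
    have le: "x k \<le> y k" for k
    proof -
      have "inverse (real (Suc k)) \<le> 1" "1 \<le> real (Suc k)" by (auto simp: field_simps)
      then show ?thesis using xy(2)[of k] xy(4)[of k] by linarith
    qed
    have val: "(\<integral>w. indicator {x k..y k} w *\<^sub>R boundary_deriv w \<partial>lborel) = boundary_term (x k) - boundary_term (y k)" for k
    proof -
      have "set_integrable lborel {x k..y k} boundary_deriv"
        using int unfolding set_integrable_def by (intro integrable_mult_indicator) auto
      from set_borel_integral_eq_integral(2)[OF this] show ?thesis
        unfolding set_lebesgue_integral_def using boundary_deriv_has_integral[OF xy(1) le, of k]
        by (simp add: integral_unique)
    qed
    have "(\<lambda>k. \<integral>w. indicator {x k..y k} w *\<^sub>R boundary_deriv w \<partial>lborel) \<longlonglongrightarrow> (\<integral>w. boundary_deriv w \<partial>lborel)"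
    proof (rule integral_dominated_convergence[where w="\<lambda>w. norm (boundary_deriv w)"])
      show "AE w in lborel. (\<lambda>k. indicator {x k..y k} w *\<^sub>R boundary_deriv w) \<longlonglongrightarrow> boundary_deriv w"
      proof (rule AE_I2)
        fix w :: real
        show "(\<lambda>k. indicator {x k..y k} w *\<^sub>R boundary_deriv w) \<longlonglongrightarrow> boundary_deriv w"
        proof (cases "w > 0")
          case True
          obtain N :: nat where N: "max w (inverse w) \<le> real N" using real_arch_simple by blast
          have "\<forall>\<^sub>F k in sequentially. indicator {x k..y k} w *\<^sub>R boundary_deriv w = boundary_deriv w"
            using eventually_ge_at_top[of N]
          proof eventually_elim
            case (elim k)
            then have "w \<le> real (Suc k)" "inverse w \<le> real (Suc k)" using N by auto
            then have "inverse (real (Suc k)) \<le> w" "w \<le> real (Suc k)"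
              using True by (auto simp: inverse_eq_divide field_simps)
            then have "w \<in> {x k..y k}"
              using xy(2)[of k] xy(4)[of k] unfolding atLeastAtMost_iff by linarith
            then show ?case by simp
          qed
          then show ?thesis by (rule tendsto_eventually)
        qed (simp add: boundary_deriv_def)
      qed
      show "AE w in lborel. norm (indicator {x k..y k} w *\<^sub>R boundary_deriv w) \<le> norm (boundary_deriv w)" for k
        by (rule AE_I2) (auto simp: indicator_def)
    qed (use int in auto)
    moreover have "(\<lambda>k. \<integral>w. indicator {x k..y k} w *\<^sub>R boundary_deriv w \<partial>lborel) \<longlonglongrightarrow> 0"
    proof (rule Lim_null_comparison[OF always_eventually LIMSEQ_inverse_real_of_nat], rule allI)
      fix k
      have "y k > 0" using xy(4)[of k] by (meson less_trans of_nat_0_less_iff zero_less_Suc)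
      then show "norm (\<integral>w. indicator {x k..y k} w *\<^sub>R boundary_deriv w \<partial>lborel) \<le> inverse (real (Suc k))"
        unfolding val using bt_nonneg[OF xy(1)[of k]] bt_nonneg[of "y k"] xy(3)[of k] xy(5)[of k]
        by (simp add: abs_if del: of_nat_Suc)
    qed
    ultimately show ?thesis by (rule LIMSEQ_unique)
  qed
  let ?iV = "\<integral>w. ?V w \<partial>lborel" and ?iH = "\<integral>w. ?H w \<partial>lborel" and ?iQ = "\<integral>w. ?Q w \<partial>lborel" and ?iB = "\<integral>w. ?B w \<partial>lborel"
  have "0 = 2 * ?iV - 2 * real m * ?iH + \<kappa> * (2 * (real p - 1) * ?iH - ?iB) - ?iQ"
    using zero unfolding dec using V Q H B by simp
  then have "?iQ + 2 * real m * ?iH + \<kappa> * ?iB = 2 * ?iV + \<kappa> * (2 * (real p - 1) * ?iH)"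
    by (simp add: right_diff_distrib)
  then have "?iQ + 2 * real m * ?iH \<le> 2 * ?iV + \<kappa> * (2 * (real p - 1) * ?iH)"
    using \<kappa>(2) B0 by (smt (verit) mult_nonneg_nonneg)
  from mult_left_mono[OF this, of "real (m - 1)"]
  have "real (m - 1) * ?iQ + real (m - 1) * (2 * real m * ?iH) \<le> real (m - 1) * (2 * ?iV) + real (m - 1) * \<kappa> * (2 * (real p - 1) * ?iH)"
    by (simp add: algebra_simps)
  \<comment> \<open>The total coefficient of the integral of \<open>?H\<close> is 2m((m - 1) - (p -
    1)), and m - p = 2j.\<close>
  moreover have "real (m - 1) * (2 * real m * ?iH) - real m * (2 * (real p - 1) * ?iH) = 4 * real j * (real m * ?iH)"
  proof -
    have e: "real (m - 1) = real p + 2 * real j - 1" using m m1 by auto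
    show ?thesis unfolding e by (simp add: algebra_simps)
  qed
  ultimately show "real (m - 1) * ?iQ + 4 * real j * (real m * ?iH) \<le> 2 * real (m - 1) * ?iV"
    unfolding \<kappa>(1) by linarith
qed

end

section \<open>Expectations of functions of the chi-square ratio\<close>

definition ratio_expectation :: "nat \<Rightarrow> nat \<Rightarrow> (real \<Rightarrow> ennreal) \<Rightarrow> ennreal" where
  "ratio_expectation n k F = (\<integral>\<^sup>+u. \<integral>\<^sup>+v. F (u / v) \<partial>chi_square n \<partial>chi_square k)"

lemma ratio_expectation_weight:
  assumes "m > 0" "n > 0" and [measurable]: "F \<in> borel_measurable borel"
  shows "ratio_expectation n m F = (\<integral>\<^sup>+w. F w * ennreal (ratio_weight m n 0 w) \<partial>lborel)"
  using nn_integral_ratio[OF assms, of 0] by (simp add: ratio_expectation_def)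

text \<open>The first form is size-biasing in the numerator. The second writes
  \<open>u = (u / v) * v\<close>, where the factor \<open>v\<close> selects the ratio weight of
  index 1.\<close>

lemma ratio_expectation_shift:
  assumes m: "m > 0" and n: "n > 0" and [measurable]: "F \<in> borel_measurable borel"
  shows "of_nat m * ratio_expectation n (m + 2) F = (\<integral>\<^sup>+u. \<integral>\<^sup>+v. F (u / v) * ennreal u \<partial>chi_square n \<partial>chi_square m)"
    and "of_nat m * ratio_expectation n (m + 2) F = (\<integral>\<^sup>+w. F w * ennreal w * ennreal (ratio_weight m n 1 w) \<partial>lborel)"
proof -
  show 1: "of_nat m * ratio_expectation n (m + 2) F = (\<integral>\<^sup>+u. \<integral>\<^sup>+v. F (u / v) * ennreal u \<partial>chi_square n \<partial>chi_square m)"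
    unfolding ratio_expectation_def
    by (subst nn_integral_chi_square_mult[symmetric, OF m]) (auto simp: nn_integral_multc)
  have "(\<integral>\<^sup>+u. \<integral>\<^sup>+v. F (u / v) * ennreal u \<partial>chi_square n \<partial>chi_square m)
    = (\<integral>\<^sup>+u. \<integral>\<^sup>+v. (F (u / v) * ennreal (u / v)) * ennreal v ^ 1 \<partial>chi_square n \<partial>chi_square m)"
  proof (rule nn_integral_cong, rule nn_integral_cong_AE)
    fix u :: real
    show "AE v in chi_square n. F (u / v) * ennreal u = (F (u / v) * ennreal (u / v)) * ennreal v ^ 1"
      using AE_chi_square_pos
    proof eventually_elim
      case (elim v)
      have "ennreal u = ennreal (u / v) * ennreal v"
        using elim ennreal_mult''[of v "u / v"] by simp
      then show ?case by (simp add: mult.assoc)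
    qed
  qed
  also have "\<dots> = (\<integral>\<^sup>+w. F w * ennreal w * ennreal (ratio_weight m n 1 w) \<partial>lborel)"
    by (rule nn_integral_ratio) (use m n in auto)
  finally show "of_nat m * ratio_expectation n (m + 2) F = (\<integral>\<^sup>+w. F w * ennreal w * ennreal (ratio_weight m n 1 w) \<partial>lborel)"
    unfolding 1 .
qed

text \<open>The reciprocal undoes the size-biasing that leads from \<open>m - 2\<close> to
  \<open>m\<close> degrees of freedom, so \<open>m - 2\<close> has to be positive.\<close>

lemma chi_square_inverse_finite:
  assumes "m \<ge> 3"
  shows "(\<integral>\<^sup>+u. ennreal (1 / u) \<partial>chi_square m) < \<top>"
proof -
  have "of_nat (m - 2) * (\<integral>\<^sup>+u. ennreal (1 / u) \<partial>chi_square (m - 2 + 2)) = (\<integral>\<^sup>+u. ennreal (1 / u) * ennreal u \<partial>chi_square (m - 2))"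
    using assms by (intro nn_integral_chi_square_mult[symmetric]) auto
  also have "\<dots> \<le> (\<integral>\<^sup>+u. 1 \<partial>chi_square (m - 2))"
  proof (rule nn_integral_mono, goal_cases)
    case (1 u)
    show ?case
      by (cases "u > 0") (auto simp: ennreal_mult[symmetric] ennreal_neg)
  qed
  also have "\<dots> = 1"
    using assms prob_space.emeasure_space_1[OF prob_space_chi_square[of "m - 2"]] by simp
  also have "(1::ennreal) < \<top>" by simp
  also have "m - 2 + 2 = m" using assms by simp
  finally have "of_nat (m - 2) * (\<integral>\<^sup>+u. ennreal (1 / u) \<partial>chi_square m) < \<top>" .
  then show ?thesis using assms by (auto simp: ennreal_mult_less_top)
qed

text \<open>By 2h <= h^2 u + 1/u: the first summand is a size-biased second moment, the second has
  finite mean.\<close>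

lemma ratio_expectation_finite:
  assumes m: "m \<ge> 3" and n: "n > 0" and [measurable]: "h \<in> borel_measurable borel"
    and nn: "\<And>w. h w \<ge> 0" and fin: "ratio_expectation n (m + 2) (\<lambda>w. ennreal ((h w)\<^sup>2)) < \<top>"
  shows "ratio_expectation n m (\<lambda>w. ennreal (h w)) < \<top>"
proof -
  have pn: "prob_space (chi_square n)" by (rule prob_space_chi_square[OF n])
  have "ratio_expectation n m (\<lambda>w. ennreal (h w)) \<le>
    (\<integral>\<^sup>+u. \<integral>\<^sup>+v. ennreal ((h (u / v))\<^sup>2) * ennreal u + ennreal (1 / u) \<partial>chi_square n \<partial>chi_square m)"
    unfolding ratio_expectation_def
  proof (intro nn_integral_mono_AE, use AE_chi_square_pos in eventually_elim)
    fix u :: real assume u: "0 < u"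
    show "(\<integral>\<^sup>+v. ennreal (h (u / v)) \<partial>chi_square n) \<le> (\<integral>\<^sup>+v. ennreal ((h (u / v))\<^sup>2) * ennreal u + ennreal (1 / u) \<partial>chi_square n)"
    proof (rule nn_integral_mono, goal_cases)
      case (1 v)
      let ?h = "h (u / v)"
      have "2 * ?h \<le> ?h\<^sup>2 * u + 1 / u"
      proof -
        have "0 \<le> (?h * u - 1)\<^sup>2 / u" using u by simp
        also have "\<dots> = ?h\<^sup>2 * u + 1 / u - 2 * ?h"
          using u by (simp add: power2_eq_square field_simps)
        finally show ?thesis by simp
      qed
      then have "?h \<le> ?h\<^sup>2 * u + 1 / u" using nn[of "u / v"] by simp
      then show ?case
        using u by (simp add: ennreal_mult[symmetric] ennreal_plus[symmetric] ennreal_leI del: ennreal_plus)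
    qed
  qed
  also have "\<dots> = of_nat m * ratio_expectation n (m + 2) (\<lambda>w. ennreal ((h w)\<^sup>2)) + (\<integral>\<^sup>+u. ennreal (1 / u) \<partial>chi_square m)"
    using m n prob_space.emeasure_space_1[OF pn]
    by (subst ratio_expectation_shift(1)) (auto simp: nn_integral_add)
  also have "\<dots> < \<top>"
    using fin chi_square_inverse_finite[OF m] by (simp add: ennreal_mult_less_top of_nat_less_top)
  finally show ?thesis .
qed

text \<open>\<open>weighted_inequality\<close> in terms of expectations. Size-biasing attaches the
  factor \<open>m\<close> to the two terms with two more degrees of freedom, the remaining term
  already carries it, and so it cancels.\<close>

lemma ratio_expectation_inequality:
  fixes \<phi> :: "real \<Rightarrow> real"
  assumes p: "p \<ge> 3" and n: "n \<ge> 1"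
    and lac: "locally_absolutely_continuous_on {0<..} \<phi>"
    and diff: "AE w in lborel. w > 0 \<longrightarrow> \<phi> differentiable (at w)"
    and nn: "\<And>w. w > 0 \<Longrightarrow> \<phi> w \<ge> 0"
    and grow: "\<not> filterlim (\<lambda>w. (\<phi> w)\<^sup>2 / w) at_top at_top"
    and int: "integrable (chi_square (p + 2 * j) \<Otimes>\<^sub>M chi_square n) (beta1_integrand p n \<phi> j)"
    and beta: "beta1_at p n \<phi> j \<ge> 0"
    and fin: "ratio_expectation n (p + 2 * j + 2) (\<lambda>w. ennreal ((hfun \<phi> w)\<^sup>2)) < \<top>"
  shows "of_nat (p + 2 * j - 1) * ratio_expectation n (p + 2 * j + 2) (\<lambda>w. ennreal ((hfun \<phi> w)\<^sup>2))
      + of_nat (4 * j) * ratio_expectation n (p + 2 * j) (\<lambda>w. ennreal (hfun \<phi> w))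
    \<le> of_nat (2 * (p + 2 * j - 1)) * ratio_expectation n (p + 2 * j + 2) (\<lambda>w. ennreal (hfun \<phi> w))"
proof -
  define m where "m = p + 2 * j"
  have m3: "m \<ge> 3" "m > 0" "n > 0" using p n by (auto simp: m_def)
  note ctx = p n m_def lac diff nn
  let ?h = "hfun \<phi>" and ?r0 = "rw0 n m" and ?r1 = "rw1 n m"
  have [measurable]: "?h \<in> borel_measurable borel" by (rule measurable_hfun[OF ctx])
  have [measurable]: "?r0 \<in> borel_measurable borel" "?r1 \<in> borel_measurable borel"
    using measurable_rw[OF ctx] by auto
  have hn: "?h w \<ge> 0" for w by (rule hfun_nonneg[OF ctx])
  have rn: "?r0 w \<ge> 0" "?r1 w \<ge> 0" for w using rw_nonneg[OF ctx] by auto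
  have r: "ratio_weight m n 0 = ?r0" "ratio_weight m n 1 = ?r1"
    by (simp_all add: rw0_def[OF ctx] rw1_def[OF ctx])
  have fin': "ratio_expectation n m (\<lambda>w. ennreal (?h w)) < \<top>"
    by (rule ratio_expectation_finite) (use m3 fin hn in \<open>auto simp: m_def\<close>)
  have nH: "ratio_expectation n m (\<lambda>w. ennreal (?h w)) = (\<integral>\<^sup>+w. ennreal (?h w * ?r0 w) \<partial>lborel)"
    using m3 by (subst ratio_expectation_weight) (auto simp: r ennreal_mult hn rn)
  have r1z: "?r1 w = 0" if "\<not> w > 0" for w
    using that by (simp add: r[symmetric] ratio_weight_def)
  have nQ: "of_nat m * ratio_expectation n (m + 2) (\<lambda>w. ennreal ((?h w)\<^sup>2)) = (\<integral>\<^sup>+w. ennreal ((?h w)\<^sup>2 * w * ?r1 w) \<partial>lborel)"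
  proof (subst ratio_expectation_shift(2), goal_cases)
    case 4
    show ?case unfolding r
    proof (rule nn_integral_cong, goal_cases)
      case (1 w)
      show ?case
        by (cases "w > 0") (auto simp: ennreal_mult rn r1z)
    qed
  qed (use m3 in auto)
  have nV: "of_nat m * ratio_expectation n (m + 2) (\<lambda>w. ennreal (?h w)) = (\<integral>\<^sup>+w. ennreal (?h w * w * ?r1 w) \<partial>lborel)"
  proof (subst ratio_expectation_shift(2), goal_cases)
    case 4
    show ?case unfolding r
    proof (rule nn_integral_cong, goal_cases)
      case (1 w)
      show ?case
        by (cases "w > 0") (auto simp: ennreal_mult rn hn r1z)
    qed
  qed (use m3 in auto)
  have posQ: "(?h w)\<^sup>2 * w * ?r1 w \<ge> 0" and posV: "?h w * w * ?r1 w \<ge> 0" for w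
    by (cases "w > 0"; simp add: rn hn r1z)+
  have H: "integrable lborel (\<lambda>w. ?h w * ?r0 w)"
    using fin' hn rn by (intro integrableI_nonneg) (auto simp: nH)
  have Q: "integrable lborel (\<lambda>w. (?h w)\<^sup>2 * w * ?r1 w)"
  proof (rule integrableI_nonneg)
    have "ratio_expectation n (m + 2) (\<lambda>w. ennreal ((?h w)\<^sup>2)) < \<top>"
      unfolding m_def by (rule fin)
    then show "(\<integral>\<^sup>+w. ennreal ((?h w)\<^sup>2 * w * ?r1 w) \<partial>lborel) < \<infinity>"
      unfolding nQ[symmetric] by (simp add: ennreal_mult_less_top of_nat_less_top)
  qed (use posQ in auto)
  \<comment> \<open>The integrand depends on its two arguments through their ratio only, so it may
    be evaluated at second argument 1.\<close>
  let ?F = "\<lambda>w. beta1_integrand p n \<phi> j (w, 1)"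
  have eq: "beta1_integrand p n \<phi> j = (\<lambda>(u, v). ?F (u / v))"
    by (auto simp: beta1_integrand_def)
  \<comment> \<open>The integrand contains \<open>deriv \<phi>\<close>; its measurability is taken
    from the integrability hypothesis.\<close>
  have Fm[measurable]: "?F \<in> borel_measurable borel"
  proof -
    have "beta1_integrand p n \<phi> j \<in> borel_measurable (borel \<Otimes>\<^sub>M borel)"
      using borel_measurable_integrable[OF int] by (simp cong: measurable_cong_sets)
    then show ?thesis by (rule measurable_compose[rotated]) measurable
  qed
  have "integrable (chi_square m \<Otimes>\<^sub>M chi_square n) (\<lambda>(u, v). ?F (u / v))"
    unfolding m_def by (rule subst[OF eq, of "\<lambda>f. integrable _ f", OF int])
  then have B: "integrable lborel (\<lambda>w. ?r0 w * ?F w)"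
    using integral_ratio(1)[OF m3(2,3) Fm] by (simp add: r)
  have "(\<integral>z. (\<lambda>(u, v). ?F (u / v)) z \<partial>(chi_square m \<Otimes>\<^sub>M chi_square n)) \<ge> 0"
    unfolding m_def by (rule subst[OF eq, of "\<lambda>f. 0 \<le> integral\<^sup>L _ f", OF beta[unfolded beta1_at_def]])
  then have B0: "(\<integral>w. ?r0 w * ?F w \<partial>lborel) \<ge> 0"
    unfolding integral_ratio(2)[OF m3(2,3) Fm] by (simp add: r)
  have V: "integrable lborel (\<lambda>w. ?h w * w * ?r1 w)"
    by (rule weighted_inequality(1)[OF ctx H Q B B0 grow])
  have ineq: "real (m - 1) * (\<integral>w. (?h w)\<^sup>2 * w * ?r1 w \<partial>lborel) + 4 * real j * (real m * (\<integral>w. ?h w * ?r0 w \<partial>lborel))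
      \<le> 2 * real (m - 1) * (\<integral>w. ?h w * w * ?r1 w \<partial>lborel)"
    by (rule weighted_inequality(2)[OF ctx H Q B B0 grow])
  have iH: "ratio_expectation n m (\<lambda>w. ennreal (?h w)) = ennreal (\<integral>w. ?h w * ?r0 w \<partial>lborel)"
    unfolding nH by (rule nn_integral_eq_integral[OF H]) (auto simp: hn rn)
  have iQ: "of_nat m * ratio_expectation n (m + 2) (\<lambda>w. ennreal ((?h w)\<^sup>2)) = ennreal (\<integral>w. (?h w)\<^sup>2 * w * ?r1 w \<partial>lborel)"
    unfolding nQ by (rule nn_integral_eq_integral[OF Q]) (auto simp: posQ)
  have iV: "of_nat m * ratio_expectation n (m + 2) (\<lambda>w. ennreal (?h w)) = ennreal (\<integral>w. ?h w * w * ?r1 w \<partial>lborel)"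
    unfolding nV by (rule nn_integral_eq_integral[OF V]) (auto simp: posV)
  have pos: "(\<integral>w. ?h w * ?r0 w \<partial>lborel) \<ge> 0" "(\<integral>w. (?h w)\<^sup>2 * w * ?r1 w \<partial>lborel) \<ge> 0" "(\<integral>w. ?h w * w * ?r1 w \<partial>lborel) \<ge> 0"
    by (auto intro!: integral_nonneg_AE simp: hn rn posQ posV)
  have "of_nat m * (of_nat (m - 1) * ratio_expectation n (m + 2) (\<lambda>w. ennreal ((?h w)\<^sup>2)) + of_nat (4 * j) * ratio_expectation n m (\<lambda>w. ennreal (?h w)))
    = of_nat (m - 1) * (of_nat m * ratio_expectation n (m + 2) (\<lambda>w. ennreal ((?h w)\<^sup>2))) + of_nat (4 * j) * (of_nat m * ratio_expectation n m (\<lambda>w. ennreal (?h w)))"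
    by (simp add: distrib_left mult_ac)
  also have "\<dots> = ennreal (real (m - 1) * (\<integral>w. (?h w)\<^sup>2 * w * ?r1 w \<partial>lborel) + 4 * real j * (real m * (\<integral>w. ?h w * ?r0 w \<partial>lborel)))"
    unfolding iH iQ using pos by (simp add: ennreal_of_nat_eq_real_of_nat ennreal_mult[symmetric])
  also have "\<dots> \<le> ennreal (2 * real (m - 1) * (\<integral>w. ?h w * w * ?r1 w \<partial>lborel))"
    by (rule ennreal_leI[OF ineq])
  also have "\<dots> = of_nat (2 * (m - 1)) * (of_nat m * ratio_expectation n (m + 2) (\<lambda>w. ennreal (?h w)))"
    unfolding iV using pos by (simp add: ennreal_of_nat_eq_real_of_nat ennreal_mult[symmetric])
  also have "\<dots> = of_nat m * (of_nat (2 * (m - 1)) * ratio_expectation n (m + 2) (\<lambda>w. ennreal (?h w)))"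
    by (simp only: mult_ac)
  finally have "of_nat (m - 1) * ratio_expectation n (m + 2) (\<lambda>w. ennreal ((?h w)\<^sup>2)) + of_nat (4 * j) * ratio_expectation n m (\<lambda>w. ennreal (?h w))
    \<le> of_nat (2 * (m - 1)) * ratio_expectation n (m + 2) (\<lambda>w. ennreal (?h w))"
    by (subst (asm) ennreal_mult_le_mult_iff) (use m3 in auto)
  then show ?thesis by (simp add: m_def)
qed

section \<open>Moments of functions of \<open>W\<close> under the model\<close>

lemma measurable_vec_nth_compose [measurable (raw)]:
  fixes f :: "'a \<Rightarrow> real^'p"
  assumes [measurable]: "f \<in> borel_measurable M"
  shows "(\<lambda>x. f x $ k) \<in> borel_measurable M"
  by (simp add: cart_eq_inner_axis)

lemma AE_model:
  fixes \<theta> :: "real^'p"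
  assumes p: "CARD('p) \<ge> 2" and n: "n > 0" and s: "\<sigma> > 0"
  shows "AE z in model n \<theta> \<sigma>. fst z \<noteq> 0 \<and> snd z > 0"
proof -
  have 1: "AE x in spherical_normal \<theta> \<sigma>. x \<noteq> 0"
    unfolding spherical_normal_def by (subst AE_density) (auto intro: AE_mp[OF AE_lborel_singleton[of 0]])
  let ?N = "{z :: (real^'p) \<times> real. \<not> (fst z \<noteq> 0 \<and> snd z > 0)}"
  have N[measurable]: "?N \<in> sets (borel \<Otimes>\<^sub>M borel)"
  proof -
    have "{z \<in> space (borel \<Otimes>\<^sub>M borel). \<not> (fst z \<noteq> (0::real^'p) \<and> snd z > (0::real))} \<in> sets (borel \<Otimes>\<^sub>M borel)"
      by measurable
    then show ?thesis
      by (simp only: space_pair_measure space_borel UNIV_Times_UNIV UNIV_I simp_thms)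
  qed
  have "emeasure (model n \<theta> \<sigma>) ?N = (\<integral>\<^sup>+z. indicator ?N z \<partial>model n \<theta> \<sigma>)"
    by (rule nn_integral_indicator[symmetric]) (simp only: sets_model N)
  also have "\<dots> = (\<integral>\<^sup>+x. \<integral>\<^sup>+v. indicator ?N (x, \<sigma> * v) \<partial>chi_square n \<partial>spherical_normal \<theta> \<sigma>)"
    by (rule nn_integral_model[OF n]) measurable
  also have "\<dots> = (\<integral>\<^sup>+x. \<integral>\<^sup>+v. 0 \<partial>chi_square n \<partial>spherical_normal \<theta> \<sigma>)"
  proof (rule nn_integral_cong_AE, use 1 in eventually_elim)
    fix x :: "real^'p" assume x: "x \<noteq> 0"
    show "(\<integral>\<^sup>+v. indicator ?N (x, \<sigma> * v) \<partial>chi_square n) = (\<integral>\<^sup>+v. 0 \<partial>chi_square n)"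
      by (rule nn_integral_cong_AE, use AE_chi_square_pos in eventually_elim) (use x s in \<open>auto simp: indicator_def\<close>)
  qed
  finally have "?N \<in> null_sets (model n \<theta> \<sigma>)"
    by (intro null_setsI) (simp_all only: sets_model N nn_integral_0_iff_AE nn_integral_const mult_zero_left)
  then show ?thesis by (rule AE_I') auto
qed

lemma nn_integral_model_norm:
  fixes \<theta> :: "real^'p"
  assumes p: "CARD('p) \<ge> 2" and n: "n > 0" and s: "\<sigma> > 0"
    and [measurable]: "case_prod F \<in> borel_measurable (borel \<Otimes>\<^sub>M borel)"
  shows "(\<integral>\<^sup>+z. F ((norm (fst z))\<^sup>2) (snd z) \<partial>model n \<theta> \<sigma>)
    = noncentral CARD('p) ((norm \<theta>)\<^sup>2 / \<sigma>) (\<lambda>t. \<integral>\<^sup>+v. F (\<sigma> * t) (\<sigma> * v) \<partial>chi_square n)"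
  using spherical_normal_norm[OF p s, of "\<lambda>t. \<integral>\<^sup>+v. F t (\<sigma> * v) \<partial>chi_square n" \<theta>]
  by (subst nn_integral_model[OF n]) auto

definition noncentral_ratio :: "nat \<Rightarrow> nat \<Rightarrow> real \<Rightarrow> (real \<Rightarrow> ennreal) \<Rightarrow> ennreal" where
  "noncentral_ratio n k l F = poisson_mix l (\<lambda>j. ratio_expectation n (k + 2 * j) F)"

lemma noncentral_ratio_eq: "noncentral k l (\<lambda>t. \<integral>\<^sup>+v. F (t / v) \<partial>chi_square n) = noncentral_ratio n k l F"
  by (simp add: noncentral_def noncentral_ratio_def ratio_expectation_def)

text \<open>The scale cancels in \<open>W\<close>, so averaging over \<open>S\<close> leaves a
  function of the squared norm to which the coordinate formulas apply. The signed moment again keeps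
  its two parts on opposite sides.\<close>

lemma nn_integral_model_W:
  fixes \<theta> :: "real^'p"
  assumes p: "CARD('p) \<ge> 2" and n: "n > 0" and s: "\<sigma> > 0" and [measurable]: "F \<in> borel_measurable borel"
  shows "(\<integral>\<^sup>+z. F (W_stat z) * ennreal ((fst z $ k)\<^sup>2) \<partial>model n \<theta> \<sigma>)
      = ennreal \<sigma> * noncentral_ratio n (CARD('p) + 2) ((norm \<theta>)\<^sup>2 / \<sigma>) F
        + ennreal ((\<theta> $ k)\<^sup>2) * noncentral_ratio n (CARD('p) + 4) ((norm \<theta>)\<^sup>2 / \<sigma>) F"
    and "(\<integral>\<^sup>+z. F (W_stat z) * ennreal (fst z $ k * \<theta> $ k) \<partial>model n \<theta> \<sigma>)
      = (\<integral>\<^sup>+z. F (W_stat z) * ennreal (- (fst z $ k * \<theta> $ k)) \<partial>model n \<theta> \<sigma>)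
        + ennreal ((\<theta> $ k)\<^sup>2) * noncentral_ratio n (CARD('p) + 2) ((norm \<theta>)\<^sup>2 / \<sigma>) F"
proof -
  let ?g = "\<lambda>t. \<integral>\<^sup>+v. F (t / (\<sigma> * v)) \<partial>chi_square n"
  have eq: "(\<integral>\<^sup>+z. F (W_stat z) * c (fst z) \<partial>model n \<theta> \<sigma>) = (\<integral>\<^sup>+x. ?g ((norm x)\<^sup>2) * c x \<partial>spherical_normal \<theta> \<sigma>)"
    if [measurable]: "c \<in> borel_measurable borel" for c :: "real^'p \<Rightarrow> ennreal"
  proof -
    have [measurable]: "W_stat \<in> borel_measurable (borel \<Otimes>\<^sub>M borel)"
      unfolding W_stat_def by measurable
    show ?thesis
      by (subst nn_integral_model[OF n]) (auto simp: W_stat_def nn_integral_multc)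
  qed
  show "(\<integral>\<^sup>+z. F (W_stat z) * ennreal ((fst z $ k)\<^sup>2) \<partial>model n \<theta> \<sigma>)
      = ennreal \<sigma> * noncentral_ratio n (CARD('p) + 2) ((norm \<theta>)\<^sup>2 / \<sigma>) F
        + ennreal ((\<theta> $ k)\<^sup>2) * noncentral_ratio n (CARD('p) + 4) ((norm \<theta>)\<^sup>2 / \<sigma>) F"
    using spherical_normal_second_moment[OF p s, of ?g \<theta> k]
    by (subst eq[of "\<lambda>x. ennreal ((x $ k)\<^sup>2)"]) (auto simp: s[THEN less_imp_neq, symmetric] noncentral_ratio_eq)
  show "(\<integral>\<^sup>+z. F (W_stat z) * ennreal (fst z $ k * \<theta> $ k) \<partial>model n \<theta> \<sigma>)
      = (\<integral>\<^sup>+z. F (W_stat z) * ennreal (- (fst z $ k * \<theta> $ k)) \<partial>model n \<theta> \<sigma>)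
        + ennreal ((\<theta> $ k)\<^sup>2) * noncentral_ratio n (CARD('p) + 2) ((norm \<theta>)\<^sup>2 / \<sigma>) F"
    using spherical_normal_signed_moment[OF p s, of ?g \<theta> k]
    unfolding eq[of "\<lambda>x. ennreal (x $ k * \<theta> $ k)", simplified] eq[of "\<lambda>x. ennreal (- (x $ k * \<theta> $ k))", simplified]
    by (auto simp: s[THEN less_imp_neq, symmetric] noncentral_ratio_eq)
qed

lemma nn_integral_model_variance:
  fixes \<theta> :: "real^'p"
  assumes p: "CARD('p) \<ge> 2" and n: "n > 0" and s: "\<sigma> > 0"
  shows "(\<integral>\<^sup>+z. ennreal ((fst z $ k - \<theta> $ k)\<^sup>2) \<partial>model n \<theta> \<sigma>) = ennreal \<sigma>"
  using prob_space.emeasure_space_1[OF prob_space_chi_square[OF n]]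
  by (subst nn_integral_model[OF n]) (auto simp: spherical_normal_variance[OF p s])

lemma nn_integral_model_translate:
  fixes \<theta> :: "real^'p"
  assumes n: "n > 0" and s: "\<sigma> > 0" and [measurable]: "F \<in> borel_measurable (borel \<Otimes>\<^sub>M borel)"
  shows "(\<integral>\<^sup>+z. F z \<partial>model n \<theta> \<sigma>) = (\<integral>\<^sup>+z. F (\<theta> + fst z, snd z) \<partial>model n 0 \<sigma>)"
  by (subst (1 2) nn_integral_model[OF n]) (auto simp: spherical_normal_translate[OF s, of _ \<theta>])

lemma nn_integral_model_orthogonal:
  fixes \<theta> :: "real^'p" and T :: "real^'p \<Rightarrow> real^'p"
  assumes n: "n > 0" and s: "\<sigma> > 0" and T: "orthogonal_transformation T"
    and [measurable]: "F \<in> borel_measurable (borel \<Otimes>\<^sub>M borel)"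
  shows "(\<integral>\<^sup>+z. F (T (fst z), snd z) \<partial>model n \<theta> \<sigma>) = (\<integral>\<^sup>+z. F z \<partial>model n (T \<theta>) \<sigma>)"
proof -
  have "linear T" using T by (rule orthogonal_transformation_linear)
  then have [measurable]: "T \<in> borel_measurable borel"
    by (intro borel_measurable_continuous_onI linear_continuous_on linear_conv_bounded_linear[THEN iffD1])
  show ?thesis
    by (subst (1 2) nn_integral_model[OF n]) (auto simp: spherical_normal_orthogonal[OF s T, of "\<lambda>x. \<integral>\<^sup>+v. F (x, \<sigma> * v) \<partial>chi_square n"])
qed

subsection \<open>The mean squared error on the complement of a line\<close>

text \<open>The type argument fixes the dimension. Nonnegativity of \<phi> and of each
  \<open>beta1_at\<close> are assumptions here; they are derived before the locale is
  interpreted.\<close>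

locale improving_shrinkage =
  fixes \<phi> :: "real \<Rightarrow> real" and n :: nat and P :: "'p::finite itself"
  assumes p: "CARD('p) \<ge> 3" and n: "n \<ge> 1"
    and lac: "locally_absolutely_continuous_on {0<..} \<phi>"
    and diff: "AE w in lborel. w > 0 \<longrightarrow> \<phi> differentiable (at w)"
    and nn: "\<And>w. w > 0 \<Longrightarrow> \<phi> w \<ge> 0"
    and imp: "improves_on n squared_error_loss (shrinkage \<phi> :: (real^'p) \<times> real \<Rightarrow> real^'p) fst"
    and int: "\<And>j. integrable (chi_square (CARD('p) + 2 * j) \<Otimes>\<^sub>M chi_square n) (beta1_integrand CARD('p) n \<phi> j)"
    and beta: "\<And>j. beta1_at CARD('p) n \<phi> j \<ge> 0"
begin

abbreviation "hh \<equiv> hfun \<phi>"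

text \<open>Almost surely equal to the error of the shrinkage estimator, but measurable without
  exceptions because \<open>hh\<close> is Borel.\<close>

definition error :: "real^'p \<Rightarrow> (real^'p) \<times> real \<Rightarrow> real^'p" where
  "error \<theta> z = (1 - hh (W_stat z)) *\<^sub>R fst z - \<theta>"

lemma p2: "CARD('p) \<ge> 2" and n0: "n > 0" using p n by auto

lemma measurable_hh [measurable]: "hh \<in> borel_measurable borel"
  by (rule measurable_hfun[OF p n refl[of "CARD('p) + 2 * 0"] lac diff nn])

lemma hh_nonneg: "hh w \<ge> 0"
  by (rule hfun_nonneg[OF p n refl[of "CARD('p) + 2 * 0"] lac diff nn])

lemma hh_eq: "w > 0 \<Longrightarrow> hh w = \<phi> w / w"
  using hfun_def[OF p n refl[of "CARD('p) + 2 * 0"] lac diff nn] by simp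

lemma measurable_W_stat [measurable]: "W_stat \<in> borel_measurable (borel \<Otimes>\<^sub>M borel)"
  unfolding W_stat_def by measurable

lemma measurable_error [measurable]: "error \<theta> \<in> borel_measurable (borel \<Otimes>\<^sub>M borel)"
  unfolding error_def by measurable

lemma shrinkage_error:
  assumes "\<sigma> > 0"
  shows "AE z in model n \<theta> \<sigma>. shrinkage \<phi> z - \<theta> = error \<theta> z"
  using AE_model[OF p2 n0 assms, of \<theta>]
proof eventually_elim
  case (elim z)
  then have "W_stat z > 0" by (auto simp: W_stat_def case_prod_unfold)
  then show ?case by (simp add: shrinkage_def error_def hh_eq)
qed

lemma norm2_sum: "ennreal ((norm (x :: real^'p))\<^sup>2) = (\<Sum>k\<in>UNIV. ennreal ((x $ k)\<^sup>2))"
  by (simp add: norm_vec_def L2_set_def sum_nonneg sum_ennreal)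

text \<open>The vector h(W) X is the difference of X - \<theta> and the shrinkage error. Both have
  mean squared norm at most p \<sigma>, the second because the estimator improves on X (here
  \<sigma> is the variance). Squaring the triangle inequality doubles each, hence the 4.\<close>

lemma shrinkage_second_moment:
  fixes \<theta> :: "real^'p"
  assumes s: "\<sigma> > 0"
  shows "(\<integral>\<^sup>+z. ennreal ((hh (W_stat z))\<^sup>2) * ennreal ((norm (fst z))\<^sup>2) \<partial>model n \<theta> \<sigma>) \<le> ennreal (4 * real CARD('p) * \<sigma>)"
proof -
  have X: "(\<integral>\<^sup>+z. ennreal ((norm (fst z - \<theta>))\<^sup>2) \<partial>model n \<theta> \<sigma>) = ennreal (real CARD('p) * \<sigma>)"
    unfolding norm2_sum vector_minus_component using s
    by (subst nn_integral_sum) (auto simp: nn_integral_model_variance[OF p2 n0 s] ennreal_of_nat_eq_real_of_nat ennreal_mult)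
  have "(\<integral>\<^sup>+z. ennreal ((norm (error \<theta> z))\<^sup>2) \<partial>model n \<theta> \<sigma>) = risk n squared_error_loss (shrinkage \<phi>) \<theta> \<sigma>"
    unfolding risk_def squared_error_loss_def
    by (rule nn_integral_cong_AE) (use shrinkage_error[OF s, of \<theta>] in \<open>eventually_elim, simp\<close>)
  also have "\<dots> \<le> risk n squared_error_loss fst \<theta> \<sigma>"
    using imp s by (simp add: improves_on_def)
  also have "\<dots> = ennreal (real CARD('p) * \<sigma>)"
    using X by (simp add: risk_def squared_error_loss_def)
  finally have E: "(\<integral>\<^sup>+z. ennreal ((norm (error \<theta> z))\<^sup>2) \<partial>model n \<theta> \<sigma>) \<le> ennreal (real CARD('p) * \<sigma>)" .
  have "(\<integral>\<^sup>+z. ennreal ((hh (W_stat z))\<^sup>2) * ennreal ((norm (fst z))\<^sup>2) \<partial>model n \<theta> \<sigma>)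
    \<le> (\<integral>\<^sup>+z. 2 * ennreal ((norm (fst z - \<theta>))\<^sup>2) + 2 * ennreal ((norm (error \<theta> z))\<^sup>2) \<partial>model n \<theta> \<sigma>)"
  proof (rule nn_integral_mono, goal_cases)
    case (1 z)
    have "hh (W_stat z) *\<^sub>R fst z = (fst z - \<theta>) - error \<theta> z"
      by (simp add: error_def algebra_simps)
    then have "norm (hh (W_stat z) *\<^sub>R fst z) \<le> norm (fst z - \<theta>) + norm (error \<theta> z)"
      by (metis norm_triangle_ineq4)
    then have "(norm (hh (W_stat z) *\<^sub>R fst z))\<^sup>2 \<le> (norm (fst z - \<theta>) + norm (error \<theta> z))\<^sup>2"
      by (intro power_mono) auto
    also have "\<dots> \<le> 2 * (norm (fst z - \<theta>))\<^sup>2 + 2 * (norm (error \<theta> z))\<^sup>2"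
      using zero_le_power2[of "norm (fst z - \<theta>) - norm (error \<theta> z)"] by (simp add: power2_eq_square algebra_simps)
    finally have "(hh (W_stat z))\<^sup>2 * (norm (fst z))\<^sup>2 \<le> 2 * (norm (fst z - \<theta>))\<^sup>2 + 2 * (norm (error \<theta> z))\<^sup>2"
      by (simp add: power_mult_distrib)
    from ennreal_leI[OF this] show ?case
      by (simp add: ennreal_mult)
  qed
  also have "\<dots> = 2 * ennreal (real CARD('p) * \<sigma>) + 2 * (\<integral>\<^sup>+z. ennreal ((norm (error \<theta> z))\<^sup>2) \<partial>model n \<theta> \<sigma>)"
    by (subst nn_integral_add) (auto simp: nn_integral_cmult X)
  also have "\<dots> \<le> 2 * ennreal (real CARD('p) * \<sigma>) + 2 * ennreal (real CARD('p) * \<sigma>)"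
    using E by (intro add_left_mono mult_left_mono) auto
  also have "\<dots> = ennreal (4 * real CARD('p) * \<sigma>)"
    using s by (subst distrib_right[symmetric]) (simp add: ennreal_mult mult.assoc)
  finally show ?thesis .
qed

text \<open>Let \<theta> run to infinity along an axis. For fixed noise \<open>W\<close> tends to
  infinity, and h(W)^2 times the squared norm of X equals S \<phi>(W)^2 / W, which would diverge.
  Fatou's lemma contradicts the uniform bound of \<open>shrinkage_second_moment\<close>.\<close>

lemma no_fast_growth: "\<not> filterlim (\<lambda>w. (\<phi> w)\<^sup>2 / w) at_top at_top"
proof
  assume lim: "filterlim (\<lambda>w. (\<phi> w)\<^sup>2 / w) at_top at_top"
  obtain k :: 'p where True by simp
  define a :: "nat \<Rightarrow> real^'p" where "a i = real i *\<^sub>R axis k 1" for i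
  let ?F = "\<lambda>z::(real^'p) \<times> real. ennreal ((hh (W_stat z))\<^sup>2) * ennreal ((norm (fst z))\<^sup>2)"
  interpret M: prob_space "model n (0::real^'p) 1"
    by (rule prob_space_model[OF p2 n0]) simp
  have le: "(\<integral>\<^sup>+z. ?F (a i + fst z, snd z) \<partial>model n 0 1) \<le> ennreal (4 * real CARD('p))" for i
  proof -
    have "(\<integral>\<^sup>+z. ?F z \<partial>model n (a i) 1) = (\<integral>\<^sup>+z. ?F (a i + fst z, snd z) \<partial>model n 0 1)"
      by (rule nn_integral_model_translate[OF n0]) auto
    then show ?thesis using shrinkage_second_moment[of 1 "a i"] by simp
  qed
  have "AE z in model n (0::real^'p) 1. liminf (\<lambda>i. ?F (a i + fst z, snd z)) = \<top>"
    using AE_model[OF p2 n0 zero_less_one, of "0::real^'p"]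
  proof eventually_elim
    case (elim z)
    obtain x s where z: "z = (x, s)" by force
    with elim have s: "s > 0" by simp
    have "filterlim (\<lambda>i. norm (a i + x)) at_top sequentially"
    proof (rule filterlim_at_top_mono)
      show "filterlim (\<lambda>i. real i - norm x) at_top sequentially" by real_asymp
      show "\<forall>\<^sub>F i in sequentially. real i - norm x \<le> norm (a i + x)"
        using norm_diff_ineq[of "a i" x for i] by (intro always_eventually) (auto simp: a_def norm_Basis axis_in_Basis_iff)
    qed
    then have W: "filterlim (\<lambda>i. (norm (a i + x))\<^sup>2 / s) at_top sequentially"
      using s filterlim_tendsto_pos_mult_at_top[OF tendsto_const[of "1 / s"] _ filterlim_pow_at_top[of 2]]
      by auto
    have "filterlim (\<lambda>i. (\<phi> ((norm (a i + x))\<^sup>2 / s))\<^sup>2 / ((norm (a i + x))\<^sup>2 / s)) at_top sequentially"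
      by (rule filterlim_compose[OF lim W])
    then have "filterlim (\<lambda>i. s * ((\<phi> ((norm (a i + x))\<^sup>2 / s))\<^sup>2 / ((norm (a i + x))\<^sup>2 / s))) at_top sequentially"
      using s by (intro filterlim_tendsto_pos_mult_at_top[OF tendsto_const]) auto
    then have "((\<lambda>i. ennreal (s * ((\<phi> ((norm (a i + x))\<^sup>2 / s))\<^sup>2 / ((norm (a i + x))\<^sup>2 / s)))) \<longlongrightarrow> \<top>) sequentially"
      by (rule ennreal_tendsto_top_eq_at_top[THEN iffD2])
    moreover have "\<forall>\<^sub>F i in sequentially. ennreal (s * ((\<phi> ((norm (a i + x))\<^sup>2 / s))\<^sup>2 / ((norm (a i + x))\<^sup>2 / s))) = ?F (a i + fst z, snd z)"
      using filterlim_at_top_dense[THEN iffD1, OF W, rule_format, of 0]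
    proof eventually_elim
      case (elim i)
      define w where "w = (norm (a i + x))\<^sup>2 / s"
      have w: "w > 0" using elim by (simp add: w_def)
      have N: "(norm (a i + x))\<^sup>2 = s * w" using s by (simp add: w_def)
      have "hh (W_stat (a i + x, s)) = \<phi> w / w"
        using w by (simp add: W_stat_def hh_eq w_def)
      moreover have "s * ((\<phi> w)\<^sup>2 / w) = (\<phi> w / w)\<^sup>2 * (s * w)"
        using w by (simp add: power2_eq_square)
      ultimately show ?case
        unfolding z fst_conv snd_conv w_def[symmetric] N using s w by (simp add: ennreal_mult[symmetric])
    qed
    ultimately have "(\<lambda>i. ?F (a i + fst z, snd z)) \<longlonglongrightarrow> \<top>"
      by (rule Lim_transform_eventually)
    then show ?case by (simp add: lim_imp_Liminf)
  qed
  then have "(\<integral>\<^sup>+z. liminf (\<lambda>i. ?F (a i + fst z, snd z)) \<partial>model n 0 1) = (\<integral>\<^sup>+z. \<top> \<partial>model n (0::real^'p) 1)"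
    by (rule nn_integral_cong_AE)
  also have "\<dots> = \<top>" using M.emeasure_space_1 by simp
  finally have "\<top> \<le> liminf (\<lambda>i. \<integral>\<^sup>+z. ?F (a i + fst z, snd z) \<partial>model n 0 1)"
    using nn_integral_liminf[of "\<lambda>i z. ?F (a i + fst z, snd z)" "model n 0 1"] by simp
  also have "\<dots> \<le> liminf (\<lambda>i. ennreal (4 * real CARD('p)))"
    by (intro Liminf_mono always_eventually allI le)
  also have "\<dots> < \<top>" by (simp add: Liminf_const)
  finally show False by simp
qed

section \<open>Finiteness and inequalities for the Poisson mixtures\<close>

lemma poisson_mix_finite_term:
  assumes "l > 0" "poisson_mix l c < \<top>"
  shows "c j < \<top>"
proof -
  have "ennreal (poisson_weight l j) * c j < \<top>"
    using assms(2) unfolding poisson_mix_def by (rule ennreal_suminf_lessD)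
  moreover have "poisson_weight l j > 0" using assms by (simp add: poisson_weight_def)
  ultimately show ?thesis by (auto simp: ennreal_mult_less_top)
qed

lemma poisson_mix_0: "poisson_mix 0 c = c 0"
  unfolding poisson_mix_def by (subst suminf_finite[of "{0}"]) (auto simp: poisson_weight_def)

abbreviation "hE k \<equiv> ratio_expectation n k (\<lambda>w. ennreal (hh w))"
abbreviation "h2E k \<equiv> ratio_expectation n k (\<lambda>w. ennreal ((hh w)\<^sup>2))"
abbreviation "hN k l \<equiv> noncentral_ratio n k l (\<lambda>w. ennreal (hh w))"
abbreviation "h2N k l \<equiv> noncentral_ratio n k l (\<lambda>w. ennreal ((hh w)\<^sup>2))"

lemma second_moment_bound:
  fixes \<theta> :: "real^'p"
  assumes s: "\<sigma> > 0"
  shows "ennreal \<sigma> * h2N (CARD('p) + 2) ((norm \<theta>)\<^sup>2 / \<sigma>) + ennreal ((\<theta> $ k)\<^sup>2) * h2N (CARD('p) + 4) ((norm \<theta>)\<^sup>2 / \<sigma>) < \<top>"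
proof -
  have "(\<integral>\<^sup>+z. ennreal ((hh (W_stat z))\<^sup>2) * ennreal ((fst z $ k)\<^sup>2) \<partial>model n \<theta> \<sigma>)
    \<le> (\<integral>\<^sup>+z. ennreal ((hh (W_stat z))\<^sup>2) * ennreal ((norm (fst z))\<^sup>2) \<partial>model n \<theta> \<sigma>)"
  proof (intro nn_integral_mono mult_left_mono ennreal_leI)
    fix z :: "(real^'p) \<times> real"
    show "(fst z $ k)\<^sup>2 \<le> (norm (fst z))\<^sup>2"
      using component_le_norm_cart[of "fst z" k] by (metis abs_ge_zero power2_abs power_mono)
  qed auto
  also have "\<dots> \<le> ennreal (4 * real CARD('p) * \<sigma>)" by (rule shrinkage_second_moment[OF s])
  also have "\<dots> < \<top>" by simp
  finally show ?thesis
    by (subst (asm) nn_integral_model_W(1)[OF p2 n0 s]) auto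
qed

text \<open>With unit variance and a unit vector as mean the noncentrality is 1. Every Poisson index
  then has positive weight, so finiteness of the mixture gives that of each term.\<close>

lemma h2E_finite: "h2E (CARD('p) + 2 * j + 2) < \<top>"
proof -
  obtain k :: 'p where True by simp
  have "h2N (CARD('p) + 2) 1 < \<top>"
    using second_moment_bound[of 1 "axis k 1 :: real^'p" k] by (simp add: norm_Basis axis_in_Basis_iff)
  from poisson_mix_finite_term[OF zero_less_one this[unfolded noncentral_ratio_def], of j]
  show ?thesis by (simp add: add_ac)
qed

lemma hN_finite:
  fixes \<theta> :: "real^'p"
  assumes s: "\<sigma> > 0"
  defines "l \<equiv> (norm \<theta>)\<^sup>2 / \<sigma>"
  shows "h2N (CARD('p) + 2) l < \<top>" "h2N (CARD('p) + 4) l < \<top>" "hN (CARD('p) + 2) l < \<top>" "hN (CARD('p) + 4) l < \<top>"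
proof -
  have l: "l \<ge> 0" using s by (simp add: l_def)
  show a: "h2N (CARD('p) + 2) l < \<top>"
  proof -
    obtain k :: 'p where True by simp
    show ?thesis
      using second_moment_bound[OF s, of \<theta> k] s unfolding l_def by (auto simp: ennreal_mult_less_top)
  qed
  show b: "h2N (CARD('p) + 4) l < \<top>"
  proof (cases "\<theta> = 0")
    case True
    \<comment> \<open>At mean 0 the second moment bound has coefficient 0 in front of this term; but
      then the mixture consists of its index 0 alone.\<close>
    have "h2E (CARD('p) + 2 * 1 + 2) < \<top>" by (rule h2E_finite)
    then show ?thesis using True by (simp add: l_def noncentral_ratio_def poisson_mix_0 eval_nat_numeral)
  next
    case False
    then obtain k where "\<theta> $ k \<noteq> 0" by (auto simp: vec_eq_iff)
    then show ?thesis
      using second_moment_bound[OF s, of \<theta> k] unfolding l_def by (auto simp: ennreal_mult_less_top)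
  qed
  have "hN k l \<le> 1 + h2N k l" if "k > 0" for k
  proof -
    have "hE (k + 2 * j) \<le> 1 + h2E (k + 2 * j)" for j
    proof -
      have "hE (k + 2 * j) \<le> ratio_expectation n (k + 2 * j) (\<lambda>w. 1 + ennreal ((hh w)\<^sup>2))"
        unfolding ratio_expectation_def
      proof (intro nn_integral_mono)
        fix u v :: real
        have "hh (u / v) \<le> 1 + (hh (u / v))\<^sup>2"
          using zero_le_power2[of "hh (u / v) - 1"] hh_nonneg[of "u / v"] unfolding power2_diff by simp
        from ennreal_leI[OF this] show "ennreal (hh (u / v)) \<le> 1 + ennreal ((hh (u / v))\<^sup>2)" by simp
      qed
      also have "\<dots> = 1 + h2E (k + 2 * j)"
        unfolding ratio_expectation_def
        using that prob_space.emeasure_space_1[OF prob_space_chi_square[of n]] prob_space.emeasure_space_1[OF prob_space_chi_square[of "k + 2 * j"]] n0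
        by (simp add: nn_integral_add)
      finally show ?thesis .
    qed
    then have "hN k l \<le> poisson_mix l (\<lambda>j. 1 + h2E (k + 2 * j))"
      unfolding noncentral_ratio_def by (rule poisson_mix_mono)
    then show ?thesis by (simp add: poisson_mix_add poisson_mix_const l noncentral_ratio_def)
  qed
  from this[of "CARD('p) + 2"] this[of "CARD('p) + 4"] a b
  show "hN (CARD('p) + 2) l < \<top>" "hN (CARD('p) + 4) l < \<top>"
    by (auto simp: top.extremum_strict less_top[symmetric] top_unique)
qed

lemma hE_inequality:
  "of_nat (CARD('p) + 2 * j - 1) * h2E (CARD('p) + 2 * j + 2) + of_nat (4 * j) * hE (CARD('p) + 2 * j)
    \<le> of_nat (2 * (CARD('p) + 2 * j - 1)) * hE (CARD('p) + 2 * j + 2)"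
  by (rule ratio_expectation_inequality[OF p n lac diff nn no_fast_growth int beta h2E_finite])

text \<open>Both parts average \<open>hE_inequality\<close>. The first drops the term with
  \<open>4 * j\<close>. The second splits p + 2j - 1 into p - 1 and 2j, and
  \<open>poisson_mix_shift\<close> turns each factor 2j into \<open>l\<close> with a shifted
  index.\<close>

lemma hN_inequality:
  assumes l: "l \<ge> 0"
  shows "h2N (CARD('p) + 2) l \<le> 2 * hN (CARD('p) + 2) l"
    and "of_nat (CARD('p) - 1) * h2N (CARD('p) + 2) l + ennreal l * h2N (CARD('p) + 4) l + 2 * ennreal l * hN (CARD('p) + 2) l
      \<le> 2 * of_nat (CARD('p) - 1) * hN (CARD('p) + 2) l + 2 * ennreal l * hN (CARD('p) + 4) l"
proof -
  have idx: "CARD('p) + 2 + 2 * j = CARD('p) + 2 * j + 2" "CARD('p) + 2 * Suc j = CARD('p) + 2 + 2 * j"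
     "CARD('p) + 2 * Suc j + 2 = CARD('p) + 4 + 2 * j" for j by auto
  have "h2E (CARD('p) + 2 * j + 2) \<le> 2 * hE (CARD('p) + 2 * j + 2)" for j
  proof -
    let ?c = "of_nat (CARD('p) + 2 * j - 1) :: ennreal"
    have "?c * h2E (CARD('p) + 2 * j + 2) \<le> ?c * h2E (CARD('p) + 2 * j + 2) + of_nat (4 * j) * hE (CARD('p) + 2 * j)" by simp
    also have "\<dots> \<le> of_nat (2 * (CARD('p) + 2 * j - 1)) * hE (CARD('p) + 2 * j + 2)" by (rule hE_inequality)
    also have "\<dots> = ?c * (2 * hE (CARD('p) + 2 * j + 2))" by (simp only: of_nat_mult of_nat_numeral mult_ac)
    finally show ?thesis
      by (subst (asm) ennreal_mult_le_mult_iff) (use p in \<open>auto simp: of_nat_eq_0_iff\<close>)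
  qed
  then show "h2N (CARD('p) + 2) l \<le> 2 * hN (CARD('p) + 2) l"
    unfolding noncentral_ratio_def poisson_mix_cmult[symmetric] idx by (rule poisson_mix_mono)
  have sh: "ennreal l * h2N (CARD('p) + 4) l = poisson_mix l (\<lambda>j. of_nat (2 * j) * h2E (CARD('p) + 2 * j + 2))"
    "ennreal l * hN (CARD('p) + 4) l = poisson_mix l (\<lambda>j. of_nat (2 * j) * hE (CARD('p) + 2 * j + 2))"
    "ennreal l * hN (CARD('p) + 2) l = poisson_mix l (\<lambda>j. of_nat (2 * j) * hE (CARD('p) + 2 * j))"
    unfolding poisson_mix_shift[OF l] noncentral_ratio_def by (simp_all add: eval_nat_numeral)
  have two: "2 * poisson_mix l c = poisson_mix l (\<lambda>j. 2 * c j)" for c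
    by (rule poisson_mix_cmult[symmetric])
  have "of_nat (CARD('p) - 1) * h2N (CARD('p) + 2) l + ennreal l * h2N (CARD('p) + 4) l + 2 * (ennreal l * hN (CARD('p) + 2) l)
    = poisson_mix l (\<lambda>j. of_nat (CARD('p) - 1) * h2E (CARD('p) + 2 * j + 2) + of_nat (2 * j) * h2E (CARD('p) + 2 * j + 2) + 2 * (of_nat (2 * j) * hE (CARD('p) + 2 * j)))"
    unfolding sh two unfolding noncentral_ratio_def idx poisson_mix_cmult[symmetric] poisson_mix_add[symmetric] ..
  also have "\<dots> \<le> poisson_mix l (\<lambda>j. 2 * of_nat (CARD('p) - 1) * hE (CARD('p) + 2 * j + 2) + 2 * (of_nat (2 * j) * hE (CARD('p) + 2 * j + 2)))"
  proof (rule poisson_mix_mono)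
    fix j
    have e: "CARD('p) + 2 * j - 1 = (CARD('p) - 1) + 2 * j" using p by simp
    show "of_nat (CARD('p) - 1) * h2E (CARD('p) + 2 * j + 2) + of_nat (2 * j) * h2E (CARD('p) + 2 * j + 2) + 2 * (of_nat (2 * j) * hE (CARD('p) + 2 * j))
      \<le> 2 * of_nat (CARD('p) - 1) * hE (CARD('p) + 2 * j + 2) + 2 * (of_nat (2 * j) * hE (CARD('p) + 2 * j + 2))"
    proof -
      have c: "of_nat (CARD('p) - 1 + 2 * j) = (of_nat (CARD('p) - 1) + of_nat (2 * j) :: ennreal)"
        "of_nat (4 * j) = 2 * (of_nat (2 * j) :: ennreal)"
        "of_nat (2 * (CARD('p) - 1 + 2 * j)) = 2 * (of_nat (CARD('p) - 1) + of_nat (2 * j) :: ennreal)"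
        by (simp_all only: of_nat_mult of_nat_add of_nat_numeral) simp
      show ?thesis
        using hE_inequality[of j] unfolding e c by (simp only: distrib_right distrib_left mult.assoc)
    qed
  qed
  also have "\<dots> = 2 * of_nat (CARD('p) - 1) * hN (CARD('p) + 2) l + 2 * (ennreal l * hN (CARD('p) + 4) l)"
    unfolding sh two unfolding noncentral_ratio_def idx poisson_mix_cmult[symmetric] poisson_mix_add[symmetric] ..
  finally show "of_nat (CARD('p) - 1) * h2N (CARD('p) + 2) l + ennreal l * h2N (CARD('p) + 4) l + 2 * ennreal l * hN (CARD('p) + 2) l
      \<le> 2 * of_nat (CARD('p) - 1) * hN (CARD('p) + 2) l + 2 * ennreal l * hN (CARD('p) + 4) l"
    by (simp only: mult.assoc)
qed

text \<open>Expand the square of x - \<theta> - h x in one coordinate and move the terms with a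
  minus sign to the other side. The mixed term in x \<theta> has no fixed sign and is handled by the
  signed moment formula.\<close>

lemma error_component:
  fixes \<theta> :: "real^'p"
  assumes s: "\<sigma> > 0"
  defines "l \<equiv> (norm \<theta>)\<^sup>2 / \<sigma>"
  shows "(\<integral>\<^sup>+z. ennreal ((error \<theta> z $ k)\<^sup>2) \<partial>model n \<theta> \<sigma>)
      + 2 * (ennreal \<sigma> * hN (CARD('p) + 2) l + ennreal ((\<theta> $ k)\<^sup>2) * hN (CARD('p) + 4) l)
    = ennreal \<sigma> + 2 * (ennreal ((\<theta> $ k)\<^sup>2) * hN (CARD('p) + 2) l)
      + (ennreal \<sigma> * h2N (CARD('p) + 2) l + ennreal ((\<theta> $ k)\<^sup>2) * h2N (CARD('p) + 4) l)"
proof -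
  let ?M = "model n \<theta> \<sigma>"
  let ?h = "\<lambda>z::(real^'p) \<times> real. hh (W_stat z)"
  let ?y = "\<lambda>z::(real^'p) \<times> real. fst z $ k * \<theta> $ k"
  define A where "A = (\<integral>\<^sup>+z. ennreal ((error \<theta> z $ k)\<^sup>2) \<partial>?M)"
  define N where "N = (\<integral>\<^sup>+z. ennreal (?h z) * ennreal (- ?y z) \<partial>?M)"
  \<comment> \<open>As \<open>ennreal\<close> sends negative numbers to 0, only one of the two terms
    containing \<open>?y z\<close> is present, depending on its sign.\<close>
  have pt: "ennreal ((error \<theta> z $ k)\<^sup>2) + 2 * (ennreal (?h z) * ennreal ((fst z $ k)\<^sup>2)) + 2 * (ennreal (?h z) * ennreal (- ?y z))
    = ennreal ((fst z $ k - \<theta> $ k)\<^sup>2) + 2 * (ennreal (?h z) * ennreal (?y z)) + ennreal ((?h z)\<^sup>2) * ennreal ((fst z $ k)\<^sup>2)" for z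
  proof -
    have e: "(error \<theta> z $ k)\<^sup>2 + 2 * (?h z * (fst z $ k)\<^sup>2) = (fst z $ k - \<theta> $ k)\<^sup>2 + 2 * (?h z * ?y z) + (?h z)\<^sup>2 * (fst z $ k)\<^sup>2"
      by (simp add: error_def power2_eq_square algebra_simps)
    have 2: "2 * (ennreal a * ennreal b) = ennreal (2 * (a * b))" if "a \<ge> 0" for a b
      using that by (simp add: ennreal_mult')
    show ?thesis
    proof (cases "?y z \<ge> 0")
      case True
      then show ?thesis
        unfolding 2[OF hh_nonneg] using e hh_nonneg[of "W_stat z"]
        by (simp add: ennreal_mult[symmetric] ennreal_plus[symmetric] mult_nonneg_nonpos ennreal_neg del: ennreal_plus)
    next
      case False
      then have "(error \<theta> z $ k)\<^sup>2 + 2 * (?h z * (fst z $ k)\<^sup>2) + 2 * (?h z * (- ?y z)) = (fst z $ k - \<theta> $ k)\<^sup>2 + (?h z)\<^sup>2 * (fst z $ k)\<^sup>2"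
        using e by simp
      moreover have "?h z * (- ?y z) \<ge> 0" "2 * (?h z * ?y z) \<le> 0"
        using False hh_nonneg[of "W_stat z"] by (simp_all add: mult_nonneg_nonpos)
      ultimately show ?thesis
        unfolding 2[OF hh_nonneg] using hh_nonneg[of "W_stat z"]
        by (simp add: ennreal_mult[symmetric] ennreal_plus[symmetric] ennreal_neg del: ennreal_plus)
    qed
  qed
  have "A + 2 * (\<integral>\<^sup>+z. ennreal (?h z) * ennreal ((fst z $ k)\<^sup>2) \<partial>?M) + 2 * N =
    (\<integral>\<^sup>+z. ennreal ((error \<theta> z $ k)\<^sup>2) + 2 * (ennreal (?h z) * ennreal ((fst z $ k)\<^sup>2)) + 2 * (ennreal (?h z) * ennreal (- ?y z)) \<partial>?M)"
    by (simp add: nn_integral_add nn_integral_cmult A_def N_def)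
  also have "\<dots> = (\<integral>\<^sup>+z. ennreal ((fst z $ k - \<theta> $ k)\<^sup>2) + 2 * (ennreal (?h z) * ennreal (?y z)) + ennreal ((?h z)\<^sup>2) * ennreal ((fst z $ k)\<^sup>2) \<partial>?M)"
    by (simp only: pt)
  also have "\<dots> = ennreal \<sigma> + 2 * (\<integral>\<^sup>+z. ennreal (?h z) * ennreal (?y z) \<partial>?M) + (\<integral>\<^sup>+z. ennreal ((?h z)\<^sup>2) * ennreal ((fst z $ k)\<^sup>2) \<partial>?M)"
    by (simp add: nn_integral_add nn_integral_cmult nn_integral_model_variance[OF p2 n0 s])
  finally have eq: "A + 2 * (\<integral>\<^sup>+z. ennreal (?h z) * ennreal ((fst z $ k)\<^sup>2) \<partial>?M) + 2 * N
    = ennreal \<sigma> + 2 * (\<integral>\<^sup>+z. ennreal (?h z) * ennreal (?y z) \<partial>?M) + (\<integral>\<^sup>+z. ennreal ((?h z)\<^sup>2) * ennreal ((fst z $ k)\<^sup>2) \<partial>?M)" .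
  have h1: "(\<integral>\<^sup>+z. ennreal (?h z) * ennreal ((fst z $ k)\<^sup>2) \<partial>?M) = ennreal \<sigma> * hN (CARD('p) + 2) l + ennreal ((\<theta> $ k)\<^sup>2) * hN (CARD('p) + 4) l"
    unfolding l_def by (rule nn_integral_model_W(1)[OF p2 n0 s]) measurable
  have h2: "(\<integral>\<^sup>+z. ennreal ((?h z)\<^sup>2) * ennreal ((fst z $ k)\<^sup>2) \<partial>?M) = ennreal \<sigma> * h2N (CARD('p) + 2) l + ennreal ((\<theta> $ k)\<^sup>2) * h2N (CARD('p) + 4) l"
    unfolding l_def by (rule nn_integral_model_W(1)[OF p2 n0 s]) measurable
  have h3: "(\<integral>\<^sup>+z. ennreal (?h z) * ennreal (?y z) \<partial>?M) = N + ennreal ((\<theta> $ k)\<^sup>2) * hN (CARD('p) + 2) l"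
    unfolding l_def N_def by (rule nn_integral_model_W(2)[OF p2 n0 s]) measurable
  \<comment> \<open>The negative part of the mixed term occurs on both sides and can be cancelled
    once it is finite.\<close>
  have "N < \<top>"
  proof -
    interpret M: prob_space ?M by (rule prob_space_model[OF p2 n0 s])
    have "N \<le> (\<integral>\<^sup>+z. ennreal ((?h z)\<^sup>2) * ennreal ((fst z $ k)\<^sup>2) + ennreal ((\<theta> $ k)\<^sup>2) \<partial>?M)"
      unfolding N_def
    proof (rule nn_integral_mono, goal_cases)
      case (1 z)
      have "?h z * - ?y z \<le> (?h z * fst z $ k)\<^sup>2 + (\<theta> $ k)\<^sup>2"
        using zero_le_power2[of "?h z * fst z $ k + \<theta> $ k"] zero_le_power2[of "?h z * fst z $ k"] zero_le_power2[of "\<theta> $ k"]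
        unfolding power2_sum by (simp only: mult_minus_right mult.assoc)
      then have "?h z * - ?y z \<le> (?h z)\<^sup>2 * (fst z $ k)\<^sup>2 + (\<theta> $ k)\<^sup>2" by (simp add: power_mult_distrib)
      from ennreal_leI[OF this] show ?case
        unfolding ennreal_mult'[OF hh_nonneg] by (simp add: ennreal_mult)
    qed
    also have "\<dots> = (ennreal \<sigma> * h2N (CARD('p) + 2) l + ennreal ((\<theta> $ k)\<^sup>2) * h2N (CARD('p) + 4) l) + ennreal ((\<theta> $ k)\<^sup>2)"
      using M.emeasure_space_1 by (simp add: nn_integral_add h2)
    also have "\<dots> < \<top>"
      using second_moment_bound[OF s, of \<theta> k] by (simp add: l_def)
    finally show ?thesis .
  qed
  then have "2 * N \<noteq> \<top>" by (simp add: ennreal_mult_eq_top_iff)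
  moreover have "2 * N + (A + 2 * (ennreal \<sigma> * hN (CARD('p) + 2) l + ennreal ((\<theta> $ k)\<^sup>2) * hN (CARD('p) + 4) l))
    = 2 * N + (ennreal \<sigma> + 2 * (ennreal ((\<theta> $ k)\<^sup>2) * hN (CARD('p) + 2) l)
      + (ennreal \<sigma> * h2N (CARD('p) + 2) l + ennreal ((\<theta> $ k)\<^sup>2) * h2N (CARD('p) + 4) l))"
    using eq unfolding h1 h2 h3 by (simp add: distrib_left add_ac)
  ultimately show ?thesis
    unfolding A_def[symmetric] by (simp only: ennreal_add_left_cancel infinity_ennreal_def simp_thms)
qed

text \<open>The mean squared error of coordinate \<open>i\<close> is affine in
  \<open>(\<theta> $ i)\<^sup>2\<close>, so only the sum \<open>T\<close> of these squares over the
  other coordinates matters. It lies between 0 and \<open>\<sigma> * l\<close>, and the two parts of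
  \<open>hN_inequality\<close> are the claim at these two ends.\<close>

lemma error_complement_axis:
  fixes \<theta> :: "real^'p"
  assumes s: "\<sigma> > 0"
  shows "(\<integral>\<^sup>+z. ennreal ((norm (error \<theta> z))\<^sup>2 - (error \<theta> z $ k)\<^sup>2) \<partial>model n \<theta> \<sigma>) \<le> ennreal (real (CARD('p) - 1) * \<sigma>)"
proof -
  define l where "l = (norm \<theta>)\<^sup>2 / \<sigma>"
  have l: "l \<ge> 0" using s by (simp add: l_def)
  let ?I = "UNIV - {k}"
  let ?D = "\<lambda>i. \<integral>\<^sup>+z. ennreal ((error \<theta> z $ i)\<^sup>2) \<partial>model n \<theta> \<sigma>"
  have n2: "(norm (x :: real^'p))\<^sup>2 = (\<Sum>i\<in>UNIV. (x $ i)\<^sup>2)" for x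
    by (simp add: norm_vec_def L2_set_def sum_nonneg)
  have fin: "h2N (CARD('p) + 2) l < \<top>" "h2N (CARD('p) + 4) l < \<top>" "hN (CARD('p) + 2) l < \<top>" "hN (CARD('p) + 4) l < \<top>"
    unfolding l_def by (rule hN_finite[OF s])+
  have real: "\<exists>r\<ge>0. x = ennreal r" if "x < \<top>" for x
    using that by (cases x) auto
  obtain a2 where a2: "a2 \<ge> 0" "h2N (CARD('p) + 2) l = ennreal a2" using real[OF fin(1)] by blast
  obtain b2 where b2: "b2 \<ge> 0" "h2N (CARD('p) + 4) l = ennreal b2" using real[OF fin(2)] by blast
  obtain a1 where a1: "a1 \<ge> 0" "hN (CARD('p) + 2) l = ennreal a1" using real[OF fin(3)] by blast
  obtain b1 where b1: "b1 \<ge> 0" "hN (CARD('p) + 4) l = ennreal b1" using real[OF fin(4)] by blast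
  note r = a1(2) b1(2) a2(2) b2(2) and nonneg = a1(1) b1(1) a2(1) b2(1)
  have c: "(of_nat (CARD('p) - 1) :: ennreal) = ennreal (real (CARD('p) - 1))"
    by (rule ennreal_of_nat_eq_real_of_nat)
  have two: "2 * ennreal x = ennreal (2 * x)" for x
    by (simp add: ennreal_mult')
  have X: "a2 \<le> 2 * a1"
    using hN_inequality(1)[OF l] nonneg unfolding r two by (simp add: ennreal_le_iff)
  have Y: "real (CARD('p) - 1) * a2 + l * b2 + 2 * l * a1 \<le> 2 * real (CARD('p) - 1) * a1 + 2 * l * b1"
    using hN_inequality(2)[OF l] nonneg l unfolding r c two
    by (simp add: ennreal_mult[symmetric] ennreal_plus[symmetric] ennreal_le_iff del: ennreal_plus of_nat_diff)
  have "\<exists>d\<ge>0. ?D i = ennreal d \<and> d + 2 * (\<sigma> * a1 + (\<theta> $ i)\<^sup>2 * b1) = \<sigma> + 2 * ((\<theta> $ i)\<^sup>2 * a1) + (\<sigma> * a2 + (\<theta> $ i)\<^sup>2 * b2)" for i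
  proof -
    have eq: "?D i + ennreal (2 * (\<sigma> * a1 + (\<theta> $ i)\<^sup>2 * b1)) = ennreal (\<sigma> + 2 * ((\<theta> $ i)\<^sup>2 * a1) + (\<sigma> * a2 + (\<theta> $ i)\<^sup>2 * b2))"
      using error_component[OF s, of \<theta> i] nonneg s unfolding l_def[symmetric] r
      by (simp add: ennreal_mult[symmetric] ennreal_plus[symmetric] two del: ennreal_plus)
    then have "?D i < \<top>"
      by (metis ennreal_less_top ennreal_add_eq_top less_top)
    then obtain d where d: "d \<ge> 0" "?D i = ennreal d" using real by blast
    with eq show ?thesis using nonneg s
      by (intro exI[of _ d]) (simp add: ennreal_plus[symmetric] del: ennreal_plus)
  qed
  then obtain d where d: "\<And>i. d i \<ge> 0" "\<And>i. ?D i = ennreal (d i)"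
    "\<And>i. d i + 2 * (\<sigma> * a1 + (\<theta> $ i)\<^sup>2 * b1) = \<sigma> + 2 * ((\<theta> $ i)\<^sup>2 * a1) + (\<sigma> * a2 + (\<theta> $ i)\<^sup>2 * b2)" by metis
  define T where "T = (\<Sum>i\<in>?I. (\<theta> $ i)\<^sup>2)"
  have T: "0 \<le> T" "T \<le> \<sigma> * l"
    unfolding T_def l_def using s by (auto simp: n2 sum_nonneg intro!: sum_mono2)
  have d': "d i = \<sigma> * (1 - (2 * a1 - a2)) + (\<theta> $ i)\<^sup>2 * (b2 - 2 * b1 + 2 * a1)" for i
    using d(3)[of i] by (simp add: algebra_simps)
  have card: "card ?I = CARD('p) - 1" by (simp add: card_Diff_singleton)
  have sum: "(\<Sum>i\<in>?I. d i) = real (CARD('p) - 1) * \<sigma> - (\<sigma> * (real (CARD('p) - 1) * (2 * a1 - a2)) - T * (b2 - 2 * b1 + 2 * a1))"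
    unfolding d' sum.distrib T_def sum_distrib_right[symmetric] sum_constant card by (simp add: algebra_simps)
  have "T * (b2 - 2 * b1 + 2 * a1) \<le> \<sigma> * (real (CARD('p) - 1) * (2 * a1 - a2))"
  proof (cases "b2 - 2 * b1 + 2 * a1 \<ge> 0")
    case True
    have "T * (b2 - 2 * b1 + 2 * a1) \<le> \<sigma> * l * (b2 - 2 * b1 + 2 * a1)"
      by (intro mult_right_mono T True)
    also have "\<dots> = \<sigma> * (l * (b2 - 2 * b1 + 2 * a1))" by simp
    also have "\<dots> \<le> \<sigma> * (real (CARD('p) - 1) * (2 * a1 - a2))"
      using Y s by (intro mult_left_mono) (auto simp: algebra_simps)
    finally show ?thesis .
  next
    case False
    then have "T * (b2 - 2 * b1 + 2 * a1) \<le> 0" using T by (intro mult_nonneg_nonpos) auto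
    also have "\<dots> \<le> \<sigma> * (real (CARD('p) - 1) * (2 * a1 - a2))" using X s by (intro mult_nonneg_nonneg) auto
    finally show ?thesis .
  qed
  then have le: "(\<Sum>i\<in>?I. d i) \<le> real (CARD('p) - 1) * \<sigma>" unfolding sum by linarith
  have split: "(norm x)\<^sup>2 - (x $ k)\<^sup>2 = (\<Sum>i\<in>?I. (x $ i)\<^sup>2)" for x :: "real^'p"
    unfolding n2 by (simp add: sum_diff1)
  have "(\<integral>\<^sup>+z. ennreal ((norm (error \<theta> z))\<^sup>2 - (error \<theta> z $ k)\<^sup>2) \<partial>model n \<theta> \<sigma>) = (\<integral>\<^sup>+z. (\<Sum>i\<in>?I. ennreal ((error \<theta> z $ i)\<^sup>2)) \<partial>model n \<theta> \<sigma>)"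
    unfolding split by (intro nn_integral_cong sum_ennreal[symmetric]) simp
  also have "\<dots> = (\<Sum>i\<in>?I. ?D i)"
    by (rule nn_integral_sum) measurable
  also have "\<dots> = ennreal (\<Sum>i\<in>?I. d i)"
    unfolding d(2) by (rule sum_ennreal) (rule d(1))
  also have "\<dots> \<le> ennreal (real (CARD('p) - 1) * \<sigma>)" by (rule ennreal_leI[OF le])
  finally show ?thesis .
qed

text \<open>A rotation taking \<open>e\<close> to an axis commutes with the shrinkage, whose factor
  depends on the norm, and carries the model to the one with the rotated mean.\<close>

lemma error_complement:
  fixes \<theta> e :: "real^'p"
  assumes s: "\<sigma> > 0" and e: "norm e = 1"
  shows "(\<integral>\<^sup>+z. ennreal ((norm (error \<theta> z))\<^sup>2 - (e \<bullet> error \<theta> z)\<^sup>2) \<partial>model n \<theta> \<sigma>) \<le> ennreal (real (CARD('p) - 1) * \<sigma>)"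
proof -
  obtain k :: 'p where True by simp
  obtain T :: "real^'p \<Rightarrow> real^'p" where T: "orthogonal_transformation T" "T e = axis k 1"
    by (rule orthogonal_transformation_exists_1[of e "axis k 1"]) (use e in \<open>auto simp: norm_Basis axis_in_Basis_iff\<close>)
  have lin: "linear T" using T(1) by (rule orthogonal_transformation_linear)
  let ?F = "\<lambda>z. ennreal ((norm (error (T \<theta>) z))\<^sup>2 - (error (T \<theta>) z $ k)\<^sup>2)"
  have "error (T \<theta>) (T (fst z), snd z) = T (error \<theta> z)" for z
    by (simp add: error_def W_stat_def case_prod_unfold orthogonal_transformation_norm[OF T(1)] linear_diff[OF lin] linear_scale[OF lin])
  moreover have "T v $ k = e \<bullet> v" for v
    using T by (metis cart_eq_inner_axis inner_commute orthogonal_transformation_def)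
  ultimately have "(\<integral>\<^sup>+z. ennreal ((norm (error \<theta> z))\<^sup>2 - (e \<bullet> error \<theta> z)\<^sup>2) \<partial>model n \<theta> \<sigma>) = (\<integral>\<^sup>+z. ?F (T (fst z), snd z) \<partial>model n \<theta> \<sigma>)"
    by (simp add: orthogonal_transformation_norm[OF T(1)])
  also have "\<dots> = (\<integral>\<^sup>+z. ?F z \<partial>model n (T \<theta>) \<sigma>)"
    by (rule nn_integral_model_orthogonal[OF n0 s T(1)]) measurable
  also have "\<dots> \<le> ennreal (real (CARD('p) - 1) * \<sigma>)" by (rule error_complement_axis[OF s])
  finally show ?thesis .
qed

end

subsection \<open>Spectral form of the loss\<close>

lemma quadratic_form_outer: "x \<bullet> (outer d d *v x) = (x \<bullet> d)\<^sup>2" for x d :: "real^'p"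
proof -
  have "x \<bullet> (outer d d *v x) = (\<Sum>i\<in>UNIV. \<Sum>j\<in>UNIV. x $ i * (d $ i * d $ j * x $ j))"
    by (simp add: inner_vec_def matrix_vector_mult_def outer_def sum_distrib_left)
  moreover have "(x \<bullet> d)\<^sup>2 = (\<Sum>i\<in>UNIV. \<Sum>j\<in>UNIV. (x $ i * d $ i) * (x $ j * d $ j))"
    by (simp add: inner_vec_def power2_eq_square sum_product)
  ultimately show ?thesis by (simp add: mult_ac)
qed

lemma trace_outer: "trace (outer d d) = (norm d)\<^sup>2" for d :: "real^'p"
  unfolding power2_norm_eq_inner by (simp add: trace_def outer_def inner_vec_def)

text \<open>The integral of a non-integrable matrix is 0 by default. The facts needed about the MSE
  matrix hold for the zero matrix too, so each is proved in both cases.\<close>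

lemma mse_matrix_cases:
  fixes d :: "(real^'p) \<times> real \<Rightarrow> real^'p"
  obtains "mse_matrix n d \<theta> \<sigma> = 0" | "integrable (model n \<theta> \<sigma>) (\<lambda>z. outer (d z - \<theta>) (d z - \<theta>))"
proof (cases "integrable (model n \<theta> \<sigma>) (\<lambda>z. outer (d z - \<theta>) (d z - \<theta>))")
  case True
  then show thesis by (rule that(2))
next
  case False
  then have "mse_matrix n d \<theta> \<sigma> = 0"
    by (simp add: mse_matrix_def not_integrable_integral_eq)
  then show thesis by (rule that(1))
qed

text \<open>Trace, quadratic forms and differences of entries are linear in the matrix and pass
  under the integral; all information on the MSE matrix is obtained through such
  functionals.\<close>

lemma mse_matrix_linear_functional:
  fixes d :: "(real^'p) \<times> real \<Rightarrow> real^'p" and B :: "real^'p^'p \<Rightarrow> real"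
  assumes B: "linear B" and int: "integrable (model n \<theta> \<sigma>) (\<lambda>z. outer (d z - \<theta>) (d z - \<theta>))"
  shows "integrable (model n \<theta> \<sigma>) (\<lambda>z. B (outer (d z - \<theta>) (d z - \<theta>)))"
    and "B (mse_matrix n d \<theta> \<sigma>) = (\<integral>z. B (outer (d z - \<theta>) (d z - \<theta>)) \<partial>model n \<theta> \<sigma>)"
proof -
  have "bounded_linear B" using B by (simp add: linear_conv_bounded_linear)
  from integrable_bounded_linear[OF this int] integral_bounded_linear[OF this int]
  show "integrable (model n \<theta> \<sigma>) (\<lambda>z. B (outer (d z - \<theta>) (d z - \<theta>)))"
    and "B (mse_matrix n d \<theta> \<sigma>) = (\<integral>z. B (outer (d z - \<theta>) (d z - \<theta>)) \<partial>model n \<theta> \<sigma>)"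
    by (simp_all only: mse_matrix_def)
qed

lemma linear_quadratic_form: "linear (\<lambda>A :: real^'p^'p. x \<bullet> (A *v x))"
  by (intro linearI) (simp_all add: matrix_vector_mult_add_rdistrib inner_add_right scaleR_matrix_vector_assoc[symmetric])

lemma linear_trace: "linear (trace :: real^'p^'p \<Rightarrow> real)"
  by (intro linearI) (simp_all add: trace_def sum.distrib sum_distrib_left)

lemma mse_matrix_symmetric:
  fixes d :: "(real^'p) \<times> real \<Rightarrow> real^'p"
  shows "mse_matrix n d \<theta> \<sigma> $ i $ j = mse_matrix n d \<theta> \<sigma> $ j $ i"
proof (cases n d \<theta> \<sigma> rule: mse_matrix_cases)
  case 2
  have "linear (\<lambda>A :: real^'p^'p. A $ i $ j - A $ j $ i)" by (intro linearI) (simp_all add: algebra_simps)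
  from mse_matrix_linear_functional(2)[OF this 2] show ?thesis by (simp add: outer_def mult.commute)
qed simp

lemma mse_matrix_quadratic_form_nonneg: "x \<bullet> (mse_matrix n (d :: _ \<Rightarrow> real^'p) \<theta> \<sigma> *v x) \<ge> 0"
proof (cases n d \<theta> \<sigma> rule: mse_matrix_cases)
  case 2
  show ?thesis
    unfolding mse_matrix_linear_functional(2)[OF linear_quadratic_form 2] quadratic_form_outer by simp
qed simp

lemma mse_matrix_complement_nonneg:
  assumes "norm e = 1"
  shows "trace (mse_matrix n (d :: _ \<Rightarrow> real^'p) \<theta> \<sigma>) - e \<bullet> (mse_matrix n d \<theta> \<sigma> *v e) \<ge> 0"
proof (cases n d \<theta> \<sigma> rule: mse_matrix_cases)
  case 2
  have "(e \<bullet> v)\<^sup>2 \<le> (norm v)\<^sup>2" for v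
    using Cauchy_Schwarz_ineq[of e v] assms by (simp add: power2_norm_eq_inner norm_eq_1)
  then show ?thesis
    unfolding mse_matrix_linear_functional(2)[OF linear_compose_sub[OF linear_trace linear_quadratic_form] 2] quadratic_form_outer trace_outer
    by simp
qed (simp add: trace_def)

lemma (in improving_shrinkage) mse_matrix_complement_le:
  fixes \<theta> e :: "real^'p"
  assumes s: "\<sigma> > 0" and e: "norm e = 1"
  shows "trace (mse_matrix n (shrinkage \<phi>) \<theta> \<sigma>) - e \<bullet> (mse_matrix n (shrinkage \<phi>) \<theta> \<sigma> *v e) \<le> real (CARD('p) - 1) * \<sigma>"
proof (cases n "shrinkage \<phi> :: _ \<Rightarrow> real^'p" \<theta> \<sigma> rule: mse_matrix_cases)
  case 1
  then show ?thesis using s by (simp add: trace_def)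
next
  case 2
  let ?d = "\<lambda>z. shrinkage \<phi> z - \<theta>"
  note lin = linear_compose_sub[OF linear_trace linear_quadratic_form[of e]]
  note fn = mse_matrix_linear_functional[OF lin 2, unfolded quadratic_form_outer trace_outer]
  have cs: "(e \<bullet> v)\<^sup>2 \<le> (norm v)\<^sup>2" for v
    using Cauchy_Schwarz_ineq[of e v] e by (simp add: power2_norm_eq_inner norm_eq_1)
  have "ennreal (trace (mse_matrix n (shrinkage \<phi>) \<theta> \<sigma>) - e \<bullet> (mse_matrix n (shrinkage \<phi>) \<theta> \<sigma> *v e))
    = (\<integral>\<^sup>+z. ennreal ((norm (?d z))\<^sup>2 - (e \<bullet> ?d z)\<^sup>2) \<partial>model n \<theta> \<sigma>)"
    unfolding fn(2) by (rule nn_integral_eq_integral[symmetric, OF fn(1)]) (simp add: cs)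
  also have "\<dots> = (\<integral>\<^sup>+z. ennreal ((norm (error \<theta> z))\<^sup>2 - (e \<bullet> error \<theta> z)\<^sup>2) \<partial>model n \<theta> \<sigma>)"
    by (rule nn_integral_cong_AE) (use shrinkage_error[OF s, of \<theta>] in \<open>eventually_elim, simp\<close>)
  also have "\<dots> \<le> ennreal (real (CARD('p) - 1) * \<sigma>)" by (rule error_complement[OF s e])
  finally show ?thesis using s by (subst (asm) ennreal_le_iff) auto
qed

lemma trace_mult: "trace (A ** B) = (\<Sum>i\<in>UNIV. \<Sum>j\<in>UNIV. A $ i $ j * B $ j $ i)" for A B :: "real^'p^'p"
  by (simp add: trace_def matrix_matrix_mult_def)

lemma trace_square_nonneg:
  fixes A :: "real^'p^'p"
  assumes "\<And>i j. A $ i $ j = A $ j $ i"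
  shows "trace (A ** A) \<ge> 0"
  unfolding trace_mult by (intro sum_nonneg, subst assms) simp

text \<open>In the trace inner product I - P and P are orthogonal with squared norms p - 1 and 1. Up
  to the constant tr(M M), the loss is a sum of separate quadratics in the two eigenvalues, with
  linear coefficients given by tr((I - P) M) and tr(P M).\<close>

lemma trace_spectral_square:
  fixes e :: "real^'p" and M :: "real^'p^'p" and a b :: real
  assumes e: "norm e = 1"
  defines "A \<equiv> a *\<^sub>R (mat 1 - outer e e) + b *\<^sub>R outer e e - M"
  shows "trace (A ** A) = a\<^sup>2 * (real CARD('p) - 1) + b\<^sup>2 - 2 * a * (trace M - e \<bullet> (M *v e)) - 2 * b * (e \<bullet> (M *v e)) + trace (M ** M)"
proof -
  let ?ip = "\<lambda>A B :: real^'p^'p. trace (A ** B)"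
  let ?I = "mat 1 :: real^'p^'p" and ?P = "outer e e"
  have ladd: "?ip (A + B) C = ?ip A C + ?ip B C" and radd: "?ip C (A + B) = ?ip C A + ?ip C B"
    and lsub: "?ip (A - B) C = ?ip A C - ?ip B C" and rsub: "?ip C (A - B) = ?ip C A - ?ip C B"
    and lscale: "?ip (r *\<^sub>R A) C = r * ?ip A C" and rscale: "?ip C (r *\<^sub>R A) = r * ?ip C A" for A B C r
    by (simp_all add: trace_mult algebra_simps sum.distrib sum_subtractf sum_distrib_left)
  have ee: "e \<bullet> e = 1" using e by (simp add: norm_eq_1)
  have II: "?ip ?I ?I = real CARD('p)" unfolding matrix_mul_lid by (simp add: trace_def mat_def)
  have IP: "?ip ?I ?P = 1" "?ip ?P ?I = 1" using e by (simp_all add: trace_outer)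
  have PP: "?ip ?P ?P = 1"
  proof -
    have "?ip ?P ?P = (e \<bullet> e) * (e \<bullet> e)"
      by (simp add: trace_mult outer_def inner_vec_def sum_product mult_ac)
    then show ?thesis by (simp add: ee)
  qed
  have IM: "?ip ?I M = trace M" "?ip M ?I = trace M" by simp_all
  have PM: "?ip ?P M = e \<bullet> (M *v e)" "?ip M ?P = e \<bullet> (M *v e)"
  proof -
    have 1: "e \<bullet> (M *v e) = (\<Sum>i\<in>UNIV. \<Sum>j\<in>UNIV. M $ i $ j * (e $ i * e $ j))"
      by (simp add: inner_vec_def matrix_vector_mult_def sum_distrib_left mult_ac)
    show "?ip M ?P = e \<bullet> (M *v e)"
      unfolding 1 by (simp add: trace_mult outer_def mult_ac)
    then show "?ip ?P M = e \<bullet> (M *v e)"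
      by (simp only: trace_mul_sym[of ?P M])
  qed
  show ?thesis
    unfolding A_def by (simp only: ladd radd lsub rsub lscale rscale II IP PP IM PM) (simp add: power2_eq_square algebra_simps)
qed

subsection \<open>Truncation\<close>

text \<open>For arbitrary \<open>f\<close> the integral is the supremum over simple functions below
  it, and to each of these the measurable \<open>a\<close> can be added. The losses call for this
  generality.\<close>

lemma nn_integral_superadditive:
  assumes [measurable]: "a \<in> borel_measurable M"
  shows "(\<integral>\<^sup>+x. f x \<partial>M) + (\<integral>\<^sup>+x. a x \<partial>M) \<le> (\<integral>\<^sup>+x. f x + a x \<partial>M)"
proof -
  have "(\<integral>\<^sup>+x. f x \<partial>M) + (\<integral>\<^sup>+x. a x \<partial>M) = (SUP g\<in>{g. simple_function M g \<and> g \<le> f}. integral\<^sup>S M g + (\<integral>\<^sup>+x. a x \<partial>M))"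
    unfolding nn_integral_def[of M f]
    by (rule ennreal_SUP_add_left[symmetric]) (auto intro!: exI[of _ "\<lambda>_. 0"] simp: le_fun_def)
  also have "\<dots> \<le> (\<integral>\<^sup>+x. f x + a x \<partial>M)"
  proof (rule SUP_least)
    fix g assume "g \<in> {g. simple_function M g \<and> g \<le> f}"
    then have g: "simple_function M g" "g \<le> f" by auto
    have [measurable]: "g \<in> borel_measurable M" using g(1) by (rule borel_measurable_simple_function)
    have "integral\<^sup>S M g + (\<integral>\<^sup>+x. a x \<partial>M) = (\<integral>\<^sup>+x. g x + a x \<partial>M)"
      by (simp add: nn_integral_add nn_integral_eq_simple_integral[OF g(1)])
    also have "\<dots> \<le> (\<integral>\<^sup>+x. f x + a x \<partial>M)"
      using g(2) by (intro nn_integral_mono add_right_mono) (auto simp: le_fun_def)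
    finally show "integral\<^sup>S M g + (\<integral>\<^sup>+x. a x \<partial>M) \<le> (\<integral>\<^sup>+x. f x + a x \<partial>M)" .
  qed
  finally show ?thesis .
qed

text \<open>If a simple function \<open>g\<close> lies below \<open>f + b\<close>, the truncated
  difference \<open>g - b\<close> is measurable and, \<open>b\<close> being finite, lies below
  \<open>f\<close>.\<close>

lemma nn_integral_subadditive:
  assumes [measurable]: "b \<in> borel_measurable M" and fin: "\<And>x. b x < \<top>"
  shows "(\<integral>\<^sup>+x. f x + b x \<partial>M) \<le> (\<integral>\<^sup>+x. f x \<partial>M) + (\<integral>\<^sup>+x. b x \<partial>M)"
  unfolding nn_integral_def[of M "\<lambda>x. f x + b x"]
proof (rule SUP_least)
  fix g assume "g \<in> {g. simple_function M g \<and> g \<le> (\<lambda>x. f x + b x)}"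
  then have g: "simple_function M g" "\<And>x. g x \<le> f x + b x" by (auto simp: le_fun_def)
  have [measurable]: "g \<in> borel_measurable M" using g(1) by (rule borel_measurable_simple_function)
  have "integral\<^sup>S M g = (\<integral>\<^sup>+x. g x \<partial>M)" by (simp add: nn_integral_eq_simple_integral[OF g(1)])
  also have "\<dots> \<le> (\<integral>\<^sup>+x. (g x - b x) + b x \<partial>M)"
    by (intro nn_integral_mono) (metis add.commute diff_add_self_ennreal order.refl linear add_increasing2 zero_le)
  also have "\<dots> = (\<integral>\<^sup>+x. g x - b x \<partial>M) + (\<integral>\<^sup>+x. b x \<partial>M)"
    by (rule nn_integral_add) measurable
  also have "(\<integral>\<^sup>+x. g x - b x \<partial>M) \<le> (\<integral>\<^sup>+x. f x \<partial>M)"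
  proof (rule nn_integral_mono, goal_cases)
    case (1 x)
    have "b x \<noteq> \<top>" using fin[of x] by auto
    then show ?case using g(2)[of x] by (simp add: ennreal_minus_le_iff add.commute)
  qed
  finally show "integral\<^sup>S M g \<le> (\<integral>\<^sup>+x. f x \<partial>M) + (\<integral>\<^sup>+x. b x \<partial>M)" by (simp add: add_right_mono)
qed

context improving_shrinkage
begin

text \<open>Conditionally on \<open>W\<close> and the mixing index \<open>j\<close>, the sum \<open>S + \<parallel>X\<parallel>\<^sup>2\<close> is a scaled chi-square
  variable with \<open>p + 2 j + n\<close> degrees of freedom; the size-biased version of it that occurs here
  has mean at least \<open>n + p + 2\<close>.\<close>

lemma truncation_gain:
  fixes \<theta> :: "real^'p"
  assumes s: "\<sigma> > 0" and [measurable]: "q \<in> borel_measurable borel" and q: "\<And>w. q w \<ge> 0"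
  defines "T \<equiv> \<lambda>z :: (real^'p) \<times> real. snd z * (1 + W_stat z) / (real n + real CARD('p) + 1)"
  shows "(\<integral>\<^sup>+z. ennreal (snd z * q (W_stat z)) * ennreal \<sigma> \<partial>model n \<theta> \<sigma>)
    \<le> (\<integral>\<^sup>+z. ennreal (snd z * q (W_stat z)) * ennreal (T z) \<partial>model n \<theta> \<sigma>)"
proof -
  let ?c = "real n + real CARD('p) + 1"
  let ?l = "(norm \<theta>)\<^sup>2 / \<sigma>"
  have c: "?c > 0" by simp
  have l: "?l \<ge> 0" using s by simp
  let ?F = "\<lambda>t r. ennreal (r * q (t / r)) * ennreal \<sigma>"
  let ?G = "\<lambda>t r. ennreal (r * q (t / r)) * ennreal (r * (1 + t / r) / ?c)"
  have F: "(\<integral>\<^sup>+z. ennreal (snd z * q (W_stat z)) * ennreal \<sigma> \<partial>model n \<theta> \<sigma>)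
    = noncentral CARD('p) ?l (\<lambda>t. \<integral>\<^sup>+v. ?F (\<sigma> * t) (\<sigma> * v) \<partial>chi_square n)"
    using nn_integral_model_norm[OF p2 n0 s, of ?F \<theta>] by (simp add: W_stat_def case_prod_unfold)
  have G: "(\<integral>\<^sup>+z. ennreal (snd z * q (W_stat z)) * ennreal (T z) \<partial>model n \<theta> \<sigma>)
    = noncentral CARD('p) ?l (\<lambda>t. \<integral>\<^sup>+v. ?G (\<sigma> * t) (\<sigma> * v) \<partial>chi_square n)"
    using nn_integral_model_norm[OF p2 n0 s, of ?G \<theta>] by (simp add: W_stat_def T_def case_prod_unfold)
  have "(\<integral>\<^sup>+t. \<integral>\<^sup>+v. ?F (\<sigma> * t) (\<sigma> * v) \<partial>chi_square n \<partial>chi_square m)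
    \<le> (\<integral>\<^sup>+t. \<integral>\<^sup>+v. ?G (\<sigma> * t) (\<sigma> * v) \<partial>chi_square n \<partial>chi_square m)" if m: "m = CARD('p) + 2 * j" for m j
  proof -
    have m0: "m > 0" using p m by simp
    \<comment> \<open>One factor \<open>v\<close> on this side and two on the other select the ratio
      weights of index 1 and 2, whose quotient is (m + n + 2) / (1 + w).\<close>
    have "(\<integral>\<^sup>+t. \<integral>\<^sup>+v. ?F (\<sigma> * t) (\<sigma> * v) \<partial>chi_square n \<partial>chi_square m)
      = (\<integral>\<^sup>+t. \<integral>\<^sup>+v. ennreal (\<sigma>\<^sup>2 * q (t / v)) * ennreal v ^ 1 \<partial>chi_square n \<partial>chi_square m)"
    proof (rule nn_integral_cong, rule nn_integral_cong_AE)
      fix t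
      show "AE v in chi_square n. ?F (\<sigma> * t) (\<sigma> * v) = ennreal (\<sigma>\<^sup>2 * q (t / v)) * ennreal v ^ 1"
        using AE_chi_square_pos
        by eventually_elim (use s q in \<open>simp add: ennreal_mult[symmetric] power2_eq_square mult_ac\<close>)
    qed
    also have "\<dots> = (\<integral>\<^sup>+w. ennreal (\<sigma>\<^sup>2 * q w) * ennreal (ratio_weight m n 1 w) \<partial>lborel)"
      by (rule nn_integral_ratio[OF m0 n0]) measurable
    also have "\<dots> \<le> (\<integral>\<^sup>+w. ennreal (\<sigma>\<^sup>2 * q w * (1 + w) / ?c) * ennreal (ratio_weight m n 2 w) \<partial>lborel)"
    proof (rule nn_integral_mono, goal_cases)
      case (1 w)
      show ?case
      proof (cases "w > 0")
        case True
        have e: "ratio_weight m n 2 w * (1 + w) = real (m + n + 2) * ratio_weight m n 1 w"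
          using ratio_weight_Suc[OF m0 n0, of 1 w] by (simp add: numeral_2_eq_2)
        \<comment> \<open>The factor \<open>m + n + 2\<close> exceeds \<open>?c\<close>, for
          \<open>m\<close> is at least the dimension.\<close>
        have "?c * ratio_weight m n 1 w \<le> real (m + n + 2) * ratio_weight m n 1 w"
          using m by (intro mult_right_mono ratio_weight_nonneg) auto
        then have "ratio_weight m n 1 w \<le> ratio_weight m n 2 w * (1 + w) / ?c"
          unfolding e using c by (simp add: pos_le_divide_eq mult.commute)
        then have "\<sigma>\<^sup>2 * q w * ratio_weight m n 1 w \<le> \<sigma>\<^sup>2 * q w * (ratio_weight m n 2 w * (1 + w) / ?c)"
          using q by (intro mult_left_mono) auto
        from ennreal_leI[OF this] show ?thesis
          using q True c by (simp add: ennreal_mult[symmetric] ratio_weight_nonneg mult_ac)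
      qed (simp add: ratio_weight_def)
    qed
    also have "\<dots> = (\<integral>\<^sup>+t. \<integral>\<^sup>+v. ennreal (\<sigma>\<^sup>2 * q (t / v) * (1 + t / v) / ?c) * ennreal v ^ 2 \<partial>chi_square n \<partial>chi_square m)"
      by (rule nn_integral_ratio[OF m0 n0, symmetric]) measurable
    also have "\<dots> = (\<integral>\<^sup>+t. \<integral>\<^sup>+v. ?G (\<sigma> * t) (\<sigma> * v) \<partial>chi_square n \<partial>chi_square m)"
    proof (rule nn_integral_cong_AE, use AE_chi_square_pos in eventually_elim)
      fix t :: real assume t: "0 < t"
      show "(\<integral>\<^sup>+v. ennreal (\<sigma>\<^sup>2 * q (t / v) * (1 + t / v) / ?c) * ennreal v ^ 2 \<partial>chi_square n) = (\<integral>\<^sup>+v. ?G (\<sigma> * t) (\<sigma> * v) \<partial>chi_square n)"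
      proof (rule nn_integral_cong_AE, use AE_chi_square_pos in eventually_elim)
        fix v :: real assume v: "0 < v"
        have "ennreal (\<sigma>\<^sup>2 * q (t / v) * (1 + t / v) / ?c) * ennreal v ^ 2 = ennreal (\<sigma>\<^sup>2 * q (t / v) * (1 + t / v) / ?c * v\<^sup>2)"
          using v by (subst ennreal_mult'') (simp_all add: ennreal_power)
        also have "\<sigma>\<^sup>2 * q (t / v) * (1 + t / v) / ?c * v\<^sup>2 = (\<sigma> * v * q (t / v)) * (\<sigma> * v * (1 + t / v) / ?c)"
          by (simp add: power2_eq_square)
        also have "ennreal \<dots> = ?G (\<sigma> * t) (\<sigma> * v)"
        proof -
          have "\<sigma> * t / (\<sigma> * v) = t / v" using s by simp
          then show ?thesis
            using s v t by (simp only:) (rule ennreal_mult'', simp)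
        qed
        finally show "ennreal (\<sigma>\<^sup>2 * q (t / v) * (1 + t / v) / ?c) * ennreal v ^ 2 = ?G (\<sigma> * t) (\<sigma> * v)" .
      qed
    qed
    finally show ?thesis .
  qed
  then show ?thesis
    unfolding F G noncentral_def by (intro poisson_mix_mono) blast
qed

lemma S_mean_finite: "\<sigma> > 0 \<Longrightarrow> (\<integral>\<^sup>+z. ennreal (snd z) \<partial>model n (\<theta> :: real^'p) \<sigma>) < \<top>"
proof -
  assume s: "\<sigma> > 0"
  interpret prob_space "spherical_normal \<theta> \<sigma>" by (rule prob_space_spherical_normal[OF p2 s])
  have "(\<integral>\<^sup>+v. ennreal (\<sigma> * v) \<partial>chi_square n) = ennreal \<sigma> * (\<integral>\<^sup>+v. 1 * ennreal v \<partial>chi_square n)"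
    using s by (subst nn_integral_cmult[symmetric]) (auto simp: ennreal_mult')
  also have "\<dots> = ennreal \<sigma> * of_nat n"
    using prob_space.emeasure_space_1[OF prob_space_chi_square[of "n + 2"]]
    by (subst nn_integral_chi_square_mult[OF n0]) auto
  finally have "(\<integral>\<^sup>+z. ennreal (snd z) \<partial>model n \<theta> \<sigma>) = ennreal \<sigma> * of_nat n"
    using emeasure_space_1 by (subst nn_integral_model[OF n0]) auto
  then show ?thesis by (simp add: ennreal_mult_less_top of_nat_less_top)
qed

end

text \<open>Here \<open>a0\<close> and \<open>b0\<close> are the eigenvalues of the unbiased
  estimator, \<open>c\<close> and \<open>b1\<close> are cut at 0, and \<open>a1\<close> is also cut
  at \<open>T\<close> from above. As k a^2 - 2 a Q is convex in a and Q is at most k \<sigma>, going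
  down from \<open>c\<close> to \<open>T\<close> lowers it by at least 2k (c - T)(T - \<sigma>).
  This number may be negative and is dealt with only after integration.\<close>

lemma truncation_pointwise:
  fixes Q R \<sigma> k a0 b0 T :: real
  assumes Q: "0 \<le> Q" "Q \<le> k * \<sigma>" and R: "0 \<le> R" and k: "k \<ge> 0" and T: "T \<ge> 0"
  defines "c \<equiv> max a0 0"
  defines "a1 \<equiv> min c T" and "b1 \<equiv> max b0 0" and "Y \<equiv> max (c - T) 0"
  shows "(a1\<^sup>2 * k + b1\<^sup>2 - 2 * a1 * Q - 2 * b1 * R) + 2 * k * (Y * T)
    \<le> (a0\<^sup>2 * k + b0\<^sup>2 - 2 * a0 * Q - 2 * b0 * R) + 2 * k * (Y * \<sigma>)"
proof -
  have b: "b1\<^sup>2 - 2 * b1 * R \<le> b0\<^sup>2 - 2 * b0 * R"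
  proof (cases "b0 \<ge> 0")
    case False
    then have "2 * b0 * R \<le> 0" using R by (simp add: mult_nonpos_nonneg)
    then have "0 \<le> b0\<^sup>2 - 2 * b0 * R" using zero_le_power2[of b0] by linarith
    moreover have "b1 = 0" using False by (simp add: b1_def)
    ultimately show ?thesis by simp
  qed (simp add: b1_def)
  have c: "c\<^sup>2 * k - 2 * c * Q \<le> a0\<^sup>2 * k - 2 * a0 * Q"
  proof (cases "a0 \<ge> 0")
    case False
    then have "a0 * Q \<le> 0" using Q(1) by (simp add: mult_nonpos_nonneg)
    moreover have "c = 0" "0 \<le> a0\<^sup>2 * k" using False k by (simp_all add: c_def)
    ultimately show ?thesis by (simp add: mult.assoc)
  qed (simp add: c_def)
  have a: "a1\<^sup>2 * k - 2 * a1 * Q + 2 * k * (Y * T) \<le> c\<^sup>2 * k - 2 * c * Q + 2 * k * (Y * \<sigma>)"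
  proof (cases "c \<le> T")
    case True
    then show ?thesis by (simp add: a1_def Y_def)
  next
    case False
    then have e: "a1 = T" "Y = c - T" by (auto simp: a1_def Y_def)
    have "2 * (c - T) * (Q - k * \<sigma>) \<le> 0"
      using False Q by (intro mult_nonneg_nonpos) auto
    also have "0 \<le> k * (c - T)\<^sup>2" using k by simp
    finally show ?thesis unfolding e by (simp add: power2_eq_square algebra_simps)
  qed
  from a b c show ?thesis by linarith
qed

text \<open>The cost \<open>b\<close> has a finite integral not above that of the gain
  \<open>a\<close>, so it cancels. Only gain and cost are measurable; \<open>f\<close> and
  \<open>g\<close> stand for the two losses.\<close>

lemma nn_integral_le_of_balance:
  assumes [measurable]: "a \<in> borel_measurable M" "b \<in> borel_measurable M"
    and le: "AE x in M. f x + a x \<le> g x + b x" and b: "\<And>x. b x < \<top>"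
    and ba: "(\<integral>\<^sup>+x. b x \<partial>M) \<le> (\<integral>\<^sup>+x. a x \<partial>M)" and fin: "(\<integral>\<^sup>+x. b x \<partial>M) < \<top>"
  shows "(\<integral>\<^sup>+x. f x \<partial>M) \<le> (\<integral>\<^sup>+x. g x \<partial>M)"
proof -
  have "(\<integral>\<^sup>+x. f x \<partial>M) + (\<integral>\<^sup>+x. b x \<partial>M) \<le> (\<integral>\<^sup>+x. f x \<partial>M) + (\<integral>\<^sup>+x. a x \<partial>M)"
    using ba by (rule add_left_mono)
  also have "\<dots> \<le> (\<integral>\<^sup>+x. f x + a x \<partial>M)" by (rule nn_integral_superadditive) measurable
  also have "\<dots> \<le> (\<integral>\<^sup>+x. g x + b x \<partial>M)" by (rule nn_integral_mono_AE[OF le])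
  also have "\<dots> \<le> (\<integral>\<^sup>+x. g x \<partial>M) + (\<integral>\<^sup>+x. b x \<partial>M)" by (rule nn_integral_subadditive[OF _ b]) measurable
  finally show ?thesis
    using fin by (metis add.commute ennreal_add_left_cancel_le infinity_ennreal_def less_irrefl)
qed

theorem theorem5:
  fixes \<phi> :: "real \<Rightarrow> real" and n :: nat
  assumes "CARD('p::finite) \<ge> 3"
    and "n \<ge> 1"
    and "locally_absolutely_continuous_on {0<..} \<phi>"
    and "AE w in lborel. w > 0 \<longrightarrow> \<phi> differentiable (at w)"
    and "improves_on n squared_error_loss
           (shrinkage \<phi> :: (real^'p) \<times> real \<Rightarrow> real^'p) fst"
    and "\<And>w. w > 0 \<Longrightarrow> g1 n \<phi> w > 0"
    and "antimono_on {0<..} (g1 n \<phi>)"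
    and "\<And>j. integrable (chi_square (CARD('p) + 2 * j) \<Otimes>\<^sub>M chi_square n)
           (beta1_integrand CARD('p) n \<phi> j)"
    and "beta1 CARD('p) n \<phi> \<ge> 0"
  shows "improves_on n
           (mse_matrix_loss n (shrinkage \<phi> :: (real^'p) \<times> real \<Rightarrow> real^'p))
           (M_hat n \<phi> (xi0 CARD('p) n \<phi>) (eta0 n \<phi>))
           (M_hat0 n \<phi>)"
proof -
  have nn: "\<phi> w \<ge> 0" if "w > 0" for w
    using nonneg_of_tail_transform_antimono[OF locally_absolutely_continuous_continuous[OF assms(3)] assms(6,7) _ that] assms(2) by simp
  have beta: "beta1_at CARD('p) n \<phi> j \<ge> 0" for j
    using order_trans[OF assms(9)[unfolded beta1_def] INF_lower[of j UNIV "\<lambda>j. ereal (beta1_at CARD('p) n \<phi> j)"]] by simp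
  interpret improving_shrinkage \<phi> n "TYPE('p)"
    by unfold_locales (use assms nn beta in auto)
  define c where "c = real n + real CARD('p) + 1"
  have c: "c > 0" by (simp add: c_def)
  define k where "k = real CARD('p) - 1"
  have k: "k \<ge> 0" "real (CARD('p) - 1) = k" using p by (auto simp: k_def)
  \<comment> \<open>The amount by which the eigenvalue on the complement of X, divided by S and
    already cut at 0, exceeds (1 + w)/c. The indicator discards \<open>g1\<close> outside the half
    line on which it is monotone.\<close>
  define q where "q w = max (max (1 / real n - indicator {0<..} w *\<^sub>R g1 n \<phi> w) 0 - (1 + w) / c) 0" for w
  have [measurable]: "(\<lambda>w. indicator {0<..} w *\<^sub>R g1 n \<phi> w) \<in> borel_measurable borel"
  proof -
    have "mono_on {0<..} (\<lambda>w. - g1 n \<phi> w)"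
      using assms(7) by (auto simp: monotone_on_def)
    then have "(\<lambda>w. - (- g1 n \<phi> w)) \<in> borel_measurable (restrict_space borel {0<..})"
      by (intro borel_measurable_uminus borel_measurable_mono_on_fnc)
    then show ?thesis by (subst (asm) borel_measurable_restrict_space_iff) auto
  qed
  have [measurable]: "q \<in> borel_measurable borel" unfolding q_def by measurable
  have q: "q w \<ge> 0" for w by (simp add: q_def)
  \<comment> \<open>Positivity of \<open>g1\<close> bounds the excess by 1/n, so the cost is at most
    a constant times S and has finite expectation.\<close>
  have q_le: "q w \<le> 1 / real n" if "w > 0" for w
  proof -
    have "(1 + w) / c \<ge> 0" "1 / real n \<ge> 0" using c that by auto
    then show ?thesis
      using assms(6)[OF that] that unfolding q_def by (simp add: max_def) linarith?
  qed
  show ?thesis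
    unfolding improves_on_def
  proof (intro allI impI)
    fix \<theta> :: "real^'p" and \<sigma> :: real assume s: "\<sigma> > 0"
    define M where "M = mse_matrix n (shrinkage \<phi>) \<theta> \<sigma>"
    let ?T = "\<lambda>z :: (real^'p) \<times> real. snd z * (1 + W_stat z) / c"
    let ?Y = "\<lambda>z :: (real^'p) \<times> real. snd z * q (W_stat z)"
    let ?gain = "\<lambda>z. ennreal (2 * k) * (ennreal (?Y z) * ennreal (?T z))" and ?cost = "\<lambda>z. ennreal (2 * k) * (ennreal (?Y z) * ennreal \<sigma>)"
    let ?L1 = "\<lambda>z. mse_matrix_loss n (shrinkage \<phi>) (M_hat n \<phi> (xi0 CARD('p) n \<phi>) (eta0 n \<phi>) z) \<theta> \<sigma>"
    let ?L0 = "\<lambda>z. mse_matrix_loss n (shrinkage \<phi>) (M_hat0 n \<phi> z) \<theta> \<sigma>"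
    have pos: "AE z in model n \<theta> \<sigma>. W_stat z > 0 \<and> fst z \<noteq> 0 \<and> snd z > 0"
      using AE_model[OF p2 n0 s, of \<theta>] by eventually_elim (auto simp: W_stat_def case_prod_unfold)
    have pointwise: "ennreal (?L1 z) + ?gain z \<le> ennreal (?L0 z) + ?cost z" if z: "W_stat z > 0 \<and> fst z \<noteq> 0 \<and> snd z > 0" for z
    proof -
      define w S e where "w = W_stat z" and "S = snd z" and "e = (1 / norm (fst z)) *\<^sub>R fst z"
      have w: "w > 0" and S: "S > 0" and e: "norm e = 1" using z by (auto simp: w_def S_def e_def)
      have P: "P_stat z = outer e e"
        by (simp add: P_stat_def e_def outer_def vec_eq_iff case_prod_unfold power2_eq_square)
      define g where "g = g1 n \<phi> w"
      have g: "g > 0" using assms(6)[OF w] by (simp add: g_def)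
      define R Q where "R = e \<bullet> (M *v e)" and "Q = trace M - e \<bullet> (M *v e)"
      have R: "R \<ge> 0" unfolding R_def M_def by (rule mse_matrix_quadratic_form_nonneg)
      have Q: "0 \<le> Q" "Q \<le> k * \<sigma>"
        unfolding Q_def M_def using mse_matrix_complement_nonneg[OF e] mse_matrix_complement_le[OF s e] k(2) by auto
      have loss: "mse_matrix_loss n (shrinkage \<phi>) (M_hat n \<phi> \<xi> \<eta> z) \<theta> \<sigma> = a\<^sup>2 * k + b\<^sup>2 - 2 * a * Q - 2 * b * R + trace (M ** M)"
        "mse_matrix_loss n (shrinkage \<phi>) (M_hat n \<phi> \<xi> \<eta> z) \<theta> \<sigma> \<ge> 0"
        if ab: "a = S * (1 / real n - g * \<xi> w)" "b = S * (1 / real n - g * \<eta> w + g3 n \<phi> w)" for \<xi> \<eta> a b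
      proof -
        have M: "M_hat n \<phi> \<xi> \<eta> z = a *\<^sub>R (mat 1 - outer e e) + b *\<^sub>R outer e e"
          unfolding M_hat_def Let_def P w_def[symmetric] S_def[symmetric] ab g_def
          by (simp add: scaleR_add_right)
        show "mse_matrix_loss n (shrinkage \<phi>) (M_hat n \<phi> \<xi> \<eta> z) \<theta> \<sigma> = a\<^sup>2 * k + b\<^sup>2 - 2 * a * Q - 2 * b * R + trace (M ** M)"
          unfolding mse_matrix_loss_def M_def[symmetric] M trace_spectral_square[OF e] by (simp add: Q_def R_def k_def)
        show "mse_matrix_loss n (shrinkage \<phi>) (M_hat n \<phi> \<xi> \<eta> z) \<theta> \<sigma> \<ge> 0"
          unfolding mse_matrix_loss_def M_def[symmetric] M
        proof (rule trace_square_nonneg)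
          fix i j
          have "M $ i $ j = M $ j $ i" unfolding M_def by (rule mse_matrix_symmetric)
          then show "(a *\<^sub>R (mat 1 - outer e e) + b *\<^sub>R outer e e - M) $ i $ j = (a *\<^sub>R (mat 1 - outer e e) + b *\<^sub>R outer e e - M) $ j $ i"
            by (simp add: outer_def mat_def mult.commute)
        qed
      qed
      let ?a0 = "S * (1 / real n - g)" and ?b0 = "S * (1 / real n - g + g3 n \<phi> w)" and ?t = "S * (1 + w) / c"
      have T: "?t \<ge> 0" using w S c by simp
      \<comment> \<open>Multiplying by \<open>g > 0\<close> clears the divisions in
        \<open>xi0\<close>. Subtracting from 1/n then turns the outer maximum into the cut at
        \<open>?t\<close> and the inner minimum into the cut at 0.\<close>
      have xi: "S * (1 / real n - g * xi0 CARD('p) n \<phi> w) = min (max ?a0 0) ?t"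
      proof -
        have "g * xi0 CARD('p) n \<phi> w = max (min g (1 / real n)) (1 / real n - (1 + w) / c)"
        proof -
          have "g * xi0 CARD('p) n \<phi> w = max (min (g * 1) (g * (1 / (real n * g)))) (g * (1 / g * (1 / real n - (1 + w) / c)))"
            using g unfolding xi0_def g_def[symmetric] c_def by (simp only: max_mult_distrib_left min_mult_distrib_left less_imp_le if_True add.assoc)
          then show ?thesis using g by simp
        qed
        then have "1 / real n - g * xi0 CARD('p) n \<phi> w = min (max (1 / real n - g) 0) ((1 + w) / c)"
          by (simp add: max_def min_def)
        then have "S * (1 / real n - g * xi0 CARD('p) n \<phi> w) = min (max (S * (1 / real n - g)) (S * 0)) (S * ((1 + w) / c))"
          using S by (simp only: max_mult_distrib_left min_mult_distrib_left less_imp_le if_True)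
        then show ?thesis by simp
      qed
      \<comment> \<open>In the same way the minimum in \<open>eta0\<close> becomes the cut of the
        eigenvalue along X at 0.\<close>
      have eta: "S * (1 / real n - g * eta0 n \<phi> w + g3 n \<phi> w) = max ?b0 0"
      proof -
        have "g * eta0 n \<phi> w = min (g * 1) (g * (1 / g * (1 / real n + g3 n \<phi> w)))"
          using g unfolding eta0_def g_def[symmetric] by (simp only: min_mult_distrib_left less_imp_le if_True)
        then have "1 / real n - g * eta0 n \<phi> w + g3 n \<phi> w = max (1 / real n - g + g3 n \<phi> w) 0"
          using g by (simp add: max_def min_def)
        then have "S * (1 / real n - g * eta0 n \<phi> w + g3 n \<phi> w) = max (S * (1 / real n - g + g3 n \<phi> w)) (S * 0)"
          using S by (simp only: max_mult_distrib_left less_imp_le if_True)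
        then show ?thesis by simp
      qed
      have Y: "?Y z = max (max ?a0 0 - ?t) 0"
      proof -
        have "?Y z = S * max (max (1 / real n - g) 0 - (1 + w) / c) 0"
          using w by (simp add: q_def w_def[symmetric] S_def g_def)
        also have "\<dots> = max (S * (max (1 / real n - g) 0 - (1 + w) / c)) (S * 0)"
          using S by (simp only: max_mult_distrib_left less_imp_le if_True)
        also have "S * (max (1 / real n - g) 0 - (1 + w) / c) = max ?a0 (S * 0) - S * ((1 + w) / c)"
          using S by (simp only: right_diff_distrib max_mult_distrib_left less_imp_le if_True)
        finally show ?thesis by simp
      qed
      have L1: "?L1 z = (min (max ?a0 0) ?t)\<^sup>2 * k + (max ?b0 0)\<^sup>2 - 2 * min (max ?a0 0) ?t * Q - 2 * max ?b0 0 * R + trace (M ** M)"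
        by (rule loss(1)) (simp_all only: xi eta)
      have L0: "?L0 z = ?a0\<^sup>2 * k + ?b0\<^sup>2 - 2 * ?a0 * Q - 2 * ?b0 * R + trace (M ** M)"
        unfolding M_hat0_def by (rule loss(1)) simp_all
      have nonneg: "?L1 z \<ge> 0" "?L0 z \<ge> 0"
        unfolding M_hat0_def by (rule loss(2); simp)+
      have Tz: "?T z = ?t" by (simp add: w_def S_def)
      \<comment> \<open>The trace of the squared target occurs in both losses and drops out.\<close>
      have le: "?L1 z + 2 * k * (?Y z * ?T z) \<le> ?L0 z + 2 * k * (?Y z * \<sigma>)"
        using truncation_pointwise[OF Q R k(1) T, of ?a0 ?b0] unfolding L1 L0 Tz Y by linarith
      have Yn: "?Y z \<ge> 0" using S q by (simp add: S_def)
      have conv: "ennreal x + ennreal (2 * k) * (ennreal y * ennreal u) = ennreal (x + 2 * k * (y * u))"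
        if "x \<ge> 0" "y \<ge> 0" "u \<ge> 0" for x y u
        using that k(1) by (simp add: ennreal_mult[symmetric] ennreal_plus[symmetric] del: ennreal_plus)
      have "ennreal (?L1 z) + ?gain z = ennreal (?L1 z + 2 * k * (?Y z * ?T z))"
        using nonneg Yn T unfolding Tz by (intro conv)
      also have "\<dots> \<le> ennreal (?L0 z + 2 * k * (?Y z * \<sigma>))" by (rule ennreal_leI[OF le])
      also have "\<dots> = ennreal (?L0 z) + ?cost z"
        using nonneg Yn s by (intro conv[symmetric]) auto
      finally show ?thesis .
    qed
    have le: "AE z in model n \<theta> \<sigma>. ennreal (?L1 z) + ?gain z \<le> ennreal (?L0 z) + ?cost z"
      using pos by eventually_elim (rule pointwise)
    show "risk n (mse_matrix_loss n (shrinkage \<phi>)) (M_hat n \<phi> (xi0 CARD('p) n \<phi>) (eta0 n \<phi>)) \<theta> \<sigma>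
      \<le> risk n (mse_matrix_loss n (shrinkage \<phi>)) (M_hat0 n \<phi>) \<theta> \<sigma>"
      unfolding risk_def
    proof (rule nn_integral_le_of_balance[OF _ _ le])
      show "?gain \<in> borel_measurable (model n \<theta> \<sigma>)" "?cost \<in> borel_measurable (model n \<theta> \<sigma>)" by measurable
      show "?cost z < \<top>" for z by (simp add: ennreal_mult_less_top)
      show "(\<integral>\<^sup>+z. ?cost z \<partial>model n \<theta> \<sigma>) \<le> (\<integral>\<^sup>+z. ?gain z \<partial>model n \<theta> \<sigma>)"
        using truncation_gain[where q = q and \<theta> = \<theta>, OF s _ q] unfolding c_def
        by (subst (1 2) nn_integral_cmult) (auto intro!: mult_left_mono)
      have "(\<integral>\<^sup>+z. ?cost z \<partial>model n \<theta> \<sigma>) \<le> (\<integral>\<^sup>+z. ennreal (2 * k * \<sigma> / real n) * ennreal (snd z) \<partial>model n \<theta> \<sigma>)"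
      proof (rule nn_integral_mono_AE, use pos in eventually_elim)
        case (elim z)
        have "2 * k * (?Y z * \<sigma>) \<le> 2 * k * (snd z * (1 / real n) * \<sigma>)"
          using elim k s q_le[of "W_stat z"] by (intro mult_left_mono mult_right_mono) auto
        moreover have "?cost z = ennreal (2 * k * (?Y z * \<sigma>))"
          using elim k(1) s q[of "W_stat z"] by (simp add: ennreal_mult[symmetric])
        moreover have "ennreal (2 * k * \<sigma> / real n) * ennreal (snd z) = ennreal (2 * k * (snd z * (1 / real n) * \<sigma>))"
          using elim k(1) s by (simp add: ennreal_mult[symmetric] mult_ac)
        ultimately show ?case by (simp only: ennreal_leI)
      qed
      also have "\<dots> = ennreal (2 * k * \<sigma> / real n) * (\<integral>\<^sup>+z. ennreal (snd z) \<partial>model n \<theta> \<sigma>)"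
        by (rule nn_integral_cmult) measurable
      also have "\<dots> < \<top>" using S_mean_finite[OF s, of \<theta>] by (simp add: ennreal_mult_less_top)
      finally show "(\<integral>\<^sup>+z. ?cost z \<partial>model n \<theta> \<sigma>) < \<top>" .
    qed
  qed
qed

end
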